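(* Let $d\ge1$, let $K:[0,1]\to\mathbb{R}^+$ be positive, decreasing and Lipschitz continuous with $\int_0^1K(z)\,dz=\gamma$. Let $f_0\in L^\infty(\mathbb{R}^d\times\mathbb{R}^d)$ be a probability density such that $\mathrm{supp}(f_0)\subset B_{R_x}\times B_{R_v}$, for some $R_x,R_v>0$. Given $T>0$, there exists a unique weak solution $f\in C_w\left([0,T];L^\infty(\mathbb{R}^d\times\mathbb{R}^d)\right)$, with initial datum $f_0$, of the topological Cucker-Smale equation $$\partial_t f_t+v\cdot\nabla_x f_t+\nabla_v\cdot\left(W[Sf_t,f_t](x,v)f_t\right)=0 .$$ Moreover, for every $t\in[0,T]$, $$\mathrm{supp}(f_t)\subset B_{R_x+tR_v}\times B_{R_v}.$$
   Context: $B_R$ is the closed ball of center $0$ and radius $R$ in $\mathbb{R}^d$. $Sf(x)=\int f(x,v)\,dv$ is the spatial marginal. For a probability density $\rho$ on $\mathbb{R}^d$ and a probability density $f$ on $\mathbb{R}^d\times\mathbb{R}^d$, $$W[\rho,f](x,v)=\int K\bigl(M[\rho](x,|x-y|)\bigr)(w-v)f(y,w)\,dy\,dw,\qquad M[\rho](x,r)=\int_{|x'-x|\le r}\rho(x')\,dx'.$$ $C_w([0,T];L^\infty(\mathbb{R}^d\times\mathbb{R}^d))$ is the set of families $\{f_t\}_{t\in[0,T]}$ of bounded probability densities that are weakly continuous in time in the sense of measures. Weak solution with initial datum $f_0$: $f_t$ is the push-forward of $f_0$ along the flow it generates, i.e. $\int\alpha(x,v)\,df_t(x,v)=\int\alpha(X_t(x,v),V_t(x,v))\,df_0(x,v)$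 for every $\alpha\in C_b(\mathbb{R}^d\times\mathbb{R}^d)$, where $$\dot X_t(x,v)=V_t(x,v),\quad \dot V_t(x,v)=W[Sf_t,f_t](X_t(x,v),V_t(x,v)),\quad X_0(x,v)=x,\ V_0(x,v)=v.$$ *)

theory Defs
  imports "HOL-Analysis.Analysis"
begin

text \<open>Elements of \<open>L\<^sup>\<infinity>\<close> are represented by Borel functions, identified up to Lebesgue-null
  sets; hence the almost-everywhere quantifiers below and in the uniqueness claim.\<close>

definition bounded_prob_density :: "('a::euclidean_space \<Rightarrow> real) \<Rightarrow> bool" where
  "bounded_prob_density f \<longleftrightarrow>
     (AE z in lborel. 0 \<le> f z) \<and> has_bochner_integral lborel f 1 \<and>
     (\<exists>C. AE z in lborel. f z \<le> C)"

text \<open>The support of the measure with density \<open>f\<close>: the complement of the largest open set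
  on which \<open>f\<close> vanishes almost everywhere.\<close>

definition ess_supp :: "('a::euclidean_space \<Rightarrow> real) \<Rightarrow> 'a set" where
  "ess_supp f = {z. \<forall>U. open U \<and> z \<in> U \<longrightarrow> \<not> (AE y in lborel. y \<in> U \<longrightarrow> f y = 0)}"

definition bounded_continuous :: "('a::euclidean_space \<Rightarrow> real) \<Rightarrow> bool" where
  "bounded_continuous \<alpha> \<longleftrightarrow> continuous_on UNIV \<alpha> \<and> bounded (range \<alpha>)"

text \<open>The space \<open>C\<^sub>w([0,T]; L\<^sup>\<infinity>)\<close>; the values of a family outside \<open>[0,T]\<close> are irrelevant.
  Each \<open>f t\<close> is bounded, with no uniformity in \<open>t\<close> required.\<close>

definition Cw_Linf :: "real \<Rightarrow> (real \<Rightarrow> 'a::euclidean_space \<Rightarrow> real) set" where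
  "Cw_Linf T = {f. (\<forall>t\<in>{0..T}. bounded_prob_density (f t)) \<and>
     (\<forall>\<alpha>. bounded_continuous \<alpha> \<longrightarrow> continuous_on {0..T} (\<lambda>t. \<integral>z. \<alpha> z * f t z \<partial>lborel))}"

definition marginal :: "('a::euclidean_space \<times> 'a \<Rightarrow> real) \<Rightarrow> 'a \<Rightarrow> real" where
  "marginal f x = (\<integral>v. f (x, v) \<partial>lborel)"

definition ball_mass :: "('a::euclidean_space \<Rightarrow> real) \<Rightarrow> 'a \<Rightarrow> real \<Rightarrow> real" where
  "ball_mass \<rho> x r = (LINT x':cball x r|lborel. \<rho> x')"

definition W_integrand ::
  "(real \<Rightarrow> real) \<Rightarrow> ('a::euclidean_space \<Rightarrow> real) \<Rightarrow> ('a \<times> 'a \<Rightarrow> real) \<Rightarrow> 'a \<Rightarrow> 'a \<Rightarrow> 'a \<times> 'a \<Rightarrow> 'a" where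
  "W_integrand K \<rho> f x v = (\<lambda>(y, w). (K (ball_mass \<rho> x (norm (x - y))) * f (y, w)) *\<^sub>R (w - v))"

definition W_field ::
  "(real \<Rightarrow> real) \<Rightarrow> ('a::euclidean_space \<Rightarrow> real) \<Rightarrow> ('a \<times> 'a \<Rightarrow> real) \<Rightarrow> 'a \<Rightarrow> 'a \<Rightarrow> 'a" where
  "W_field K \<rho> f x v = (\<integral>z. W_integrand K \<rho> f x v z \<partial>lborel)"

text \<open>The integrability clause says that the integral defining the velocity field
  converges; otherwise the Bochner integral would silently be \<open>0\<close>.\<close>

definition generated_flow ::
  "(real \<Rightarrow> real) \<Rightarrow> real \<Rightarrow> (real \<Rightarrow> 'a::euclidean_space \<times> 'a \<Rightarrow> real) \<Rightarrow>
    (real \<Rightarrow> 'a \<Rightarrow> 'a \<Rightarrow> 'a) \<Rightarrow> (real \<Rightarrow> 'a \<Rightarrow> 'a \<Rightarrow> 'a) \<Rightarrow> bool" where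
  "generated_flow K T f X V \<longleftrightarrow>
     (\<forall>x v. X 0 x v = x \<and> V 0 x v = v \<and>
       (\<forall>t\<in>{0..T}.
          integrable lborel (W_integrand K (marginal (f t)) (f t) (X t x v) (V t x v)) \<and>
          ((\<lambda>s. X s x v) has_vector_derivative V t x v) (at t within {0..T}) \<and>
          ((\<lambda>s. V s x v) has_vector_derivative
             W_field K (marginal (f t)) (f t) (X t x v) (V t x v)) (at t within {0..T})))"

definition weak_solution ::
  "(real \<Rightarrow> real) \<Rightarrow> real \<Rightarrow> ('a::euclidean_space \<times> 'a \<Rightarrow> real) \<Rightarrow>
    (real \<Rightarrow> 'a \<times> 'a \<Rightarrow> real) \<Rightarrow> bool" where
  "weak_solution K T f\<^sub>0 f \<longleftrightarrow>
     (\<exists>X V. generated_flow K T f X V \<and>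
       (\<forall>t\<in>{0..T}. \<forall>\<alpha>. bounded_continuous \<alpha> \<longrightarrow>
          (\<integral>z. \<alpha> z * f t z \<partial>lborel) =
          (\<integral>(x, v). \<alpha> (X t x v, V t x v) * f\<^sub>0 (x, v) \<partial>lborel)))"

end

theory Submission
  imports Defs "HOL-Probability.Probability_Measure"
begin

text \<open>The equation is solved on labels \<open>z = (x, v)\<close> distributed according to the initial measure
  \<open>M = f\<^sub>0 dz\<close>: a family of maps \<open>\<Phi>\<^sub>t\<close> with push-forwards \<open>f\<^sub>t\<close> is a solution iff it satisfies
  \<open>\<Phi>' = field \<Phi> \<Phi>\<close>, where the field at time \<open>t\<close> depends on \<open>\<Phi>\<^sub>t\<close> through the \<open>M\<close>-mass of balls. If the
  spatial push-forward of \<open>\<Phi>\<close> has a bounded density, moving all particles by at most \<open>D\<close> changes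
  the mass of a ball by at most that of a shell of width of order \<open>D\<close>; so the field is Lipschitz in the
  uniform distance, and here only one of the two maps compared needs a bounded density.

  For existence, a kick-drift Euler scheme is used: each step is a composition of a shear and a
  map affine in \<open>v\<close>, so its effect on Lebesgue measure is bounded by Fubini's theorem without any
  differentiability, and the density bound survives the dyadic limit. The limit satisfies the
  equation by a discrete Taylor estimate.

  For uniqueness, the competitor is compared with the constructed flow; what must be shown is
  that its velocities are bounded, which is not part of the assumptions. The convergence of
  \<open>W\<close> gives a finite first velocity moment at each time, and Baire's theorem turns this
  into a uniform bound.\<close>

subsection \<open>Bounded densities\<close>

text \<open>A circularity has to be broken: the field is Lipschitz only when positions have a
  bounded density, while controlling that density through the Jacobian of a flow would mean
  differentiating a field that is merely Lipschitz in \<open>x\<close>. The scheme breaks it because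
  its density bound is proved step by step, before any convergence is known. A bounded phase density
  gives a bounded spatial density since velocities never leave \<open>cball 0 R\<^sub>v\<close>: for
  \<open>h * K 0 \<le> 1\<close> a new velocity is an average of convex combinations of old ones.
  The same fact gives the support claim. A trajectory is required for every \<open>(x, v)\<close>,
  not only for those in the support of \<open>f\<^sub>0\<close>, and the constants depend on the
  size of the label. Hence the estimates live on bounded boxes of labels that carry
  \<open>M\<close>, and the results are glued afterwards. The densities of a competitor are bounded
  at each time with no uniformity in time. A Lipschitz constant built on them could not be used in a
  Gronwall argument, which is why the estimate must draw its density bound from the constructed flow
  alone.\<close>

lemma power_diff_le_mult:
  fixes a b :: real
  assumes "0 \<le> a" "a \<le> b"
  shows "b ^ n - a ^ n \<le> real n * (b - a) * b ^ (n - 1)"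
proof (induction n)
  case (Suc n)
  have "b ^ Suc n - a ^ Suc n = b * (b ^ n - a ^ n) + (b - a) * a ^ n"
    by (simp add: algebra_simps)
  also have "\<dots> \<le> b * (real n * (b - a) * b ^ (n - 1)) + (b - a) * b ^ n"
    using Suc assms by (intro add_mono mult_left_mono power_mono) auto
  also have "\<dots> = real (Suc n) * (b - a) * b ^ (Suc n - 1)"
    by (cases n) (auto simp: algebra_simps)
  finally show ?case .
qed simp

text \<open>Each point off the support has an open neighbourhood on which \<open>f\<close> vanishes
  almost everywhere. \<open>Lindelof\<close> leaves countably many of these, so their exceptional
  null sets can be united.\<close>

lemma AE_eq_0_outside_ess_supp:
  fixes f :: "'a::euclidean_space \<Rightarrow> real"
  shows "AE z in lborel. z \<notin> ess_supp f \<longrightarrow> f z = 0"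
proof -
  let ?F = "{U. open U \<and> (AE y in lborel. y \<in> U \<longrightarrow> f y = 0)}"
  obtain F' where F': "F' \<subseteq> ?F" "countable F'" "\<Union>F' = \<Union>?F"
    using Lindelof[of ?F] by auto
  have "AE z in lborel. \<forall>U\<in>F'. z \<in> U \<longrightarrow> f z = 0"
    using F' by (subst AE_ball_countable) auto
  moreover have "z \<notin> ess_supp f \<longrightarrow> f z = 0" if "\<forall>U\<in>F'. z \<in> U \<longrightarrow> f z = 0" for z
  proof
    assume "z \<notin> ess_supp f"
    then have "z \<in> \<Union>F'"
      unfolding F' ess_supp_def by auto
    with that show "f z = 0" by auto
  qed
  ultimately show ?thesis
    by (rule eventually_mono)
qed

lemma bounded_continuous_measurable:
  "bounded_continuous \<alpha> \<Longrightarrow> \<alpha> \<in> borel_measurable borel"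
  unfolding bounded_continuous_def by (simp add: borel_measurable_continuous_onI)

lemma bounded_continuous_bound:
  assumes "bounded_continuous \<alpha>"
  obtains B where "0 \<le> B" "\<And>z. \<bar>\<alpha> z\<bar> \<le> B"
  using assms unfolding bounded_continuous_def bounded_iff
  by (metis abs_ge_zero order_trans rangeI real_norm_def)

text \<open>Closed sets form an intersection-stable generator, and the indicator of a closed
  \<open>F\<close> is the pointwise limit of the continuous cut-offs
  \<open>max 0 (1 - n * infdist z F)\<close>, which lie between 0 and 1.\<close>

lemma measure_eqI_bounded_continuous:
  fixes P Q :: "'a::euclidean_space measure"
  assumes fin: "finite_measure P" "finite_measure Q"
    and sets: "sets P = sets borel" "sets Q = sets borel"
    and eq: "\<And>\<alpha>. bounded_continuous \<alpha> \<Longrightarrow> integral\<^sup>L P \<alpha> = integral\<^sup>L Q \<alpha>"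
  shows "P = Q"
proof -
  interpret P: finite_measure P by fact
  interpret Q: finite_measure Q by fact
  note [measurable_cong] = sets
  have closed_eq: "emeasure P F = emeasure Q F" if F: "closed F" for F
  \<comment> \<open>\<open>infdist z {}\<close> is 0 by convention, so for the empty set the
    cut-offs would be constantly 1.\<close>
  proof (cases "F = {}")
    case False
    define \<alpha> where "\<alpha> n z = max 0 (1 - real n * infdist z F)" for n z
    have bc: "bounded_continuous (\<alpha> n)" for n
    proof -
      have "\<bar>\<alpha> n z\<bar> \<le> 1" for z
        unfolding \<alpha>_def using infdist_nonneg[of z F] by (auto simp: max_def)
      moreover have "continuous_on UNIV (\<alpha> n)"
        unfolding \<alpha>_def by (intro continuous_intros)
      ultimately show ?thesis
        unfolding bounded_continuous_def bounded_iff by auto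
    qed
    have [measurable]: "\<alpha> n \<in> borel_measurable borel" for n
      using bc by (rule bounded_continuous_measurable)
    have [measurable]: "F \<in> sets borel"
      using F by simp
    have lim: "(\<lambda>n. \<alpha> n z) \<longlonglongrightarrow> indicator F z" for z
    proof (cases "z \<in> F")
      case True
      then show ?thesis by (simp add: \<alpha>_def)
    next
      case notin: False
      then have pos: "0 < infdist z F"
        using F False by (simp add: infdist_pos_not_in_closed)
      obtain N :: nat where "1 / infdist z F < real N"
        using reals_Archimedean2 by blast
      then have N: "1 < real N * infdist z F"
        using pos by (simp add: field_simps)
      have "\<alpha> n z = 0" if "n \<ge> N" for n
      proof -
        have "real N * infdist z F \<le> real n * infdist z F"
          using that pos by (intro mult_right_mono) auto
        with N show ?thesis by (simp add: \<alpha>_def)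
      qed
      then show ?thesis
        using notin by (intro tendsto_eventually) (auto simp: eventually_sequentially)
    qed
    have bd: "norm (\<alpha> n z) \<le> 1" for n z
      unfolding \<alpha>_def using infdist_nonneg[of z F] by (auto simp: max_def)
    have "(\<lambda>n. integral\<^sup>L P (\<alpha> n)) \<longlonglongrightarrow> integral\<^sup>L P (indicator F)"
      using lim bd by (intro integral_dominated_convergence[where w="\<lambda>_. 1"]) auto
    moreover have "(\<lambda>n. integral\<^sup>L Q (\<alpha> n)) \<longlonglongrightarrow> integral\<^sup>L Q (indicator F)"
      using lim bd by (intro integral_dominated_convergence[where w="\<lambda>_. 1"]) auto
    ultimately have "integral\<^sup>L P (indicator F :: _ \<Rightarrow> real) = integral\<^sup>L Q (indicator F)"
      using eq[OF bc] LIMSEQ_unique by simp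
    then show ?thesis
      using sets sets_eq_imp_space_eq[OF sets(1)] sets_eq_imp_space_eq[OF sets(2)]
      by (simp add: P.emeasure_eq_measure Q.emeasure_eq_measure)
  qed simp
  show ?thesis
  proof (rule measure_eqI_generator_eq[where E="Collect closed" and \<Omega>=UNIV and A="\<lambda>_. UNIV"])
    show "Int_stable (Collect closed)"
      by (auto simp: Int_stable_def)
    show "sets P = sigma_sets UNIV (Collect closed)" "sets Q = sigma_sets UNIV (Collect closed)"
      using sets by (simp_all add: borel_eq_closed)
  qed (use closed_eq in auto)
qed

text \<open>The hypothesis is tested on superlevel sets of \<open>g\<close>. The gap
  \<open>1 / Suc n\<close> above \<open>C\<close> contradicts it unless the set is null, and cutting
  with a ball makes the volume finite, so that it can be cancelled.\<close>

lemma AE_le_of_density_le: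
  fixes g :: "'a::euclidean_space \<Rightarrow> ennreal"
  assumes [measurable]: "g \<in> borel_measurable lborel" and C: "0 \<le> C"
    and le: "\<And>B. B \<in> sets borel \<Longrightarrow> emeasure (density lborel g) B \<le> ennreal C * emeasure lborel B"
  shows "AE z in lborel. g z \<le> ennreal C"
proof -
  define B where "B n = {z. ennreal (C + 1 / real (Suc n)) \<le> g z} \<inter> ball 0 (real (Suc n))" for n
  have [measurable]: "B n \<in> sets borel" for n
    unfolding B_def by measurable
  have null: "B n \<in> null_sets lborel" for n
  proof -
    have fin: "emeasure lborel (B n) < \<infinity>"
      using emeasure_mono[of "B n" "ball 0 (real (Suc n))" lborel]
      by (intro order.strict_trans1[OF _ emeasure_lborel_ball_finite]) (auto simp: B_def)
    have "ennreal (C + 1 / real (Suc n)) * emeasure lborel (B n)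
        = (\<integral>\<^sup>+z. ennreal (C + 1 / real (Suc n)) * indicator (B n) z \<partial>lborel)"
      by (simp add: nn_integral_cmult_indicator)
    also have "\<dots> \<le> (\<integral>\<^sup>+z. g z * indicator (B n) z \<partial>lborel)"
      by (intro nn_integral_mono) (auto simp: B_def indicator_def)
    also have "\<dots> = emeasure (density lborel g) (B n)"
      by (simp add: emeasure_density)
    also have "\<dots> \<le> ennreal C * emeasure lborel (B n)"
      by (intro le) simp
    finally have *: "ennreal (C + 1 / real (Suc n)) * emeasure lborel (B n)
        \<le> ennreal C * emeasure lborel (B n)" .
    obtain b where b: "emeasure lborel (B n) = ennreal b" "0 \<le> b"
      using fin by (cases "emeasure lborel (B n)") auto
    have "(C + 1 / real (Suc n)) * b \<le> C * b"
      using * C b by (simp add: ennreal_mult[symmetric] del: of_nat_Suc ennreal_plus)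
    then have "1 / real (Suc n) * b \<le> 0"
      by (simp add: algebra_simps)
    then have "b = 0"
      using b(2) by (simp add: field_simps)
    then show ?thesis
      using b by auto
  qed
  have "AE z in lborel. \<forall>n. z \<notin> B n"
    using null AE_not_in by (subst AE_all_countable) blast
  moreover have "g z \<le> ennreal C" if z: "\<forall>n. z \<notin> B n" for z
  proof (rule ccontr)
    assume "\<not> g z \<le> ennreal C"
    then have gz: "ennreal C < g z" by simp
    obtain e where e: "0 < e" "ennreal (C + e) \<le> g z"
    proof (cases "g z")
      case (real r)
      then show ?thesis
        using gz C that[of "r - C"] by (auto simp: ennreal_less_iff)
    next
      case top
      then show ?thesis using that[of 1] by simp
    qed
    obtain n1 where n1: "inverse (real (Suc n1)) < e"
      using reals_Archimedean[OF e(1)] by auto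
    obtain n2 :: nat where n2: "norm z < real n2"
      using reals_Archimedean2 by blast
    define n where "n = max n1 n2"
    have "1 / real (Suc n) \<le> inverse (real (Suc n1))"
      unfolding n_def by (simp add: field_simps)
    then have "ennreal (C + 1 / real (Suc n)) \<le> ennreal (C + e)"
      using n1 by (intro ennreal_leI) simp
    then have "z \<in> B n"
      using e n2 unfolding B_def n_def by auto
    then show False using z by blast
  qed
  ultimately show ?thesis
    by (rule eventually_mono)
qed

lemma bounded_prob_density_exists:
  fixes P :: "'a::euclidean_space measure"
  assumes P: "prob_space P" and sets: "sets P = sets borel" and C: "0 \<le> C"
    and le: "\<And>B. B \<in> sets borel \<Longrightarrow> emeasure P B \<le> ennreal C * emeasure lborel B"
  shows "\<exists>f. bounded_prob_density f \<and> density lborel (\<lambda>z. ennreal (f z)) = P"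
proof -
  interpret P: prob_space P by fact
  have "absolutely_continuous lborel P"
    unfolding absolutely_continuous_def
  proof
    fix N :: "'a set" assume "N \<in> null_sets lborel"
    then show "N \<in> null_sets P"
      using le[of N] sets by (auto simp: null_sets_def)
  qed
  then obtain g where g[measurable]: "g \<in> borel_measurable lborel" and dg: "density lborel g = P"
    using sigma_finite_measure.Radon_Nikodym[OF sigma_finite_lborel, of P] sets by auto
  have gC: "AE z in lborel. g z \<le> ennreal C"
    using C le dg by (intro AE_le_of_density_le) auto
  define f where "f z = enn2real (g z)" for z
  have [measurable]: "f \<in> borel_measurable lborel"
    unfolding f_def by measurable
  have fg: "AE z in lborel. ennreal (f z) = g z"
    using gC by eventually_elim (metis ennreal_enn2real ennreal_less_top f_def le_less_trans)
  have dens: "density lborel (\<lambda>z. ennreal (f z)) = P"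
    unfolding dg[symmetric] using fg by (intro density_cong) auto
  have "(\<integral>\<^sup>+z. ennreal (f z) \<partial>lborel) = emeasure (density lborel (\<lambda>z. ennreal (f z))) (space lborel)"
    by (subst emeasure_density) auto
  also have "\<dots> = 1"
    unfolding dens using P.emeasure_space_1 sets_eq_imp_space_eq[OF sets] by simp
  finally have "has_bochner_integral lborel f 1"
    by (intro has_bochner_integral_nn_integral) (auto simp: f_def)
  moreover have "AE z in lborel. f z \<le> C"
    using gC by eventually_elim (use C in \<open>auto simp: f_def intro: enn2real_leI\<close>)
  ultimately have "bounded_prob_density f"
    unfolding bounded_prob_density_def by (auto simp: f_def)
  with dens show ?thesis by blast
qed

lemma prob_space_bounded_prob_density:
  assumes "bounded_prob_density f"
  shows "prob_space (density lborel (\<lambda>z. ennreal (f z)))"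
proof
  have [measurable]: "f \<in> borel_measurable lborel" and "integrable lborel f" "integral\<^sup>L lborel f = 1"
    using assms by (auto simp: bounded_prob_density_def has_bochner_integral_iff)
  then show "emeasure (density lborel (\<lambda>z. ennreal (f z))) (space (density lborel (\<lambda>z. ennreal (f z)))) = 1"
    using assms by (simp add: emeasure_density nn_integral_eq_integral bounded_prob_density_def)
qed

lemma bounded_prob_density_measurable:
  "bounded_prob_density f \<Longrightarrow> f \<in> borel_measurable borel"
  by (auto simp: bounded_prob_density_def has_bochner_integral_iff)

lemma AE_eq_of_density_eq:
  assumes f: "bounded_prob_density f" and g: "bounded_prob_density g"
    and eq: "density lborel (\<lambda>z. ennreal (f z)) = density lborel (\<lambda>z. ennreal (g z))"
  shows "AE z in lborel. f z = g z"
proof -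
  note [measurable] = f[THEN bounded_prob_density_measurable] g[THEN bounded_prob_density_measurable]
  have "AE z in lborel. ennreal (f z) = ennreal (g z)"
    using eq by (subst (asm) sigma_finite_measure.density_unique_iff[OF sigma_finite_lborel]) auto
  moreover have "AE z in lborel. 0 \<le> f z" "AE z in lborel. 0 \<le> g z"
    using f g by (auto simp: bounded_prob_density_def)
  ultimately show ?thesis
    by eventually_elim (simp add: ennreal_inj)
qed

lemma ess_supp_subset_closed:
  fixes f :: "'a::euclidean_space \<Rightarrow> real"
  assumes f: "bounded_prob_density f" and S: "closed S"
    and AE: "AE z in density lborel (\<lambda>z. ennreal (f z)). z \<in> S"
  shows "ess_supp f \<subseteq> S"
proof
  fix z assume z: "z \<in> ess_supp f"
  note [measurable] = f[THEN bounded_prob_density_measurable]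
  have "AE y in lborel. 0 < ennreal (f y) \<longrightarrow> y \<in> S"
    using AE by (subst (asm) AE_density) auto
  moreover have "AE y in lborel. 0 \<le> f y"
    using f by (auto simp: bounded_prob_density_def)
  ultimately have "AE y in lborel. y \<in> - S \<longrightarrow> f y = 0"
    by eventually_elim (auto simp: less_le)
  then show "z \<in> S"
    using z S unfolding ess_supp_def by blast
qed

lemma emeasure_density_bound:
  assumes f: "bounded_prob_density f"
  obtains C where "0 \<le> C"
    "\<And>B. B \<in> sets borel \<Longrightarrow> emeasure (density lborel (\<lambda>z. ennreal (f z))) B \<le> ennreal C * emeasure lborel B"
proof -
  note [measurable] = f[THEN bounded_prob_density_measurable]
  obtain C where C: "AE z in lborel. f z \<le> C"
    using f by (auto simp: bounded_prob_density_def)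
  have "emeasure (density lborel (\<lambda>z. ennreal (f z))) B \<le> ennreal (max 0 C) * emeasure lborel B"
    if [measurable]: "B \<in> sets borel" for B
  proof -
    have "emeasure (density lborel (\<lambda>z. ennreal (f z))) B = (\<integral>\<^sup>+z. ennreal (f z) * indicator B z \<partial>lborel)"
      by (simp add: emeasure_density)
    also have "\<dots> \<le> (\<integral>\<^sup>+z. ennreal (max 0 C) * indicator B z \<partial>lborel)"
      using C by (intro nn_integral_mono_AE) (auto elim!: eventually_mono intro!: mult_right_mono ennreal_leI)
    finally show ?thesis by (simp add: nn_integral_cmult_indicator)
  qed
  then show thesis using that[of "max 0 C"] by auto
qed

lemma emeasure_indicator_comp:
  assumes [measurable]: "f \<in> borel_measurable M" "U \<in> sets borel"
  shows "(\<integral>\<^sup>+z. indicator U (f z) \<partial>M) = emeasure M {z \<in> space M. f z \<in> U}"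
proof -
  have "(\<integral>\<^sup>+z. indicator U (f z) \<partial>M) = (\<integral>\<^sup>+z. indicator {z \<in> space M. f z \<in> U} z \<partial>M)"
    by (intro nn_integral_cong) (simp add: indicator_def)
  then show ?thesis by simp
qed

text \<open>Fatou's lemma for open sets, whose indicators are lower semicontinuous, followed by
  outer regularity of Lebesgue measure. This is how a density bound survives a pointwise limit of
  maps.\<close>

lemma emeasure_distr_limit_le:
  fixes \<Phi> :: "nat \<Rightarrow> 'l \<Rightarrow> 'a::euclidean_space"
  assumes [measurable]: "\<And>n. \<Phi> n \<in> borel_measurable M" "\<Psi> \<in> borel_measurable M"
    and lim: "\<And>z. z \<in> space M \<Longrightarrow> (\<lambda>n. \<Phi> n z) \<longlonglongrightarrow> \<Psi> z"
    and le: "\<And>n B. B \<in> sets borel \<Longrightarrow> emeasure M {z \<in> space M. \<Phi> n z \<in> B} \<le> ennreal C * emeasure lborel B"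
    and C: "0 \<le> C" and B: "B \<in> sets borel"
  shows "emeasure M {z \<in> space M. \<Psi> z \<in> B} \<le> ennreal C * emeasure lborel B"
proof -
  have op: "emeasure M {z \<in> space M. \<Psi> z \<in> U} \<le> ennreal C * emeasure lborel U" if U: "open U" for U
  proof -
    have [measurable]: "U \<in> sets borel" using U by simp
    have "emeasure M {z \<in> space M. \<Psi> z \<in> U} = (\<integral>\<^sup>+z. indicator U (\<Psi> z) \<partial>M)"
      by (simp add: emeasure_indicator_comp)
    also have "\<dots> \<le> (\<integral>\<^sup>+z. liminf (\<lambda>n. indicator U (\<Phi> n z)) \<partial>M)"
    proof (intro nn_integral_mono)
      fix z assume z: "z \<in> space M"
      show "indicator U (\<Psi> z) \<le> liminf (\<lambda>n. indicator U (\<Phi> n z) :: ennreal)"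
      proof (cases "\<Psi> z \<in> U")
        case True
        then have "\<forall>\<^sub>F n in sequentially. \<Phi> n z \<in> U"
          using lim[OF z] U by (simp add: topological_tendstoD)
        then show ?thesis
          using True by (intro Liminf_bounded) (auto elim: eventually_mono)
      qed simp
    qed
    also have "\<dots> \<le> liminf (\<lambda>n. \<integral>\<^sup>+z. indicator U (\<Phi> n z) \<partial>M)"
      by (intro nn_integral_liminf) simp
    also have "(\<lambda>n. \<integral>\<^sup>+z. indicator U (\<Phi> n z) \<partial>M) = (\<lambda>n. emeasure M {z \<in> space M. \<Phi> n z \<in> U})"
      by (simp add: emeasure_indicator_comp)
    also have "liminf \<dots> \<le> ennreal C * emeasure lborel U"
      using le[of U] by (intro Liminf_le) auto
    finally show ?thesis .
  qed
  show ?thesis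
  proof (rule ennreal_le_epsilon)
    fix e :: real assume e: "0 < e"
    \<comment> \<open>Dividing by \<open>C + 1\<close> rather than \<open>C\<close> covers the case
      \<open>C = 0\<close>.\<close>
    obtain U where U: "open U" "B \<subseteq> U" "emeasure lborel (U - B) < ennreal (e / (C + 1))"
      using outer_regular_lborel[OF B, of "e / (C + 1)"] e C by auto
    have [measurable]: "U \<in> sets borel" "B \<in> sets borel" using U B by auto
    have "emeasure M {z \<in> space M. \<Psi> z \<in> B} \<le> emeasure M {z \<in> space M. \<Psi> z \<in> U}"
      using U by (intro emeasure_mono) auto
    also have "\<dots> \<le> ennreal C * emeasure lborel U" by (rule op) fact
    also have "emeasure lborel U = emeasure lborel B + emeasure lborel (U - B)"
      using U B by (subst plus_emeasure) (auto intro!: arg_cong[where f="emeasure lborel"])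
    also have "ennreal C * \<dots> = ennreal C * emeasure lborel B + ennreal C * emeasure lborel (U - B)"
      by (simp add: distrib_left)
    also have "ennreal C * emeasure lborel (U - B) \<le> ennreal C * ennreal (e / (C + 1))"
      using U by (intro mult_left_mono) auto
    also have "\<dots> = ennreal (C * (e / (C + 1)))"
      using C e by (subst ennreal_mult) auto
    also have "\<dots> \<le> ennreal e"
      using C e by (intro ennreal_leI) (simp add: field_simps)
    finally show "emeasure M {z \<in> space M. \<Psi> z \<in> B} \<le> ennreal C * emeasure lborel B + ennreal e"
      by (simp add: add_left_mono)
  qed
qed

subsection \<open>The alignment force\<close>

lemma borel_measurable_fst_comp[measurable (raw)]:
  fixes f :: "'l \<Rightarrow> 'a::topological_space \<times> 'b::topological_space"
  assumes "f \<in> borel_measurable M"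
  shows "(\<lambda>x. fst (f x)) \<in> borel_measurable M"
  using measurable_compose[OF assms borel_measurable_continuous_onI[OF continuous_on_fst[OF continuous_on_id]]]
  by simp

lemma borel_measurable_snd_comp[measurable (raw)]:
  fixes f :: "'l \<Rightarrow> 'a::topological_space \<times> 'b::topological_space"
  assumes "f \<in> borel_measurable M"
  shows "(\<lambda>x. snd (f x)) \<in> borel_measurable M"
  using measurable_compose[OF assms borel_measurable_continuous_onI[OF continuous_on_snd[OF continuous_on_id]]]
  by simp

locale topological_alignment = prob_space M for M :: "'l measure" +
  fixes K :: "real \<Rightarrow> real" and L :: real
  assumes K_pos: "\<And>z. z \<in> {0..1} \<Longrightarrow> 0 < K z"
    and K_decreasing: "antimono_on {0..1} K"
    and K_Lipschitz: "L-lipschitz_on {0..1} K"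
begin

text \<open>This is the ball mass \<open>M[Sf](x, r)\<close> for the push-forward under
  \<open>\<Phi>\<close>, written as a probability so that it makes sense without a density.\<close>

definition crowd :: "('l \<Rightarrow> 'a::euclidean_space \<times> 'a) \<Rightarrow> 'a \<Rightarrow> real \<Rightarrow> real" where
  "crowd \<Phi> x r = prob {\<eta> \<in> space M. dist x (fst (\<Phi> \<eta>)) \<le> r}"

text \<open>The integrand of \<open>W\<close> transported to labels; its mean \<open>force\<close>
  is \<open>W[Sf, f](x, v)\<close> when \<open>f\<close> is the density of the push-forward under
  \<open>\<Phi>\<close>.\<close>

definition pull :: "('l \<Rightarrow> 'a::euclidean_space \<times> 'a) \<Rightarrow> 'a \<Rightarrow> 'a \<Rightarrow> 'l \<Rightarrow> 'a" where
  "pull \<Phi> x v \<zeta> = K (crowd \<Phi> x (dist x (fst (\<Phi> \<zeta>)))) *\<^sub>R (snd (\<Phi> \<zeta>) - v)"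

definition force :: "('l \<Rightarrow> 'a::euclidean_space \<times> 'a) \<Rightarrow> 'a \<Rightarrow> 'a \<Rightarrow> 'a" where
  "force \<Phi> x v = (\<integral>\<zeta>. pull \<Phi> x v \<zeta> \<partial>M)"

text \<open>A bound \<open>C\<close> on the spatial density, phrased as domination of measures so
  that no density has to be chosen.\<close>

definition spatial_bound :: "real \<Rightarrow> ('l \<Rightarrow> 'a::euclidean_space \<times> 'a) \<Rightarrow> bool" where
  "spatial_bound C \<Phi> \<longleftrightarrow> \<Phi> \<in> borel_measurable M \<and>
    (\<forall>B\<in>sets borel. emeasure M {\<eta> \<in> space M. fst (\<Phi> \<eta>) \<in> B} \<le> ennreal C * emeasure lborel B)"

lemma crowd_in_unit: "crowd \<Phi> x r \<in> {0..1}"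
  unfolding crowd_def by simp

lemma K_antimonoD: "a \<in> {0..1} \<Longrightarrow> b \<in> {0..1} \<Longrightarrow> a \<le> b \<Longrightarrow> K b \<le> K a"
  using K_decreasing by (auto simp: monotone_on_def)

lemma K_le: "z \<in> {0..1} \<Longrightarrow> K z \<le> K 0"
  by (intro K_antimonoD) auto

lemma K_ge: "z \<in> {0..1} \<Longrightarrow> K 1 \<le> K z"
  by (intro K_antimonoD) auto

lemma K_0_pos: "0 < K 0" and K_1_pos: "0 < K 1"
  by (auto intro: K_pos)

lemma L_nonneg: "0 \<le> L"
  using K_Lipschitz by (rule lipschitz_on_nonneg)

lemma K_crowd_bounds: "0 < K (crowd \<Phi> x r)" "K (crowd \<Phi> x r) \<le> K 0" "K 1 \<le> K (crowd \<Phi> x r)"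
  using crowd_in_unit[of \<Phi> x r] by (auto intro: K_pos K_le K_ge simp del: atLeastAtMost_iff)

text \<open>\<open>crowd\<close> may jump in \<open>r\<close>, but it is increasing and
  \<open>K\<close> is decreasing, so the composition is monotone and therefore Borel.\<close>

lemma K_crowd_measurable:
  fixes \<Phi> :: "'l \<Rightarrow> 'a::euclidean_space \<times> 'a"
  assumes [measurable]: "\<Phi> \<in> borel_measurable M"
  shows "(\<lambda>r. K (crowd \<Phi> x r)) \<in> borel_measurable borel"
proof -
  have "crowd \<Phi> x r \<le> crowd \<Phi> x s" if "r \<le> s" for r s
    unfolding crowd_def using that by (intro finite_measure_mono) auto
  then have "mono (\<lambda>r. - K (crowd \<Phi> x r))"
    by (intro monoI) (auto intro!: K_antimonoD crowd_in_unit simp del: atLeastAtMost_iff)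
  then have "(\<lambda>r. - (- K (crowd \<Phi> x r))) \<in> borel_measurable borel"
    by (intro borel_measurable_uminus borel_measurable_mono)
  then show ?thesis by simp
qed

lemma K_crowd_comp_measurable[measurable (raw)]:
  assumes "\<Phi> \<in> borel_measurable M" "f \<in> borel_measurable N"
  shows "(\<lambda>y. K (crowd \<Phi> x (f y))) \<in> borel_measurable N"
  using measurable_compose[OF assms(2) K_crowd_measurable[OF assms(1)]] .

lemma pull_measurable[measurable (raw)]:
  assumes [measurable]: "\<Phi> \<in> borel_measurable M"
  shows "pull \<Phi> x v \<in> borel_measurable M"
  unfolding pull_def[abs_def] by measurable

lemma pull_bound: "norm (pull \<Phi> x v \<zeta>) \<le> K 0 * norm (snd (\<Phi> \<zeta>) - v)"
  unfolding pull_def using K_crowd_bounds[of \<Phi> x "dist x (fst (\<Phi> \<zeta>))"]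
  by (auto intro!: mult_right_mono)

lemma pull_integrable_moment:
  assumes [measurable]: "\<Phi> \<in> borel_measurable M" and int: "integrable M (\<lambda>\<eta>. snd (\<Phi> \<eta>))"
  shows "integrable M (pull \<Phi> x v)"
proof (rule Bochner_Integration.integrable_bound)
  show "integrable M (\<lambda>\<zeta>. K 0 * norm (snd (\<Phi> \<zeta>) - v))"
    using int by auto
  show "AE \<zeta> in M. norm (pull \<Phi> x v \<zeta>) \<le> norm (K 0 * norm (snd (\<Phi> \<zeta>) - v))"
    using pull_bound K_0_pos by (intro AE_I2) auto
qed simp

lemma pull_integrable:
  assumes [measurable]: "\<Phi> \<in> borel_measurable M" and S: "AE \<eta> in M. norm (snd (\<Phi> \<eta>)) \<le> S"
  shows "integrable M (pull \<Phi> x v)"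
  by (rule pull_integrable_moment[OF assms(1)], rule integrable_const_bound[where B=S]) (use S in auto)

text \<open>Since \<open>K \<ge> K 1 > 0\<close>, convergence of the force integral at one single
  point already forces a finite first velocity moment. For a competitor this is the only source of
  moment information.\<close>

lemma moment_integrable_of_pull:
  assumes [measurable]: "\<Phi> \<in> borel_measurable M" and int: "integrable M (pull \<Phi> x v)"
  shows "integrable M (\<lambda>\<eta>. snd (\<Phi> \<eta>))"
proof (rule Bochner_Integration.integrable_bound)
  show "integrable M (\<lambda>\<zeta>. norm (pull \<Phi> x v \<zeta>) / K 1 + norm v)"
    using int by auto
  show "AE \<zeta> in M. norm (snd (\<Phi> \<zeta>)) \<le> norm (norm (pull \<Phi> x v \<zeta>) / K 1 + norm v)"
  proof (intro AE_I2)
    fix \<zeta>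
    have "K 1 * norm (snd (\<Phi> \<zeta>) - v) \<le> norm (pull \<Phi> x v \<zeta>)"
      unfolding pull_def using K_crowd_bounds(1,3)[of \<Phi> x "dist x (fst (\<Phi> \<zeta>))"]
      by (simp add: mult_right_mono)
    then have "norm (snd (\<Phi> \<zeta>) - v) \<le> norm (pull \<Phi> x v \<zeta>) / K 1"
      using K_1_pos by (simp add: field_simps)
    moreover have "norm (snd (\<Phi> \<zeta>)) \<le> norm (snd (\<Phi> \<zeta>) - v) + norm v"
      using norm_triangle_sub[of "snd (\<Phi> \<zeta>)" v] by simp
    ultimately show "norm (snd (\<Phi> \<zeta>)) \<le> norm (norm (pull \<Phi> x v \<zeta>) / K 1 + norm v)"
      by simp
  qed
qed simp

text \<open>The spatial bound turns the probability into the volume of an annulus of width at most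
  \<open>2 * \<delta>\<close>, which \<open>power_diff_le_mult\<close> makes linear in
  \<open>\<delta>\<close>. The constant depends only on \<open>C\<close>, \<open>S\<close> and the
  dimension.\<close>

lemma shell_bound:
  assumes C: "0 \<le> C" and S: "0 \<le> S"
  obtains Q where "0 \<le> Q"
    "\<And>(\<Phi> :: 'l \<Rightarrow> 'a::euclidean_space \<times> 'a) x r \<delta>. spatial_bound C \<Phi> \<Longrightarrow> 0 \<le> r \<Longrightarrow> r \<le> S \<Longrightarrow> 0 \<le> \<delta> \<Longrightarrow>
      prob {\<eta> \<in> space M. \<bar>dist x (fst (\<Phi> \<eta>)) - r\<bar> \<le> \<delta>} \<le> Q * \<delta>"
proof -
  let ?d = "DIM('a)" and ?\<omega> = "unit_ball_vol (real DIM('a))"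
  \<comment> \<open>For \<open>\<delta> \<le> 1\<close> the outer radius is at most
    \<open>S + 1\<close>, which gives the second entry; for \<open>\<delta> > 1\<close> the trivial
    bound 1 on a probability is enough, which gives the first.\<close>
  define Q where "Q = max 1 (C * (?\<omega> * (real ?d * 2 * (S + 1) ^ (?d - 1))))"
  have "prob {\<eta> \<in> space M. \<bar>dist x (fst (\<Phi> \<eta>)) - r\<bar> \<le> \<delta>} \<le> Q * \<delta>"
    if \<Phi>: "spatial_bound C \<Phi>" and r: "0 \<le> r" "r \<le> S" and \<delta>: "0 \<le> \<delta>"
    for \<Phi> :: "'l \<Rightarrow> 'a \<times> 'a" and x r \<delta>
  proof (cases "\<delta> \<le> 1")
    case False
    have "prob {\<eta> \<in> space M. \<bar>dist x (fst (\<Phi> \<eta>)) - r\<bar> \<le> \<delta>} \<le> 1" by simp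
    also have "1 \<le> 1 * \<delta>" using False by simp
    also have "\<dots> \<le> Q * \<delta>" unfolding Q_def using \<delta> by (intro mult_right_mono) auto
    finally show ?thesis .
  next
    case True
    have [measurable]: "\<Phi> \<in> borel_measurable M" using \<Phi> by (simp add: spatial_bound_def)
    define a b where "a = max 0 (r - \<delta>)" and "b = r + \<delta>"
    have ab: "0 \<le> a" "a \<le> b" "b - a \<le> 2 * \<delta>" "b \<le> S + 1"
      using r \<delta> True by (auto simp: a_def b_def)
    let ?B = "cball x b - ball x a"
    have sub: "{\<eta> \<in> space M. \<bar>dist x (fst (\<Phi> \<eta>)) - r\<bar> \<le> \<delta>} \<subseteq> {\<eta> \<in> space M. fst (\<Phi> \<eta>) \<in> ?B}"
      by (auto simp: a_def b_def max_def not_less split: if_splits)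
    have "emeasure lborel ?B = emeasure lborel (cball x b) - emeasure lborel (ball x a)"
      using ab by (intro emeasure_Diff) (use emeasure_lborel_ball_finite[of x a] in auto)
    also have "\<dots> = ennreal (?\<omega> * b ^ ?d) - ennreal (?\<omega> * a ^ ?d)"
      using ab by (simp add: emeasure_cball emeasure_ball)
    also have "\<dots> = ennreal (?\<omega> * b ^ ?d - ?\<omega> * a ^ ?d)"
      using ab by (simp add: ennreal_minus)
    also have "?\<omega> * b ^ ?d - ?\<omega> * a ^ ?d \<le> ?\<omega> * (real ?d * (2 * \<delta>) * (S + 1) ^ (?d - 1))"
    proof -
      have "b ^ ?d - a ^ ?d \<le> real ?d * (b - a) * b ^ (?d - 1)"
        using ab by (intro power_diff_le_mult)
      also have "\<dots> \<le> real ?d * (2 * \<delta>) * (S + 1) ^ (?d - 1)"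
        using ab \<delta> by (intro mult_mono power_mono mult_left_mono) auto
      finally show ?thesis
        by (simp add: right_diff_distrib[symmetric] mult_left_mono del: mult.assoc)
    qed
    finally have vol: "emeasure lborel ?B \<le> ennreal (?\<omega> * (real ?d * (2 * \<delta>) * (S + 1) ^ (?d - 1)))"
      by (simp add: ennreal_leI)
    have "emeasure M {\<eta> \<in> space M. \<bar>dist x (fst (\<Phi> \<eta>)) - r\<bar> \<le> \<delta>} \<le> emeasure M {\<eta> \<in> space M. fst (\<Phi> \<eta>) \<in> ?B}"
      using sub by (intro emeasure_mono) auto
    also have "\<dots> \<le> ennreal C * emeasure lborel ?B"
      using \<Phi> unfolding spatial_bound_def by (elim conjE ballE[where x="?B"]) auto
    also have "\<dots> \<le> ennreal C * ennreal (?\<omega> * (real ?d * (2 * \<delta>) * (S + 1) ^ (?d - 1)))"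
      by (intro mult_left_mono vol) auto
    also have "\<dots> = ennreal (C * (?\<omega> * (real ?d * 2 * (S + 1) ^ (?d - 1))) * \<delta>)"
      using C S \<delta> by (subst ennreal_mult[symmetric]) (auto simp: algebra_simps)
    also have "\<dots> \<le> ennreal (Q * \<delta>)"
      unfolding Q_def using \<delta> by (intro ennreal_leI mult_right_mono) auto
    finally show ?thesis
      using \<delta> by (simp add: emeasure_eq_measure Q_def)
  qed
  moreover have "0 \<le> Q" by (simp add: Q_def)
  ultimately show thesis using that by blast
qed

text \<open>A label counted in one ball and not in the other must lie, for \<open>\<Phi>\<close>, in
  a shell around radius \<open>r\<close>. Moving labels and centre costs
  \<open>D + dist x x'\<close> and changing the radius as much again, hence the factor 2. The shell
  is that of \<open>\<Phi>\<close>, so the law of \<open>\<Psi>\<close> does not enter the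
  bound.\<close>

lemma crowd_diff:
  fixes \<Phi> \<Psi> :: "'l \<Rightarrow> 'a::euclidean_space \<times> 'a"
  assumes [measurable]: "\<Phi> \<in> borel_measurable M" "\<Psi> \<in> borel_measurable M"
    and D: "AE \<eta> in M. dist (\<Phi> \<eta>) (\<Psi> \<eta>) \<le> D" and r: "\<bar>r - r'\<bar> \<le> D + dist x x'"
  shows "\<bar>crowd \<Phi> x r - crowd \<Psi> x' r'\<bar>
    \<le> prob {\<eta> \<in> space M. \<bar>dist x (fst (\<Phi> \<eta>)) - r\<bar> \<le> 2 * (D + dist x x')}"
    (is "_ \<le> prob ?S")
proof -
  let ?A = "{\<eta> \<in> space M. dist x (fst (\<Phi> \<eta>)) \<le> r}"
  let ?B = "{\<eta> \<in> space M. dist x' (fst (\<Psi> \<eta>)) \<le> r'}"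
  have close: "AE \<eta> in M. \<bar>dist x (fst (\<Phi> \<eta>)) - dist x' (fst (\<Psi> \<eta>))\<bar> \<le> D + dist x x'"
    using D
  proof eventually_elim
    case (elim \<eta>)
    have "\<bar>dist x (fst (\<Phi> \<eta>)) - dist x' (fst (\<Psi> \<eta>))\<bar> \<le> dist x x' + dist (fst (\<Phi> \<eta>)) (fst (\<Psi> \<eta>))"
      by metric
    with elim dist_fst_le[of "\<Phi> \<eta>" "\<Psi> \<eta>"] show ?case by simp
  qed
  have imp: "\<eta> \<in> ?A \<longrightarrow> \<eta> \<in> ?B \<union> ?S" "\<eta> \<in> ?B \<longrightarrow> \<eta> \<in> ?A \<union> ?S"
    if "\<bar>dist x (fst (\<Phi> \<eta>)) - dist x' (fst (\<Psi> \<eta>))\<bar> \<le> D + dist x x'" for \<eta>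
    using that r unfolding abs_le_iff by (simp; arith)+
  have "AE \<eta> in M. \<eta> \<in> ?A \<longrightarrow> \<eta> \<in> ?B \<union> ?S" "AE \<eta> in M. \<eta> \<in> ?B \<longrightarrow> \<eta> \<in> ?A \<union> ?S"
    by (rule eventually_mono[OF close imp(1)], assumption, rule eventually_mono[OF close imp(2)], assumption)
  note mono = this[THEN finite_measure_mono_AE]
  have "prob ?A \<le> prob (?B \<union> ?S)"
    by (rule mono) measurable
  also have "\<dots> \<le> prob ?B + prob ?S"
    by (rule measure_Un_le) auto
  finally have 1: "prob ?A \<le> prob ?B + prob ?S" .
  have "prob ?B \<le> prob (?A \<union> ?S)"
    by (rule mono) measurable
  also have "\<dots> \<le> prob ?A + prob ?S"
    by (rule measure_Un_le) auto
  finally show ?thesis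
    using 1 unfolding crowd_def by simp
qed

text \<open>The constant is fixed by \<open>C\<close> and \<open>S\<close> alone, so it serves all
  maps and points at once. Neither the density of \<open>\<Psi>\<close> nor \<open>x'\<close> and
  \<open>v'\<close> are restricted.\<close>

lemma force_lipschitz:
  assumes C: "0 \<le> C" and S: "0 \<le> S"
  obtains \<Lambda> where "0 \<le> \<Lambda>"
    "\<And>(\<Phi> :: 'l \<Rightarrow> 'a::euclidean_space \<times> 'a) \<Psi> x x' v v' D.
      spatial_bound C \<Phi> \<Longrightarrow> \<Psi> \<in> borel_measurable M \<Longrightarrow>
      AE \<eta> in M. norm (fst (\<Phi> \<eta>)) \<le> S \<Longrightarrow> AE \<eta> in M. norm (snd (\<Phi> \<eta>)) \<le> S \<Longrightarrow>
      AE \<eta> in M. norm (snd (\<Psi> \<eta>)) \<le> S \<Longrightarrow> AE \<eta> in M. dist (\<Phi> \<eta>) (\<Psi> \<eta>) \<le> D \<Longrightarrow>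
      norm x \<le> S \<Longrightarrow> norm v \<le> S \<Longrightarrow> 0 \<le> D \<Longrightarrow>
      norm (force \<Phi> x v - force \<Psi> x' v') \<le> \<Lambda> * (D + dist x x' + dist v v')"
proof -
  obtain Q where Q: "0 \<le> Q"
    "\<And>(\<Phi> :: 'l \<Rightarrow> 'a \<times> 'a) x r \<delta>. spatial_bound C \<Phi> \<Longrightarrow> 0 \<le> r \<Longrightarrow> r \<le> 2 * S \<Longrightarrow> 0 \<le> \<delta> \<Longrightarrow>
      prob {\<eta> \<in> space M. \<bar>dist x (fst (\<Phi> \<eta>)) - r\<bar> \<le> \<delta>} \<le> Q * \<delta>"
    by (rule shell_bound[OF C, of "2 * S"]) (use S in simp, rule that)
  define \<Lambda> where "\<Lambda> = L * (Q * 2) * (2 * S) + K 0"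
  have \<Lambda>: "0 \<le> \<Lambda>" using L_nonneg Q(1) S K_0_pos by (simp add: \<Lambda>_def)
  moreover have "norm (force \<Phi> x v - force \<Psi> x' v') \<le> \<Lambda> * (D + dist x x' + dist v v')"
    if \<Phi>: "spatial_bound C \<Phi>" and [measurable]: "\<Psi> \<in> borel_measurable M"
      and X: "AE \<eta> in M. norm (fst (\<Phi> \<eta>)) \<le> S" and V: "AE \<eta> in M. norm (snd (\<Phi> \<eta>)) \<le> S"
      and V': "AE \<eta> in M. norm (snd (\<Psi> \<eta>)) \<le> S" and D: "AE \<eta> in M. dist (\<Phi> \<eta>) (\<Psi> \<eta>) \<le> D"
      and x: "norm x \<le> S" and v: "norm v \<le> S" and D0: "0 \<le> D"
    for \<Phi> \<Psi> :: "'l \<Rightarrow> 'a \<times> 'a" and x x' v v' D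
  proof -
    have [measurable]: "\<Phi> \<in> borel_measurable M" using \<Phi> by (simp add: spatial_bound_def)
    let ?e = "D + dist x x' + dist v v'"
    have int: "integrable M (pull \<Phi> x v)" "integrable M (pull \<Psi> x' v')"
      using V V' by (auto intro: pull_integrable)
    have "AE \<zeta> in M. norm (pull \<Phi> x v \<zeta> - pull \<Psi> x' v' \<zeta>) \<le> \<Lambda> * ?e"
      using X V D
    proof eventually_elim
      case (elim \<zeta>)
      let ?r = "dist x (fst (\<Phi> \<zeta>))" and ?r' = "dist x' (fst (\<Psi> \<zeta>))"
      let ?m = "crowd \<Phi> x ?r" and ?m' = "crowd \<Psi> x' ?r'"
      have "\<bar>?r - ?r'\<bar> \<le> dist x x' + dist (fst (\<Phi> \<zeta>)) (fst (\<Psi> \<zeta>))" by metric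
      then have r: "\<bar>?r - ?r'\<bar> \<le> D + dist x x'"
        using elim dist_fst_le[of "\<Phi> \<zeta>" "\<Psi> \<zeta>"] by simp
      have "?r \<le> 2 * S"
        using elim x norm_triangle_ineq4[of x "fst (\<Phi> \<zeta>)"] by (simp add: dist_norm)
      then have "\<bar>?m - ?m'\<bar> \<le> Q * (2 * (D + dist x x'))"
        using D0 by (intro order.trans[OF crowd_diff[OF _ _ D r] Q(2)[OF \<Phi>]]) auto
      moreover have "\<bar>K ?m - K ?m'\<bar> \<le> L * \<bar>?m - ?m'\<bar>"
        using lipschitz_onD[OF K_Lipschitz crowd_in_unit crowd_in_unit] by (simp add: dist_real_def)
      ultimately have Kd: "\<bar>K ?m - K ?m'\<bar> \<le> L * (Q * (2 * (D + dist x x')))"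
        using L_nonneg by (meson mult_left_mono order.trans)
      \<comment> \<open>Product rule: a change of weight costs the shell bound times a relative
        velocity of at most \<open>2 * S\<close>, a change of velocities costs at most the factor
        \<open>K 0\<close>.\<close>
      have "pull \<Phi> x v \<zeta> - pull \<Psi> x' v' \<zeta> =
        (K ?m - K ?m') *\<^sub>R (snd (\<Phi> \<zeta>) - v) + K ?m' *\<^sub>R ((snd (\<Phi> \<zeta>) - snd (\<Psi> \<zeta>)) - (v - v'))"
        by (simp add: pull_def algebra_simps)
      also have "norm \<dots> \<le> \<bar>K ?m - K ?m'\<bar> * norm (snd (\<Phi> \<zeta>) - v)
          + K ?m' * norm ((snd (\<Phi> \<zeta>) - snd (\<Psi> \<zeta>)) - (v - v'))"
        using K_crowd_bounds(1)[of \<Psi> x' ?r'] by (intro norm_triangle_le) simp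
      also have "\<bar>K ?m - K ?m'\<bar> * norm (snd (\<Phi> \<zeta>) - v) \<le> L * (Q * (2 * (D + dist x x'))) * (2 * S)"
        using elim v L_nonneg Q(1) D0 norm_triangle_ineq4[of "snd (\<Phi> \<zeta>)" v]
        by (intro mult_mono Kd) auto
      also have "\<dots> \<le> L * (Q * 2) * (2 * S) * ?e"
        using L_nonneg Q(1) S by (simp add: algebra_simps)
      also have "K ?m' * norm ((snd (\<Phi> \<zeta>) - snd (\<Psi> \<zeta>)) - (v - v')) \<le> K 0 * ?e"
      proof (intro mult_mono K_crowd_bounds)
        have "norm ((snd (\<Phi> \<zeta>) - snd (\<Psi> \<zeta>)) - (v - v')) \<le> dist (snd (\<Phi> \<zeta>)) (snd (\<Psi> \<zeta>)) + dist v v'"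
          by (simp add: dist_norm norm_triangle_ineq4)
        also have "\<dots> \<le> D + dist x x' + dist v v'"
          using elim dist_snd_le[of "\<Phi> \<zeta>" "\<Psi> \<zeta>"] zero_le_dist[of x x'] by linarith
        finally show "norm ((snd (\<Phi> \<zeta>) - snd (\<Psi> \<zeta>)) - (v - v')) \<le> ?e" .
      qed (use K_0_pos in auto)
      finally show ?case
        by (simp add: \<Lambda>_def distrib_right)
    qed
    then have "norm (\<integral>\<zeta>. pull \<Phi> x v \<zeta> - pull \<Psi> x' v' \<zeta> \<partial>M) \<le> \<Lambda> * ?e"
    proof -
      assume AE: "AE \<zeta> in M. norm (pull \<Phi> x v \<zeta> - pull \<Psi> x' v' \<zeta>) \<le> \<Lambda> * ?e"
      have "norm (\<integral>\<zeta>. pull \<Phi> x v \<zeta> - pull \<Psi> x' v' \<zeta> \<partial>M) \<le> (\<integral>\<zeta>. norm (pull \<Phi> x v \<zeta> - pull \<Psi> x' v' \<zeta>) \<partial>M)"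
        by (rule integral_norm_bound)
      also have "\<dots> \<le> (\<integral>\<zeta>. \<Lambda> * ?e \<partial>M)"
        using AE int by (intro integral_mono_AE) auto
      finally show ?thesis by (simp add: prob_space)
    qed
    then show ?thesis
      unfolding force_def using int by simp
  qed
  ultimately show thesis using that by blast
qed

section \<open>Translation between integrals of a density and integrals over labels\<close>

context
  fixes \<Phi> :: "'l \<Rightarrow> 'a::euclidean_space \<times> 'a" and f :: "'a \<times> 'a \<Rightarrow> real"
  assumes \<Phi>[measurable]: "\<Phi> \<in> borel_measurable M"
    and f: "bounded_prob_density f"
    and push: "density lborel (\<lambda>z. ennreal (f z)) = distr M borel \<Phi>"
begin

text \<open>By Fubini the ball mass of the marginal is the mass of the cylinder
  \<open>cball x r \<times> UNIV\<close>, whose preimage under \<open>\<Phi>\<close> is the event in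
  \<open>crowd\<close>.\<close>

lemma ball_mass_eq_crowd: "ball_mass (marginal f) x r = crowd \<Phi> x r"
proof -
  have [measurable]: "f \<in> borel_measurable borel" by (rule bounded_prob_density_measurable[OF f])
  have int: "integrable lborel f" and nn: "AE z in lborel. 0 \<le> f z"
    using f by (auto simp: bounded_prob_density_def has_bochner_integral_iff)
  let ?B = "cball x r \<times> (UNIV :: 'a set)"
  have B[measurable]: "?B \<in> sets borel"
    by (intro borel_closed closed_Times) auto
  have int': "integrable (lborel \<Otimes>\<^sub>M lborel) (\<lambda>z. indicator ?B z *\<^sub>R f z)"
    using integrable_mult_indicator[of ?B lborel f] int by (simp add: lborel_prod)
  have "ball_mass (marginal f) x r = (\<integral>y. \<integral>v. indicator ?B (y, v) *\<^sub>R f (y, v) \<partial>lborel \<partial>lborel)"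
    unfolding ball_mass_def marginal_def set_lebesgue_integral_def
    by (intro Bochner_Integration.integral_cong refl) (auto simp: indicator_def)
  also have "\<dots> = integral\<^sup>L (lborel \<Otimes>\<^sub>M lborel) (\<lambda>z. indicator ?B z *\<^sub>R f z)"
    by (rule lborel_pair.integral_fst'[OF int'])
  also have "\<dots> = (\<integral>z. f z *\<^sub>R indicator ?B z \<partial>lborel)"
    by (simp add: lborel_prod mult.commute)
  also have "\<dots> = integral\<^sup>L (density lborel (\<lambda>z. ennreal (f z))) (indicator ?B)"
    using nn by (subst integral_density) auto
  also have "\<dots> = (\<integral>\<eta>. indicator ?B (\<Phi> \<eta>) \<partial>M)"
    unfolding push by (subst integral_distr) auto
  also have "\<dots> = (\<integral>\<eta>. indicator {\<eta> \<in> space M. dist x (fst (\<Phi> \<eta>)) \<le> r} \<eta> \<partial>M)"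
    by (intro Bochner_Integration.integral_cong refl) (auto simp: indicator_def mem_Times_iff)
  also have "\<dots> = crowd \<Phi> x r"
    unfolding crowd_def by simp
  finally show ?thesis .
qed

text \<open>Once the ball mass is a \<open>crowd\<close>, the integrand is \<open>f\<close> times a
  Borel function, and both claims are a change of density followed by an image measure. The
  equivalence is needed in both directions: convergence of \<open>W\<close> for the constructed
  flow, and the velocity moment of a competitor.\<close>

lemma W_integrand_integrable_iff:
    "integrable lborel (W_integrand K (marginal f) f x v) \<longleftrightarrow> integrable M (pull \<Phi> x v)" (is ?int)
  and W_field_eq_force: "W_field K (marginal f) f x v = force \<Phi> x v" (is ?eq)
proof -
  have [measurable]: "f \<in> borel_measurable borel" by (rule bounded_prob_density_measurable[OF f])
  have nn: "AE z in lborel. 0 \<le> f z"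
    using f by (auto simp: bounded_prob_density_def)
  define G where "G z = K (crowd \<Phi> x (dist x (fst z))) *\<^sub>R (snd z - v)" for z
  have [measurable]: "G \<in> borel_measurable borel"
    unfolding G_def[abs_def] by measurable
  have W: "W_integrand K (marginal f) f x v = (\<lambda>z. f z *\<^sub>R G z)"
    by (auto simp: W_integrand_def G_def ball_mass_eq_crowd dist_norm mult.commute)
  have "integrable lborel (\<lambda>z. f z *\<^sub>R G z) \<longleftrightarrow> integrable (density lborel (\<lambda>z. ennreal (f z))) G"
    using nn by (subst integrable_density) auto
  also have "\<dots> \<longleftrightarrow> integrable M (\<lambda>\<eta>. G (\<Phi> \<eta>))"
    unfolding push by (subst integrable_distr_eq) auto
  finally show ?int
    unfolding W by (simp add: G_def pull_def[abs_def])
  have "(\<integral>z. f z *\<^sub>R G z \<partial>lborel) = integral\<^sup>L (density lborel (\<lambda>z. ennreal (f z))) G"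
    using nn by (subst integral_density) auto
  also have "\<dots> = (\<integral>\<eta>. G (\<Phi> \<eta>) \<partial>M)"
    unfolding push by (subst integral_distr) auto
  finally show ?eq
    unfolding W_field_def W by (simp add: G_def force_def pull_def[abs_def])
qed

end

end

subsection \<open>The Euler scheme\<close>

lemma nn_integral_lborel_affine:
  fixes t :: "'a::euclidean_space"
  assumes c: "c \<noteq> 0" and [measurable]: "g \<in> borel_measurable borel"
  shows "(\<integral>\<^sup>+x. g x \<partial>lborel) = ennreal (\<bar>c\<bar> ^ DIM('a)) * (\<integral>\<^sup>+x. g (t + c *\<^sub>R x) \<partial>lborel)"
  by (subst lborel_affine[OF c, of t])
     (simp add: nn_integral_density nn_integral_distr nn_integral_cmult)

text \<open>For fixed \<open>x\<close>, the substitution \<open>u = c x *\<^sub>R v + b x\<close>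
  scales volume by a factor of at least \<open>c\<^sub>0 ^ DIM('a)\<close>; for fixed
  \<open>u\<close> the remaining map in \<open>x\<close> is a translation. Between the two the order
  of integration is exchanged.\<close>

lemma emeasure_kick_vimage_le:
  fixes c :: "'a::euclidean_space \<Rightarrow> real" and b :: "'a \<Rightarrow> 'a"
  assumes E[measurable]: "E \<in> borel_measurable borel"
    and Eeq: "\<And>x v. E (x, v) = (x + h *\<^sub>R (c x *\<^sub>R v + b x), c x *\<^sub>R v + b x)"
    and c: "\<And>x. c\<^sub>0 \<le> c x" "0 < c\<^sub>0" and B[measurable]: "B \<in> sets borel"
  shows "emeasure lborel {p. E p \<in> B} \<le> ennreal ((1 / c\<^sub>0) ^ DIM('a)) * emeasure lborel B"
proof -
  let ?d = "DIM('a)"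
  let ?I = "indicator B :: 'a \<times> 'a \<Rightarrow> ennreal"
  have pairb: "borel_measurable (lborel \<Otimes>\<^sub>M lborel) = borel_measurable (borel :: ('a \<times> 'a) measure)"
    by (simp add: lborel_prod)
  have slice: "ennreal (c\<^sub>0 ^ ?d) * (\<integral>\<^sup>+v. ?I (E (x, v)) \<partial>lborel) \<le> (\<integral>\<^sup>+u. ?I (x + h *\<^sub>R u, u) \<partial>lborel)"
    for x
  proof -
    have [measurable]: "(\<lambda>u. (x + h *\<^sub>R u, u)) \<in> borel_measurable borel"
      by (intro borel_measurable_continuous_onI continuous_intros)
    have g: "(\<lambda>u. ?I (x + h *\<^sub>R u, u)) \<in> borel_measurable borel"
      by measurable
    have cx: "0 < c x" using c(1)[of x] c(2) by simp
    have "ennreal (c\<^sub>0 ^ ?d) * (\<integral>\<^sup>+v. ?I (E (x, v)) \<partial>lborel)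
        \<le> ennreal (\<bar>c x\<bar> ^ ?d) * (\<integral>\<^sup>+v. ?I (E (x, v)) \<partial>lborel)"
      using c(1)[of x] c(2) cx by (intro mult_right_mono ennreal_leI power_mono) auto
    also have "\<dots> = ennreal (\<bar>c x\<bar> ^ ?d) * (\<integral>\<^sup>+v. ?I (x + h *\<^sub>R (b x + c x *\<^sub>R v), b x + c x *\<^sub>R v) \<partial>lborel)"
      by (simp add: Eeq add.commute)
    also have "\<dots> = (\<integral>\<^sup>+u. ?I (x + h *\<^sub>R u, u) \<partial>lborel)"
      using cx by (intro nn_integral_lborel_affine[OF _ g, symmetric]) auto
    finally show ?thesis .
  qed
  have [measurable]: "(\<lambda>p. (fst p + h *\<^sub>R snd p, snd p)) \<in> borel_measurable (borel :: ('a \<times> 'a) measure)"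
    by (intro borel_measurable_continuous_onI continuous_intros)
  have mI: "(\<lambda>p. ?I (E p)) \<in> borel_measurable (lborel \<Otimes>\<^sub>M lborel)"
    "(\<lambda>p. ?I (fst p + h *\<^sub>R snd p, snd p)) \<in> borel_measurable (lborel \<Otimes>\<^sub>M lborel)"
    "?I \<in> borel_measurable (lborel \<Otimes>\<^sub>M lborel)"
    unfolding pairb by measurable
  have slices: "(\<lambda>x. \<integral>\<^sup>+v. ?I (E (x, v)) \<partial>lborel) \<in> borel_measurable lborel"
    using lborel.borel_measurable_nn_integral_fst[OF mI(1)] .
  have "ennreal (c\<^sub>0 ^ ?d) * emeasure lborel {p. E p \<in> B} = ennreal (c\<^sub>0 ^ ?d) * (\<integral>\<^sup>+p. ?I (E p) \<partial>(lborel \<Otimes>\<^sub>M lborel))"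
    by (simp add: lborel_prod emeasure_indicator_comp)
  also have "\<dots> = ennreal (c\<^sub>0 ^ ?d) * (\<integral>\<^sup>+x. \<integral>\<^sup>+v. ?I (E (x, v)) \<partial>lborel \<partial>lborel)"
    by (subst lborel.nn_integral_fst[OF mI(1)]) simp
  also have "\<dots> = (\<integral>\<^sup>+x. ennreal (c\<^sub>0 ^ ?d) * (\<integral>\<^sup>+v. ?I (E (x, v)) \<partial>lborel) \<partial>lborel)"
    by (rule nn_integral_cmult[OF slices, symmetric])
  also have "\<dots> \<le> (\<integral>\<^sup>+x. \<integral>\<^sup>+u. ?I (x + h *\<^sub>R u, u) \<partial>lborel \<partial>lborel)"
    by (intro nn_integral_mono slice)
  also have "\<dots> = (\<integral>\<^sup>+u. \<integral>\<^sup>+x. ?I (x + h *\<^sub>R u, u) \<partial>lborel \<partial>lborel)"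
    using lborel_pair.Fubini'[of "\<lambda>x u. ?I (x + h *\<^sub>R u, u)"] mI(2) by (simp add: case_prod_unfold)
  also have "\<dots> = (\<integral>\<^sup>+u. \<integral>\<^sup>+x. ?I (x, u) \<partial>lborel \<partial>lborel)"
  proof (rule nn_integral_cong)
    fix u :: 'a
    have [measurable]: "(\<lambda>x. (x, u)) \<in> borel_measurable borel"
      by (intro borel_measurable_continuous_onI continuous_intros)
    have "(\<lambda>x. ?I (x, u)) \<in> borel_measurable borel"
      by measurable
    from nn_integral_lborel_affine[OF _ this, of 1 "h *\<^sub>R u"]
    show "(\<integral>\<^sup>+x. ?I (x + h *\<^sub>R u, u) \<partial>lborel) = (\<integral>\<^sup>+x. ?I (x, u) \<partial>lborel)"
      by (simp add: add.commute)
  qed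
  also have "\<dots> = integral\<^sup>N (lborel \<Otimes>\<^sub>M lborel) ?I"
    using mI(3) by (rule lborel_pair.nn_integral_snd)
  also have "\<dots> = emeasure lborel B"
    by (simp add: lborel_prod)
  finally have le: "ennreal (c\<^sub>0 ^ ?d) * emeasure lborel {p. E p \<in> B} \<le> emeasure lborel B" .
  have "emeasure lborel {p. E p \<in> B} = ennreal ((1 / c\<^sub>0) ^ ?d) * (ennreal (c\<^sub>0 ^ ?d) * emeasure lborel {p. E p \<in> B})"
    using c(2) by (simp add: mult.assoc[symmetric] ennreal_mult[symmetric] power_mult_distrib[symmetric])
  also have "\<dots> \<le> ennreal ((1 / c\<^sub>0) ^ ?d) * emeasure lborel B"
    by (intro mult_left_mono le) simp
  finally show ?thesis .
qed

context topological_alignment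
begin

text \<open>The position moves with the already updated velocity \<open>u\<close>. With the old
  velocity the step would not split into an affine map in \<open>v\<close> and a shear, and its
  Jacobian would involve the derivative of the force in \<open>x\<close>.\<close>

definition kick :: "real \<Rightarrow> ('l \<Rightarrow> 'a::euclidean_space \<times> 'a) \<Rightarrow> 'a \<times> 'a \<Rightarrow> 'a \<times> 'a" where
  "kick h \<Phi> p = (let u = snd p + h *\<^sub>R force \<Phi> (fst p) (snd p) in (fst p + h *\<^sub>R u, u))"

text \<open>This is \<open>force_lipschitz\<close> with \<open>\<Psi> = \<Phi>\<close> and
  \<open>D = 0\<close>, the radius \<open>S\<close> being adapted to the point. It supplies the
  Borel measurability of \<open>kick\<close>.\<close>

lemma force_continuous:
  fixes \<Phi> :: "'l \<Rightarrow> 'a::euclidean_space \<times> 'a"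
  assumes C: "0 \<le> C" and \<Phi>: "spatial_bound C \<Phi>"
    and X: "AE \<eta> in M. norm (fst (\<Phi> \<eta>)) \<le> R" and V: "AE \<eta> in M. norm (snd (\<Phi> \<eta>)) \<le> R"
  shows "continuous_on UNIV (\<lambda>p. force \<Phi> (fst p) (snd p))"
proof (rule continuous_at_imp_continuous_on, intro ballI)
  fix p :: "'a \<times> 'a"
  define S where "S = max \<bar>R\<bar> (norm p)"
  have S: "0 \<le> S" "R \<le> S" "norm (fst p) \<le> S" "norm (snd p) \<le> S"
    using norm_fst_le[of "fst p" "snd p"] norm_snd_le[of "snd p" "fst p"] by (auto simp: S_def)
  have [measurable]: "\<Phi> \<in> borel_measurable M" using \<Phi> by (simp add: spatial_bound_def)
  have XV: "AE \<eta> in M. norm (fst (\<Phi> \<eta>)) \<le> S" "AE \<eta> in M. norm (snd (\<Phi> \<eta>)) \<le> S"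
    using X V by (eventually_elim, use S(2) in simp)+
  obtain \<Lambda> where "0 \<le> \<Lambda>" and \<Lambda>:
    "\<And>(\<Phi> :: 'l \<Rightarrow> 'a \<times> 'a) \<Psi> x x' v v' D.
      spatial_bound C \<Phi> \<Longrightarrow> \<Psi> \<in> borel_measurable M \<Longrightarrow>
      AE \<eta> in M. norm (fst (\<Phi> \<eta>)) \<le> S \<Longrightarrow> AE \<eta> in M. norm (snd (\<Phi> \<eta>)) \<le> S \<Longrightarrow>
      AE \<eta> in M. norm (snd (\<Psi> \<eta>)) \<le> S \<Longrightarrow> AE \<eta> in M. dist (\<Phi> \<eta>) (\<Psi> \<eta>) \<le> D \<Longrightarrow>
      norm x \<le> S \<Longrightarrow> norm v \<le> S \<Longrightarrow> 0 \<le> D \<Longrightarrow>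
      norm (force \<Phi> x v - force \<Psi> x' v') \<le> \<Lambda> * (D + dist x x' + dist v v')"
    by (rule force_lipschitz[OF C S(1)]) (rule that)
  have bd: "norm (force \<Phi> (fst p) (snd p) - force \<Phi> (fst q) (snd q))
      \<le> \<Lambda> * (0 + dist (fst p) (fst q) + dist (snd p) (snd q))" for q
    using S XV by (intro \<Lambda> \<Phi>) auto
  have "((\<lambda>q. \<Lambda> * (0 + dist (fst p) (fst q) + dist (snd p) (snd q))) \<longlongrightarrow>
      \<Lambda> * (0 + dist (fst p) (fst p) + dist (snd p) (snd p))) (at p)"
    by (intro tendsto_intros)
  then have "((\<lambda>q. \<Lambda> * (0 + dist (fst p) (fst q) + dist (snd p) (snd q))) \<longlongrightarrow> 0) (at p)"
    by simp
  then have "((\<lambda>q. force \<Phi> (fst p) (snd p) - force \<Phi> (fst q) (snd q)) \<longlongrightarrow> 0) (at p)"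
    by (rule Lim_null_comparison[OF always_eventually[OF allI[OF bd]]])
  then have "((\<lambda>q. force \<Phi> (fst p) (snd p) - (force \<Phi> (fst p) (snd p) - force \<Phi> (fst q) (snd q)))
      \<longlongrightarrow> force \<Phi> (fst p) (snd p) - 0) (at p)"
    by (intro tendsto_diff tendsto_const)
  then show "isCont (\<lambda>p. force \<Phi> (fst p) (snd p)) p"
    by (simp add: isCont_def)
qed

text \<open>With \<open>k = h * K (...)\<close> in \<open>[0, 1]\<close>, the new velocity is the
  mean over \<open>\<zeta>\<close> of the convex combinations
  \<open>(1 - k) *\<^sub>R v + k *\<^sub>R snd (\<Phi> \<zeta>)\<close>, so balls of velocities are
  preserved.\<close>

lemma norm_kick_velocity_le:
  assumes [measurable]: "\<Phi> \<in> borel_measurable M" and V: "AE \<eta> in M. norm (snd (\<Phi> \<eta>)) \<le> q"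
    and v: "norm v \<le> q" and h: "0 \<le> h" "h * K 0 \<le> 1"
  shows "norm (v + h *\<^sub>R force \<Phi> x v) \<le> q"
proof -
  have int: "integrable M (pull \<Phi> x v)" using V by (intro pull_integrable) auto
  have "v + h *\<^sub>R force \<Phi> x v = (\<integral>\<zeta>. v + h *\<^sub>R pull \<Phi> x v \<zeta> \<partial>M)"
    unfolding force_def using int by (subst Bochner_Integration.integral_add) (auto simp: prob_space)
  also have "norm \<dots> \<le> (\<integral>\<zeta>. norm (v + h *\<^sub>R pull \<Phi> x v \<zeta>) \<partial>M)"
    by (rule integral_norm_bound)
  also have "\<dots> \<le> (\<integral>\<zeta>. q \<partial>M)"
  proof (intro integral_mono_AE)
    show "AE \<zeta> in M. norm (v + h *\<^sub>R pull \<Phi> x v \<zeta>) \<le> q"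
      using V
    proof eventually_elim
      case (elim \<zeta>)
      define k where "k = h * K (crowd \<Phi> x (dist x (fst (\<Phi> \<zeta>))))"
      have k: "0 \<le> k" "k \<le> 1"
        unfolding k_def using h K_crowd_bounds(1,2)[of \<Phi> x "dist x (fst (\<Phi> \<zeta>))"]
        by (auto intro: order.trans[OF mult_left_mono])
      have "v + h *\<^sub>R pull \<Phi> x v \<zeta> = (1 - k) *\<^sub>R v + k *\<^sub>R snd (\<Phi> \<zeta>)"
        by (simp add: pull_def k_def algebra_simps)
      also have "norm \<dots> \<le> (1 - k) * norm v + k * norm (snd (\<Phi> \<zeta>))"
        using k by (intro norm_triangle_le) simp
      also have "\<dots> \<le> (1 - k) * q + k * q"
        using k v elim by (intro add_mono mult_left_mono) auto
      finally show ?case by (simp add: algebra_simps)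
    qed
  qed (use int in auto)
  finally show ?thesis by (simp add: prob_space)
qed

text \<open>The dependence on \<open>v\<close> is pure damping by the mean weight, so at fixed
  \<open>x\<close> a velocity update is affine with factor 1 minus \<open>h\<close> times that
  weight, hence at least \<open>1 - h * K 0\<close>.\<close>

lemma force_affine:
  assumes [measurable]: "\<Phi> \<in> borel_measurable M" and V: "AE \<eta> in M. norm (snd (\<Phi> \<eta>)) \<le> S"
  shows "force \<Phi> x v = force \<Phi> x 0 - (\<integral>\<zeta>. K (crowd \<Phi> x (dist x (fst (\<Phi> \<zeta>)))) \<partial>M) *\<^sub>R v"
    and "(\<integral>\<zeta>. K (crowd \<Phi> x (dist x (fst (\<Phi> \<zeta>)))) \<partial>M) \<le> K 0"
proof -
  let ?k = "\<lambda>\<zeta>. K (crowd \<Phi> x (dist x (fst (\<Phi> \<zeta>))))"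
  have k: "integrable M ?k"
    by (rule integrable_const_bound[where B="K 0"])
       (use K_crowd_bounds(1,2) in \<open>auto simp: abs_if intro!: AE_I2 dest: less_asym\<close>)
  have int: "integrable M (pull \<Phi> x 0)" using V by (intro pull_integrable) auto
  have "force \<Phi> x v = (\<integral>\<zeta>. pull \<Phi> x 0 \<zeta> - ?k \<zeta> *\<^sub>R v \<partial>M)"
    unfolding force_def by (intro Bochner_Integration.integral_cong) (auto simp: pull_def algebra_simps)
  also have "\<dots> = force \<Phi> x 0 - (\<integral>\<zeta>. ?k \<zeta> \<partial>M) *\<^sub>R v"
    using int k unfolding force_def by (subst Bochner_Integration.integral_diff) auto
  finally show "force \<Phi> x v = force \<Phi> x 0 - (\<integral>\<zeta>. ?k \<zeta> \<partial>M) *\<^sub>R v" .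
  have "(\<integral>\<zeta>. ?k \<zeta> \<partial>M) \<le> (\<integral>\<zeta>. K 0 \<partial>M)"
    using k by (intro integral_mono K_crowd_bounds) auto
  then show "(\<integral>\<zeta>. ?k \<zeta> \<partial>M) \<le> K 0" by (simp add: prob_space)
qed

end

section \<open>The scheme for a given initial measure and its uniform bounds\<close>

locale alignment_data = topological_alignment M K L
  for M :: "('a::euclidean_space \<times> 'a) measure" and K L +
  fixes C\<^sub>0 R\<^sub>x R\<^sub>v T :: real
  assumes sets_M: "sets M = sets borel"
    and C0_nonneg: "0 \<le> C\<^sub>0"
    and emeasure_M_le: "\<And>B. B \<in> sets borel \<Longrightarrow> emeasure M B \<le> ennreal C\<^sub>0 * emeasure lborel B"
    and supp_M: "AE z in M. norm (fst z) \<le> R\<^sub>x \<and> norm (snd z) \<le> R\<^sub>v"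
    and R_pos: "0 < R\<^sub>x" "0 < R\<^sub>v" and T_pos: "0 < T"
begin

lemma space_M: "space M = UNIV"
  using sets_eq_imp_space_eq[OF sets_M] by simp

lemma measurable_M_iff: "borel_measurable M = borel_measurable borel"
  using sets_M by (intro measurable_cong_sets) auto

text \<open>Labels are initial states, and those outside the support of \<open>M\<close> are moved
  as well, by the force that the labels distributed according to \<open>M\<close> generate.\<close>

primrec euler :: "real \<Rightarrow> nat \<Rightarrow> 'a \<times> 'a \<Rightarrow> 'a \<times> 'a" where
  "euler h 0 = (\<lambda>z. z)"
| "euler h (Suc k) = (\<lambda>z. kick h (euler h k) (euler h k z))"

definition phase_bound :: "real \<Rightarrow> ('a \<times> 'a \<Rightarrow> 'a \<times> 'a) \<Rightarrow> bool" where
  "phase_bound C \<Phi> \<longleftrightarrow> \<Phi> \<in> borel_measurable borel \<and>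
    (\<forall>B\<in>sets borel. emeasure M {z. \<Phi> z \<in> B} \<le> ennreal C * emeasure lborel B)"

lemma phase_bound_mono: "phase_bound C \<Phi> \<Longrightarrow> C \<le> C' \<Longrightarrow> phase_bound C' \<Phi>"
  unfolding phase_bound_def by (meson ennreal_leI mult_right_mono order.trans zero_le)

text \<open>Almost all velocities lie in a ball, so a position in \<open>B\<close> means a state in
  \<open>B \<times> cball 0 R\<^sub>v\<close>; the phase density is integrated over that
  ball.\<close>

lemma spatial_bound_of_phase_bound:
  assumes C: "0 \<le> C" and \<Phi>: "phase_bound C \<Phi>" and V: "AE z in M. norm (snd (\<Phi> z)) \<le> R\<^sub>v"
  shows "spatial_bound (C * measure lborel (cball (0::'a) R\<^sub>v)) \<Phi>"
  unfolding spatial_bound_def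
proof (intro conjI ballI)
  show m[measurable]: "\<Phi> \<in> borel_measurable M" using \<Phi> by (simp add: measurable_M_iff phase_bound_def)
  fix B :: "'a set" assume B[measurable]: "B \<in> sets borel"
  let ?B = "B \<times> cball (0::'a) R\<^sub>v"
  have B2[measurable]: "?B \<in> sets borel"
    unfolding borel_prod[symmetric] by (intro pair_measureI) auto
  have "emeasure M {\<eta> \<in> space M. fst (\<Phi> \<eta>) \<in> B} \<le> emeasure M {\<eta> \<in> space M. \<Phi> \<eta> \<in> ?B}"
    using V by (intro emeasure_mono_AE) (auto simp: mem_Times_iff elim!: eventually_mono)
  also have "\<dots> \<le> ennreal C * emeasure lborel ?B"
    using \<Phi> B2 unfolding phase_bound_def space_M by auto
  also have "emeasure lborel ?B = emeasure lborel B * emeasure lborel (cball (0::'a) R\<^sub>v)"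
    by (subst lborel_prod[symmetric], subst lborel.emeasure_pair_measure_Times) auto
  also have "emeasure lborel (cball (0::'a) R\<^sub>v) = ennreal (measure lborel (cball (0::'a) R\<^sub>v))"
    using emeasure_lborel_cball_finite[of "0::'a" R\<^sub>v] by (intro emeasure_eq_ennreal_measure) auto
  also have "ennreal C * (emeasure lborel B * \<dots>) =
      ennreal (C * measure lborel (cball (0::'a) R\<^sub>v)) * emeasure lborel B"
    using C by (simp add: ennreal_mult mult_ac)
  finally show "emeasure M {\<eta> \<in> space M. fst (\<Phi> \<eta>) \<in> B}
      \<le> ennreal (C * measure lborel (cball (0::'a) R\<^sub>v)) * emeasure lborel B" .
qed

text \<open>The velocity half-step is affine in \<open>v\<close> with factor at least \<open>1 - h * K 0\<close> and the position
  half-step is a shear.\<close>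

lemma phase_bound_kick:
  assumes C: "0 \<le> C" and \<Phi>: "phase_bound C \<Phi>"
    and X: "AE z in M. norm (fst (\<Phi> z)) \<le> R" and V: "AE z in M. norm (snd (\<Phi> z)) \<le> R\<^sub>v"
    and h: "0 \<le> h" "h * K 0 < 1"
  shows "phase_bound (C * (1 / (1 - h * K 0)) ^ DIM('a)) (\<lambda>z. kick h \<Phi> (\<Phi> z))"
proof -
  have \<Phi>b[measurable]: "\<Phi> \<in> borel_measurable borel" using \<Phi> by (simp add: phase_bound_def)
  have \<Phi>M: "\<Phi> \<in> borel_measurable M" by (simp add: measurable_M_iff)
  have "continuous_on UNIV (\<lambda>p. force \<Phi> (fst p) (snd p))"
  proof (rule force_continuous[where R="max R R\<^sub>v"])
    show "spatial_bound (C * measure lborel (cball (0::'a) R\<^sub>v)) \<Phi>"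
      using C \<Phi> V by (rule spatial_bound_of_phase_bound)
    show "AE z in M. norm (fst (\<Phi> z)) \<le> max R R\<^sub>v" "AE z in M. norm (snd (\<Phi> z)) \<le> max R R\<^sub>v"
      using X V by (eventually_elim, simp)+
  qed (use C in simp)
  then have kick[measurable]: "kick h \<Phi> \<in> borel_measurable borel"
    unfolding kick_def[abs_def] Let_def
    by (intro borel_measurable_continuous_onI continuous_intros)
  define a where "a x = (\<integral>\<zeta>. K (crowd \<Phi> x (dist x (fst (\<Phi> \<zeta>)))) \<partial>M)" for x
  have a: "force \<Phi> x v = force \<Phi> x 0 - a x *\<^sub>R v" "a x \<le> K 0" for x v
    unfolding a_def using force_affine[OF \<Phi>M V] by blast+
  have step: "emeasure lborel {p. kick h \<Phi> p \<in> B} \<le> ennreal ((1 / (1 - h * K 0)) ^ DIM('a)) * emeasure lborel B"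
    if B: "B \<in> sets borel" for B
  proof (rule emeasure_kick_vimage_le[where h=h and c="\<lambda>x. 1 - h * a x" and b="\<lambda>x. h *\<^sub>R force \<Phi> x 0"])
    show "kick h \<Phi> (x, v) = (x + h *\<^sub>R ((1 - h * a x) *\<^sub>R v + h *\<^sub>R force \<Phi> x 0), (1 - h * a x) *\<^sub>R v + h *\<^sub>R force \<Phi> x 0)" for x v
      by (simp add: kick_def a(1)[of x v] Let_def algebra_simps)
    show "1 - h * K 0 \<le> 1 - h * a x" for x
      using a(2)[of x] h by (simp add: mult_left_mono)
  qed (use h B kick in auto)
  show ?thesis
    unfolding phase_bound_def
  proof (intro conjI ballI)
    fix B :: "('a \<times> 'a) set" assume B[measurable]: "B \<in> sets borel"
    have B': "{p. kick h \<Phi> p \<in> B} \<in> sets borel" by measurable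
    have "emeasure M {z. \<Phi> z \<in> {p. kick h \<Phi> p \<in> B}} \<le> ennreal C * emeasure lborel {p. kick h \<Phi> p \<in> B}"
      using \<Phi> B' unfolding phase_bound_def by blast
    also have "\<dots> \<le> ennreal C * (ennreal ((1 / (1 - h * K 0)) ^ DIM('a)) * emeasure lborel B)"
      by (intro mult_left_mono step B) auto
    also have "\<dots> = ennreal (C * (1 / (1 - h * K 0)) ^ DIM('a)) * emeasure lborel B"
      using C h by (simp add: ennreal_mult mult.assoc)
    finally show "emeasure M {z. kick h \<Phi> (\<Phi> z) \<in> B}
        \<le> ennreal (C * (1 / (1 - h * K 0)) ^ DIM('a)) * emeasure lborel B" by simp
  qed measurable
qed

text \<open>A step multiplies the density bound by at most
  \<open>(1 / (1 - h * K 0)) ^ DIM('a)\<close>, which is at most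
  \<open>exp (2 * K 0 * h) ^ DIM('a)\<close> for \<open>h * K 0 \<le> 1 / 2\<close>; the steps add
  up to time at most \<open>T\<close>.\<close>

definition phase_const :: real where
  "phase_const = C\<^sub>0 * exp (2 * K 0 * T) ^ DIM('a)"

definition space_const :: real where
  "space_const = phase_const * measure lborel (cball (0::'a) R\<^sub>v)"

lemma phase_const_nonneg: "0 \<le> phase_const" and space_const_nonneg: "0 \<le> space_const"
  using C0_nonneg by (auto simp: phase_const_def space_const_def)

text \<open>The two claims need a joint induction: the density bound of the next step requires
  almost sure bounds on positions and velocities. The box bound is stated for all \<open>p\<close>
  and all \<open>q \<ge> R\<^sub>v\<close> because labels outside the support are followed too; they
  are attracted to velocities of norm at most \<open>R\<^sub>v\<close>.\<close>

lemma euler_box_phase_bound: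
  assumes h: "0 \<le> h" "h * K 0 \<le> 1 / 2"
  shows "phase_bound (C\<^sub>0 * ((1 / (1 - h * K 0)) ^ DIM('a)) ^ k) (euler h k) \<and>
    (\<forall>z p q. R\<^sub>v \<le> q \<longrightarrow> norm (fst z) \<le> p \<longrightarrow> norm (snd z) \<le> q \<longrightarrow>
      norm (fst (euler h k z)) \<le> p + real k * h * q \<and> norm (snd (euler h k z)) \<le> q)"
proof (induction k)
  case 0
  then show ?case using emeasure_M_le by (simp add: phase_bound_def)
next
  case (Suc k)
  let ?\<Phi> = "euler h k"
  have \<Phi>: "phase_bound (C\<^sub>0 * ((1 / (1 - h * K 0)) ^ DIM('a)) ^ k) ?\<Phi>" using Suc by blast
  have \<Phi>M: "?\<Phi> \<in> borel_measurable M" using \<Phi> by (simp add: measurable_M_iff phase_bound_def)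
  have box: "norm (fst (?\<Phi> z)) \<le> p + real k * h * q" "norm (snd (?\<Phi> z)) \<le> q"
    if "R\<^sub>v \<le> q" "norm (fst z) \<le> p" "norm (snd z) \<le> q" for z p q
    using Suc that by blast+
  have X: "AE z in M. norm (fst (?\<Phi> z)) \<le> R\<^sub>x + real k * h * R\<^sub>v"
    and V: "AE z in M. norm (snd (?\<Phi> z)) \<le> R\<^sub>v"
    using supp_M by (eventually_elim, blast intro: box order.refl)+
  have "phase_bound (C\<^sub>0 * ((1 / (1 - h * K 0)) ^ DIM('a)) ^ k * (1 / (1 - h * K 0)) ^ DIM('a))
      (\<lambda>z. kick h ?\<Phi> (?\<Phi> z))"
    using h C0_nonneg by (intro phase_bound_kick[OF _ \<Phi> X V]) auto
  moreover have "norm (fst (euler h (Suc k) z)) \<le> p + real (Suc k) * h * q \<and> norm (snd (euler h (Suc k) z)) \<le> q"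
    if q: "R\<^sub>v \<le> q" and z: "norm (fst z) \<le> p" "norm (snd z) \<le> q" for z p q
  proof -
    let ?u = "snd (?\<Phi> z) + h *\<^sub>R force ?\<Phi> (fst (?\<Phi> z)) (snd (?\<Phi> z))"
    have "AE z in M. norm (snd (?\<Phi> z)) \<le> q"
      using V by eventually_elim (use q in simp)
    then have u: "norm ?u \<le> q"
      using h box(2)[OF q z] by (intro norm_kick_velocity_le[OF \<Phi>M]) auto
    have "norm (fst (?\<Phi> z) + h *\<^sub>R ?u) \<le> (p + real k * h * q) + h * q"
      using box(1)[OF q z] u h by (intro norm_triangle_mono) (auto intro: mult_left_mono)
    with u show ?thesis
      by (simp add: kick_def Let_def algebra_simps)
  qed
  ultimately show ?case by (simp add: mult_ac)
qed

lemma euler_phase_bound: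
  assumes h: "0 \<le> h" "h * K 0 \<le> 1 / 2" and k: "real k * h \<le> T"
  shows "phase_bound phase_const (euler h k)"
proof (rule phase_bound_mono[OF euler_box_phase_bound[OF h, THEN conjunct1]])
  have one_sub: "0 < 1 - h * K 0" using h by simp
  \<comment> \<open>With \<open>s = h * K 0\<close> the right-hand side is
    \<open>1 + s * (1 - 2 * s)\<close>, and \<open>s \<le> 1 / 2\<close>.\<close>
  have "1 \<le> (1 - h * K 0) * (1 + 2 * K 0 * h)"
  proof -
    have "0 \<le> (h * K 0) * (1 - 2 * (h * K 0))"
      using h K_0_pos by (intro mult_nonneg_nonneg) auto
    then show ?thesis by (simp add: algebra_simps)
  qed
  also have "\<dots> \<le> (1 - h * K 0) * exp (2 * K 0 * h)"
    using one_sub exp_ge_add_one_self by (intro mult_left_mono) auto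
  finally have grow: "1 / (1 - h * K 0) \<le> exp (2 * K 0 * h)"
    using one_sub by (simp add: field_simps)
  have "((1 / (1 - h * K 0)) ^ DIM('a)) ^ k = ((1 / (1 - h * K 0)) ^ k) ^ DIM('a)"
    by (simp only: power_mult[symmetric] mult.commute)
  also have "\<dots> \<le> (exp (2 * K 0 * h) ^ k) ^ DIM('a)"
    using grow one_sub by (intro power_mono) auto
  also have "exp (2 * K 0 * h) ^ k = exp (2 * K 0 * (real k * h))"
    by (simp add: exp_of_nat_mult[symmetric] algebra_simps)
  also have "\<dots> ^ DIM('a) \<le> exp (2 * K 0 * T) ^ DIM('a)"
    using k K_0_pos by (intro power_mono) auto
  finally show "C\<^sub>0 * ((1 / (1 - h * K 0)) ^ DIM('a)) ^ k \<le> phase_const"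
    unfolding phase_const_def using C0_nonneg by (intro mult_left_mono)
qed

lemma euler_box:
  assumes "0 \<le> h" "h * K 0 \<le> 1 / 2" "R\<^sub>v \<le> q" "norm (fst z) \<le> p" "norm (snd z) \<le> q"
  shows "norm (fst (euler h k z)) \<le> p + real k * h * q" "norm (snd (euler h k z)) \<le> q"
  using euler_box_phase_bound[OF assms(1,2)] assms(3-) by blast+

end

subsection \<open>Refinement of the mesh\<close>

lemma geometric_cauchy_limit:
  fixes x :: "nat \<Rightarrow> 'b::complete_space"
  assumes step: "\<And>n. dist (x n) (x (Suc n)) \<le> c / 2 ^ n" and c: "0 \<le> c"
  shows "x \<longlonglongrightarrow> lim x" and "dist (x n) (lim x) \<le> 2 * c / 2 ^ n"
proof -
  have tail: "dist (x n) (x (n + k)) \<le> 2 * c / 2 ^ n - 2 * c / 2 ^ (n + k)" for n k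
  proof (induction k)
    case (Suc k)
    have "dist (x n) (x (n + Suc k)) \<le> dist (x n) (x (n + k)) + dist (x (n + k)) (x (n + Suc k))"
      by (rule dist_triangle)
    also have "\<dots> \<le> (2 * c / 2 ^ n - 2 * c / 2 ^ (n + k)) + c / 2 ^ (n + k)"
      using Suc step[of "n + k"] by simp
    also have "\<dots> = 2 * c / 2 ^ n - 2 * c / 2 ^ (n + Suc k)"
      by (simp add: field_simps)
    finally show ?case .
  qed simp
  have tail': "dist (x n) (x m) \<le> 2 * c / 2 ^ n" if "n \<le> m" for n m
  proof -
    have "dist (x n) (x m) \<le> 2 * c / 2 ^ n - 2 * c / 2 ^ m"
      using tail[of n "m - n"] that by simp
    also have "\<dots> \<le> 2 * c / 2 ^ n" using c by simp
    finally show ?thesis .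
  qed
  have "(\<lambda>n. 2 * c * (1 / 2) ^ n) \<longlonglongrightarrow> 2 * c * 0"
    by (intro tendsto_mult tendsto_const LIMSEQ_power_zero) simp
  then have null: "(\<lambda>n. 2 * c / 2 ^ n) \<longlonglongrightarrow> 0"
    by (simp add: power_divide)
  have "Cauchy x"
  proof (rule metric_CauchyI)
    fix e :: real assume "0 < e"
    then obtain N where N: "2 * c / 2 ^ N < e / 2"
      using order_tendstoD(2)[OF null, of "e / 2"] by (auto simp: eventually_sequentially)
    have "dist (x m) (x n) < e" if "m \<ge> N" "n \<ge> N" for m n
      using tail'[OF that(1)] tail'[OF that(2)] N dist_triangle3[of "x m" "x n" "x N"] by linarith
    then show "\<exists>N. \<forall>m\<ge>N. \<forall>n\<ge>N. dist (x m) (x n) < e" by blast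
  qed
  then show lim: "x \<longlonglongrightarrow> lim x"
    by (simp add: Cauchy_convergent convergent_LIMSEQ_iff[symmetric])
  show "dist (x n) (lim x) \<le> 2 * c / 2 ^ n"
  proof (rule LIMSEQ_le_const2)
    show "(\<lambda>m. dist (x n) (x m)) \<longlonglongrightarrow> dist (x n) (lim x)"
      by (intro tendsto_intros lim)
    show "\<exists>N. \<forall>m\<ge>N. dist (x n) (x m) \<le> 2 * c / 2 ^ n"
      using tail' by blast
  qed
qed

lemma has_vector_derivative_quadraticI:
  fixes f :: "real \<Rightarrow> 'b::real_normed_vector"
  assumes "\<And>s. s \<in> S \<Longrightarrow> norm (f s - f t - (s - t) *\<^sub>R f') \<le> C * (s - t)\<^sup>2"
  shows "(f has_vector_derivative f') (at t within S)"
  unfolding has_vector_derivative_def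
proof (rule has_derivativeI_sandwich[where e=1 and H="\<lambda>s. C * \<bar>s - t\<bar>"])
  show "bounded_linear (\<lambda>x. x *\<^sub>R f')" by (rule bounded_linear_scaleR_left)
  have "((\<lambda>s. C * \<bar>s - t\<bar>) \<longlongrightarrow> C * \<bar>t - t\<bar>) (at t within S)"
    by (intro tendsto_intros)
  then show "((\<lambda>s. C * \<bar>s - t\<bar>) \<longlongrightarrow> 0) (at t within S)" by simp
  show "norm (f s - f t - (s - t) *\<^sub>R f') / norm (s - t) \<le> C * \<bar>s - t\<bar>"
    if "s \<in> S" "s \<noteq> t" for s
    using assms[OF that(1)] that(2) by (simp add: divide_le_eq power2_eq_square mult.assoc abs_mult_self_eq)
qed simp

lemma norm_Pair_le: "norm (a, b) \<le> norm a + norm b"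
  by (metis norm_ge_zero norm_prod_def fst_conv snd_conv sqrt_sum_squares_le_sum)

context topological_alignment
begin

definition field :: "('l \<Rightarrow> 'a::euclidean_space \<times> 'a) \<Rightarrow> 'a \<times> 'a \<Rightarrow> 'a \<times> 'a" where
  "field \<Phi> p = (snd p, force \<Phi> (fst p) (snd p))"

lemma norm_force_le_moment:
  assumes [measurable]: "\<Phi> \<in> borel_measurable M" and int: "integrable M (\<lambda>\<eta>. snd (\<Phi> \<eta>))"
  shows "norm (force \<Phi> x v) \<le> K 0 * ((\<integral>\<eta>. norm (snd (\<Phi> \<eta>)) \<partial>M) + norm v)"
proof -
  have "norm (force \<Phi> x v) \<le> (\<integral>\<zeta>. norm (pull \<Phi> x v \<zeta>) \<partial>M)"
    unfolding force_def by (rule integral_norm_bound)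
  also have "\<dots> \<le> (\<integral>\<zeta>. K 0 * (norm (snd (\<Phi> \<zeta>)) + norm v) \<partial>M)"
  proof (intro integral_mono)
    fix \<zeta>
    have "norm (pull \<Phi> x v \<zeta>) \<le> K 0 * norm (snd (\<Phi> \<zeta>) - v)" by (rule pull_bound)
    also have "\<dots> \<le> K 0 * (norm (snd (\<Phi> \<zeta>)) + norm v)"
      using K_0_pos norm_triangle_ineq4[of "snd (\<Phi> \<zeta>)" v] by (intro mult_left_mono) auto
    finally show "norm (pull \<Phi> x v \<zeta>) \<le> K 0 * (norm (snd (\<Phi> \<zeta>)) + norm v)" .
  qed (use int in \<open>auto intro!: integrable_norm pull_integrable_moment\<close>)
  also have "\<dots> = K 0 * ((\<integral>\<eta>. norm (snd (\<Phi> \<eta>)) \<partial>M) + norm v)"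
    using int by (simp add: prob_space)
  finally show ?thesis .
qed

lemma norm_force_le:
  assumes [measurable]: "\<Phi> \<in> borel_measurable M" and V: "AE \<eta> in M. norm (snd (\<Phi> \<eta>)) \<le> S"
  shows "norm (force \<Phi> x v) \<le> K 0 * (S + norm v)"
proof -
  have int: "integrable M (\<lambda>\<eta>. snd (\<Phi> \<eta>))"
    by (rule integrable_const_bound[where B=S]) (use V in auto)
  have "(\<integral>\<eta>. norm (snd (\<Phi> \<eta>)) \<partial>M) \<le> (\<integral>\<eta>. S \<partial>M)"
    using V int by (intro integral_mono_AE) auto
  then have "K 0 * ((\<integral>\<eta>. norm (snd (\<Phi> \<eta>)) \<partial>M) + norm v) \<le> K 0 * (S + norm v)"
    using K_0_pos by (intro mult_left_mono) (auto simp: prob_space)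
  with norm_force_le_moment[OF assms(1) int] show ?thesis by (rule order.trans)
qed

lemma field_lipschitz:
  assumes C: "0 \<le> C" and S: "0 \<le> S"
  obtains \<Lambda> where "0 \<le> \<Lambda>"
    "\<And>(\<Phi> :: 'l \<Rightarrow> 'a::euclidean_space \<times> 'a) \<Psi> p q D.
      spatial_bound C \<Phi> \<Longrightarrow> \<Psi> \<in> borel_measurable M \<Longrightarrow>
      AE \<eta> in M. norm (fst (\<Phi> \<eta>)) \<le> S \<Longrightarrow> AE \<eta> in M. norm (snd (\<Phi> \<eta>)) \<le> S \<Longrightarrow>
      AE \<eta> in M. norm (snd (\<Psi> \<eta>)) \<le> S \<Longrightarrow> AE \<eta> in M. norm (\<Phi> \<eta> - \<Psi> \<eta>) \<le> D \<Longrightarrow>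
      norm (fst p) \<le> S \<Longrightarrow> norm (snd p) \<le> S \<Longrightarrow> norm (p - q) \<le> D \<Longrightarrow>
      norm (field \<Phi> p - field \<Psi> q) \<le> \<Lambda> * D"
proof -
  obtain \<Lambda> where \<Lambda>0: "0 \<le> \<Lambda>" and \<Lambda>:
    "\<And>(\<Phi> :: 'l \<Rightarrow> 'a \<times> 'a) \<Psi> x x' v v' D.
      spatial_bound C \<Phi> \<Longrightarrow> \<Psi> \<in> borel_measurable M \<Longrightarrow>
      AE \<eta> in M. norm (fst (\<Phi> \<eta>)) \<le> S \<Longrightarrow> AE \<eta> in M. norm (snd (\<Phi> \<eta>)) \<le> S \<Longrightarrow>
      AE \<eta> in M. norm (snd (\<Psi> \<eta>)) \<le> S \<Longrightarrow> AE \<eta> in M. dist (\<Phi> \<eta>) (\<Psi> \<eta>) \<le> D \<Longrightarrow>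
      norm x \<le> S \<Longrightarrow> norm v \<le> S \<Longrightarrow> 0 \<le> D \<Longrightarrow>
      norm (force \<Phi> x v - force \<Psi> x' v') \<le> \<Lambda> * (D + dist x x' + dist v v')"
    by (rule force_lipschitz[OF C S]) (rule that)
  \<comment> \<open>The 1 stands for the velocity component, the 3 for the three distances in
    \<open>force_lipschitz\<close>, each at most \<open>D\<close>.\<close>
  have "norm (field \<Phi> p - field \<Psi> q) \<le> (1 + 3 * \<Lambda>) * D"
    if \<Phi>\<Psi>: "spatial_bound C \<Phi>" "\<Psi> \<in> borel_measurable M"
      "AE \<eta> in M. norm (fst (\<Phi> \<eta>)) \<le> S" "AE \<eta> in M. norm (snd (\<Phi> \<eta>)) \<le> S"
      "AE \<eta> in M. norm (snd (\<Psi> \<eta>)) \<le> S" and D: "AE \<eta> in M. norm (\<Phi> \<eta> - \<Psi> \<eta>) \<le> D"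
      and p: "norm (fst p) \<le> S" "norm (snd p) \<le> S" and pq: "norm (p - q) \<le> D"
    for \<Phi> \<Psi> :: "'l \<Rightarrow> 'a \<times> 'a" and p q D
  proof -
    have D0: "0 \<le> D" using norm_ge_zero pq by (rule order.trans)
    have pq': "dist (fst p) (fst q) \<le> D" "dist (snd p) (snd q) \<le> D"
      using pq dist_fst_le[of p q] dist_snd_le[of p q] by (auto simp: dist_norm[of p q])
    have "norm (force \<Phi> (fst p) (snd p) - force \<Psi> (fst q) (snd q))
        \<le> \<Lambda> * (D + dist (fst p) (fst q) + dist (snd p) (snd q))"
      using \<Phi>\<Psi> D p D0 by (intro \<Lambda>) (simp_all add: dist_norm)
    also have "\<dots> \<le> \<Lambda> * (D + D + D)"
      by (intro mult_left_mono add_mono order.refl \<Lambda>0 pq')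
    finally have f: "norm (force \<Phi> (fst p) (snd p) - force \<Psi> (fst q) (snd q)) \<le> 3 * \<Lambda> * D"
      by (simp add: algebra_simps)
    have "norm (snd p - snd q) \<le> D" using pq'(2) by (simp add: dist_norm)
    with f show ?thesis
      unfolding field_def by (auto simp: algebra_simps intro: order.trans[OF norm_Pair_le])
  qed
  moreover have "0 \<le> 1 + 3 * \<Lambda>" using \<Lambda>0 by simp
  ultimately show thesis by (rule that[rotated])
qed

end

context alignment_data
begin

text \<open>The common property of the iterates that the Lipschitz estimate needs and that passes to
  pointwise limits, so that \<open>flow\<close> inherits it.\<close>

definition admissible :: "real \<Rightarrow> ('a \<times> 'a \<Rightarrow> 'a \<times> 'a) \<Rightarrow> bool" where
  "admissible t \<Phi> \<longleftrightarrow> phase_bound phase_const \<Phi> \<and>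
    (\<forall>p q z. R\<^sub>v \<le> q \<longrightarrow> norm (fst z) \<le> p \<longrightarrow> norm (snd z) \<le> q \<longrightarrow>
      norm (fst (\<Phi> z)) \<le> p + t * q \<and> norm (snd (\<Phi> z)) \<le> q)"

lemma admissible_measurable: "admissible t \<Phi> \<Longrightarrow> \<Phi> \<in> borel_measurable M"
  by (simp add: admissible_def phase_bound_def measurable_M_iff)

lemma admissible_box:
  assumes "admissible t \<Phi>" "R\<^sub>v \<le> q" "norm (fst z) \<le> p" "norm (snd z) \<le> q"
  shows "norm (fst (\<Phi> z)) \<le> p + t * q" "norm (snd (\<Phi> z)) \<le> q"
  using assms unfolding admissible_def by blast+

lemma admissible_AE:
  assumes "admissible t \<Phi>"
  shows "AE z in M. norm (fst (\<Phi> z)) \<le> R\<^sub>x + t * R\<^sub>v" "AE z in M. norm (snd (\<Phi> z)) \<le> R\<^sub>v"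
  using supp_M by (eventually_elim, blast intro: admissible_box[OF assms] order.refl)+

lemma admissible_spatial_bound: "admissible t \<Phi> \<Longrightarrow> spatial_bound space_const \<Phi>"
  unfolding space_const_def
  by (rule spatial_bound_of_phase_bound[OF phase_const_nonneg _ admissible_AE(2)]) (auto simp: admissible_def)

text \<open>Labels range over the whole phase space, where speeds and constants are unbounded. A box
  with \<open>r \<ge> R\<^sub>x\<close> and \<open>r \<ge> R\<^sub>v\<close> carries
  \<open>M\<close>, so the force can be estimated from its labels alone.\<close>

definition label_box :: "real \<Rightarrow> ('a \<times> 'a) set" where
  "label_box r = {z. norm (fst z) \<le> r \<and> norm (snd z) \<le> r}"

lemma admissible_label_box:
  assumes "admissible t \<Phi>" "R\<^sub>v \<le> r" "z \<in> label_box r"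
  shows "norm (fst (\<Phi> z)) \<le> r + t * r" "norm (snd (\<Phi> z)) \<le> r"
  using admissible_box[OF assms(1,2), of z r] assms(3) by (auto simp: label_box_def)

lemma AE_label_box: "R\<^sub>x \<le> r \<Longrightarrow> R\<^sub>v \<le> r \<Longrightarrow> AE z in M. z \<in> label_box r"
  using supp_M by eventually_elim (auto simp: label_box_def)

text \<open>The distance is taken over the whole box because the field sees all labels; the same
  \<open>D\<close> also bounds the displacement of the point at which the fields are
  compared.\<close>

definition field_lip :: "real \<Rightarrow> real \<Rightarrow> bool" where
  "field_lip r \<Lambda> \<longleftrightarrow> 0 \<le> \<Lambda> \<and> (\<forall>\<Phi> \<Psi> s t D z. admissible s \<Phi> \<longrightarrow> admissible t \<Psi> \<longrightarrow> s \<in> {0..T} \<longrightarrow>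
    t \<in> {0..T} \<longrightarrow> (\<forall>\<eta>\<in>label_box r. norm (\<Phi> \<eta> - \<Psi> \<eta>) \<le> D) \<longrightarrow> z \<in> label_box r \<longrightarrow>
    norm (field \<Phi> (\<Phi> z) - field \<Psi> (\<Psi> z)) \<le> \<Lambda> * D)"

lemma field_lip_exists:
  assumes r: "R\<^sub>x \<le> r" "R\<^sub>v \<le> r"
  shows "\<exists>\<Lambda>. field_lip r \<Lambda>"
proof -
  define S where "S = r + T * r"
  have r0: "0 \<le> r" using r R_pos by simp
  then have S: "0 \<le> S" "r \<le> S" using T_pos by (auto simp: S_def)
  obtain \<Lambda> where \<Lambda>0: "0 \<le> \<Lambda>" and \<Lambda>:
    "\<And>(\<Phi> :: 'a \<times> 'a \<Rightarrow> 'a \<times> 'a) \<Psi> p q D.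
      spatial_bound space_const \<Phi> \<Longrightarrow> \<Psi> \<in> borel_measurable M \<Longrightarrow>
      AE \<eta> in M. norm (fst (\<Phi> \<eta>)) \<le> S \<Longrightarrow> AE \<eta> in M. norm (snd (\<Phi> \<eta>)) \<le> S \<Longrightarrow>
      AE \<eta> in M. norm (snd (\<Psi> \<eta>)) \<le> S \<Longrightarrow> AE \<eta> in M. norm (\<Phi> \<eta> - \<Psi> \<eta>) \<le> D \<Longrightarrow>
      norm (fst p) \<le> S \<Longrightarrow> norm (snd p) \<le> S \<Longrightarrow> norm (p - q) \<le> D \<Longrightarrow>
      norm (field \<Phi> p - field \<Psi> q) \<le> \<Lambda> * D"
    by (rule field_lipschitz[OF space_const_nonneg S(1)]) (rule that)
  have "norm (field \<Phi> (\<Phi> z) - field \<Psi> (\<Psi> z)) \<le> \<Lambda> * D"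
    if adm: "admissible s \<Phi>" "admissible t \<Psi>" and st: "s \<in> {0..T}" "t \<in> {0..T}"
      and D: "\<forall>\<eta>\<in>label_box r. norm (\<Phi> \<eta> - \<Psi> \<eta>) \<le> D" and z: "z \<in> label_box r"
    for \<Phi> \<Psi> s t D z
  proof -
    have in_S: "norm (fst (\<Phi> \<eta>)) \<le> S" "norm (snd (\<Phi> \<eta>)) \<le> S" "norm (snd (\<Psi> \<eta>)) \<le> S"
      if "\<eta> \<in> label_box r" for \<eta>
    proof -
      have "norm (fst (\<Phi> \<eta>)) \<le> r + s * r"
        using adm(1) r(2) that by (rule admissible_label_box)
      also have "\<dots> \<le> S" unfolding S_def using st r0 by (intro add_left_mono mult_right_mono) auto
      finally show "norm (fst (\<Phi> \<eta>)) \<le> S" .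
      show "norm (snd (\<Phi> \<eta>)) \<le> S" "norm (snd (\<Psi> \<eta>)) \<le> S"
        using admissible_label_box(2)[OF adm(1) r(2) that] admissible_label_box(2)[OF adm(2) r(2) that] S(2)
        by auto
    qed
    have AE_box: "AE \<eta> in M. P \<eta>" if "\<And>\<eta>. \<eta> \<in> label_box r \<Longrightarrow> P \<eta>" for P
      using AE_label_box[OF r] by eventually_elim (rule that)
    show ?thesis
      by (intro \<Lambda> AE_box in_S z admissible_spatial_bound[OF adm(1)] admissible_measurable[OF adm(2)]
          bspec[OF D])
  qed
  then have "field_lip r \<Lambda>"
    unfolding field_lip_def using \<Lambda>0 by simp
  then show ?thesis by blast
qed

lemma euler_admissible:
  assumes h: "0 \<le> h" "h * K 0 \<le> 1 / 2" and k: "real k * h \<le> t" "t \<le> T"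
  shows "admissible t (euler h k)"
  unfolding admissible_def
proof (intro conjI allI impI)
  show "phase_bound phase_const (euler h k)"
    using k by (intro euler_phase_bound[OF h]) auto
  fix p q :: real and z :: "'a \<times> 'a"
  assume q: "R\<^sub>v \<le> q" and z: "norm (fst z) \<le> p" "norm (snd z) \<le> q"
  have "norm (fst (euler h k z)) \<le> p + real k * h * q"
    by (rule euler_box(1)[OF h q z])
  also have "\<dots> \<le> p + t * q"
    using k q R_pos by (intro add_left_mono mult_right_mono) auto
  finally show "norm (fst (euler h k z)) \<le> p + t * q" .
  show "norm (snd (euler h k z)) \<le> q"
    by (rule euler_box(2)[OF h q z])
qed

text \<open>The coarsest mesh already satisfies \<open>h * K 0 \<le> 1 / 2\<close>, and halving
  nests the time grids.\<close>

definition mesh :: "nat \<Rightarrow> real" where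
  "mesh n = 1 / (2 * K 0 * 2 ^ n)"

lemma mesh_pos: "0 < mesh n" and mesh_K: "mesh n * K 0 \<le> 1 / 2"
  and mesh_Suc: "mesh (Suc n) = mesh n / 2" and mesh_eq: "mesh n = mesh 0 / 2 ^ n"
  using K_0_pos by (auto simp: mesh_def field_simps)

lemma mesh_tendsto_0: "mesh \<longlonglongrightarrow> 0"
proof -
  have "(\<lambda>n. mesh 0 * (1 / 2) ^ n) \<longlonglongrightarrow> mesh 0 * 0"
    by (intro tendsto_mult tendsto_const LIMSEQ_power_zero) simp
  then show ?thesis
    by (subst mesh_eq[abs_def]) (simp add: power_divide)
qed

definition steps :: "nat \<Rightarrow> real \<Rightarrow> nat" where
  "steps n t = nat \<lfloor>t / mesh n\<rfloor>"

lemma steps_bounds: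
  assumes "0 \<le> t"
  shows "real (steps n t) * mesh n \<le> t" "t \<le> real (steps n t) * mesh n + mesh n"
proof -
  have "0 \<le> \<lfloor>t / mesh n\<rfloor>" using assms mesh_pos[of n] by simp
  then have r: "real (steps n t) = of_int \<lfloor>t / mesh n\<rfloor>" by (simp add: steps_def)
  have "real (steps n t) \<le> t / mesh n" "t / mesh n \<le> real (steps n t) + 1"
    unfolding r by linarith+
  then show "real (steps n t) * mesh n \<le> t" "t \<le> real (steps n t) * mesh n + mesh n"
    using mesh_pos[of n] by (auto simp: field_simps)
qed

lemma steps_mono: "s \<le> t \<Longrightarrow> steps n s \<le> steps n t"
  unfolding steps_def using mesh_pos[of n] by (intro nat_mono floor_mono divide_right_mono) auto

text \<open>The second alternative occurs when the fractional part of \<open>t / mesh n\<close> is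
  at least one half; it costs one additional fine step in \<open>approx_refine\<close>.\<close>

lemma steps_Suc:
  assumes "0 \<le> t"
  shows "steps (Suc n) t = 2 * steps n t \<or> steps (Suc n) t = Suc (2 * steps n t)"
proof -
  have "0 \<le> \<lfloor>t / mesh n\<rfloor>" using assms mesh_pos[of n] by simp
  have "t / mesh (Suc n) = 2 * (t / mesh n)" by (simp add: mesh_Suc)
  moreover have "\<lfloor>2 * (t / mesh n)\<rfloor> = 2 * \<lfloor>t / mesh n\<rfloor> \<or> \<lfloor>2 * (t / mesh n)\<rfloor> = 2 * \<lfloor>t / mesh n\<rfloor> + 1"
    by linarith
  ultimately have "\<lfloor>t / mesh (Suc n)\<rfloor> = 2 * \<lfloor>t / mesh n\<rfloor> \<or> \<lfloor>t / mesh (Suc n)\<rfloor> = 2 * \<lfloor>t / mesh n\<rfloor> + 1"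
    by metis
  with \<open>0 \<le> \<lfloor>t / mesh n\<rfloor>\<close> show ?thesis unfolding steps_def by arith
qed

lemma steps_mesh_tendsto:
  assumes t: "0 \<le> t"
  shows "(\<lambda>n. real (steps n t) * mesh n) \<longlonglongrightarrow> t"
proof (rule tendsto_sandwich)
  have "(\<lambda>n. t - mesh n) \<longlonglongrightarrow> t - 0" by (intro tendsto_intros mesh_tendsto_0)
  then show "(\<lambda>n. t - mesh n) \<longlonglongrightarrow> t" by simp
  show "(\<lambda>n. t) \<longlonglongrightarrow> t" by simp
  show "\<forall>\<^sub>F n in sequentially. t - mesh n \<le> real (steps n t) * mesh n"
    using steps_bounds(2)[OF t] by (auto intro!: always_eventually simp: algebra_simps)
  show "\<forall>\<^sub>F n in sequentially. real (steps n t) * mesh n \<le> t"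
    using steps_bounds(1)[OF t] by auto
qed

definition approx :: "nat \<Rightarrow> real \<Rightarrow> 'a \<times> 'a \<Rightarrow> 'a \<times> 'a" where
  "approx n t = euler (mesh n) (steps n t)"

definition flow :: "real \<Rightarrow> 'a \<times> 'a \<Rightarrow> 'a \<times> 'a" where
  "flow t z = lim (\<lambda>n. approx n t z)"

lemma mesh_nonneg: "0 \<le> mesh n"
  using mesh_pos[of n] by simp

lemma approx_admissible: "t \<in> {0..T} \<Longrightarrow> admissible t (approx n t)"
  unfolding approx_def using steps_bounds(1)[of t n] by (intro euler_admissible mesh_nonneg mesh_K) auto

end

section \<open>Local errors and comparison of consecutive meshes on one label box\<close>

locale alignment_box = alignment_data +
  fixes r \<Lambda> :: real
  assumes r: "R\<^sub>x \<le> r" "R\<^sub>v \<le> r" and lip: "field_lip r \<Lambda>"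
begin

text \<open>In the box, velocities of admissible maps are at most \<open>r\<close> and forces at
  most \<open>K 0 * (R\<^sub>v + r)\<close>, so this bounds \<open>field\<close>.\<close>

definition slope :: real where
  "slope = r + K 0 * (2 * r)"

lemma box_radius_pos: "0 < r" using r R_pos by simp

lemma lip_nonneg: "0 \<le> \<Lambda>" using lip by (simp add: field_lip_def)

lemma slope_nonneg: "0 \<le> slope"
  using box_radius_pos K_0_pos by (simp add: slope_def)

lemma field_lipD:
  assumes "admissible s \<Phi>" "admissible t \<Psi>" "s \<in> {0..T}" "t \<in> {0..T}"
    "\<And>\<eta>. \<eta> \<in> label_box r \<Longrightarrow> norm (\<Phi> \<eta> - \<Psi> \<eta>) \<le> D" "z \<in> label_box r"
  shows "norm (field \<Phi> (\<Phi> z) - field \<Psi> (\<Psi> z)) \<le> \<Lambda> * D"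
  using lip assms unfolding field_lip_def by blast

lemma force_le_slope:
  assumes adm: "admissible t \<Phi>" and z: "z \<in> label_box r"
  shows "norm (force \<Phi> (fst (\<Phi> z)) (snd (\<Phi> z))) \<le> K 0 * (2 * r)"
proof -
  have v: "norm (snd (\<Phi> z)) \<le> r"
    using adm r(2) z by (rule admissible_label_box)
  have "norm (force \<Phi> (fst (\<Phi> z)) (snd (\<Phi> z))) \<le> K 0 * (R\<^sub>v + norm (snd (\<Phi> z)))"
    by (rule norm_force_le[OF admissible_measurable[OF adm] admissible_AE(2)[OF adm]])
  also have "\<dots> \<le> K 0 * (2 * r)"
    using v r K_0_pos by (intro mult_left_mono) auto
  finally show ?thesis .
qed

lemma field_le_slope:
  assumes adm: "admissible t \<Phi>" and z: "z \<in> label_box r"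
  shows "norm (field \<Phi> (\<Phi> z)) \<le> slope"
proof -
  have "norm (snd (\<Phi> z)) \<le> r"
    using adm r(2) z by (rule admissible_label_box)
  with force_le_slope[OF assms] show ?thesis
    unfolding field_def slope_def by (intro order.trans[OF norm_Pair_le]) auto
qed

text \<open>Because the position uses the updated velocity, the step differs from the explicit Euler
  step exactly by \<open>h\<^sup>2\<close> times the force in the position component. The factor
  \<open>1 + T\<close> in the second bound absorbs this defect through
  \<open>h \<le> T\<close>.\<close>

lemma euler_step:
  assumes h: "0 \<le> h" "h * K 0 \<le> 1 / 2" and k: "real (Suc k) * h \<le> T" and z: "z \<in> label_box r"
  shows "norm (euler h (Suc k) z - euler h k z - h *\<^sub>R field (euler h k) (euler h k z)) \<le> h\<^sup>2 * slope"
    and "norm (euler h (Suc k) z - euler h k z) \<le> h * (slope * (1 + T))"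
proof -
  have "real k * h \<le> T"
    using k h by (simp add: algebra_simps)
  then have adm: "admissible T (euler h k)"
    by (intro euler_admissible[OF h]) auto
  let ?f = "force (euler h k) (fst (euler h k z)) (snd (euler h k z))"
  have "euler h (Suc k) z - euler h k z - h *\<^sub>R field (euler h k) (euler h k z) = (h\<^sup>2 *\<^sub>R ?f, 0)"
    by (simp add: kick_def field_def Let_def prod_eq_iff power2_eq_square algebra_simps)
  also have "norm (h\<^sup>2 *\<^sub>R ?f, 0::'a) = h\<^sup>2 * norm ?f"
    by (simp add: norm_prod_def)
  also have "\<dots> \<le> h\<^sup>2 * slope"
    using force_le_slope[OF adm z] box_radius_pos by (intro mult_left_mono) (auto simp: slope_def)
  finally show 1: "norm (euler h (Suc k) z - euler h k z - h *\<^sub>R field (euler h k) (euler h k z)) \<le> h\<^sup>2 * slope" .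
  have hT: "h \<le> T" 
  proof -
    have "1 * h \<le> real (Suc k) * h" using h by (intro mult_right_mono) auto
    with k show ?thesis by simp
  qed
  have "norm (euler h (Suc k) z - euler h k z) \<le> h\<^sup>2 * slope + norm (h *\<^sub>R field (euler h k) (euler h k z))"
    using 1 norm_triangle_ineq2[of "euler h (Suc k) z - euler h k z" "h *\<^sub>R field (euler h k) (euler h k z)"]
    by linarith
  also have "\<dots> \<le> h\<^sup>2 * slope + h * slope"
    using field_le_slope[OF adm z] h by (simp add: mult_left_mono)
  also have "\<dots> = h * (slope * (1 + h))"
    by (simp add: power2_eq_square algebra_simps)
  also have "\<dots> \<le> h * (slope * (1 + T))"
    using h hT slope_nonneg by (intro mult_left_mono) auto
  finally show "norm (euler h (Suc k) z - euler h k z) \<le> h * (slope * (1 + T))" .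
qed

lemma euler_increment:
  assumes h: "0 \<le> h" "h * K 0 \<le> 1 / 2" and k: "real (i + n) * h \<le> T" and z: "z \<in> label_box r"
  shows "norm (euler h (i + n) z - euler h i z) \<le> real n * h * (slope * (1 + T))"
  using k
proof (induction n)
  case (Suc n)
  have le: "real (i + n) * h \<le> T" using Suc.prems h by (simp add: algebra_simps)
  have "norm (euler h (i + Suc n) z - euler h i z)
      \<le> norm (euler h (Suc (i + n)) z - euler h (i + n) z) + norm (euler h (i + n) z - euler h i z)"
    using norm_triangle_ineq[of "euler h (Suc (i + n)) z - euler h (i + n) z" "euler h (i + n) z - euler h i z"] by simp
  also have "\<dots> \<le> h * (slope * (1 + T)) + real n * h * (slope * (1 + T))"
    using Suc.prems by (intro add_mono euler_step(2)[OF h _ z] Suc.IH le) auto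
  finally show ?case by (simp add: algebra_simps)
qed simp

text \<open>The first summand bounds the rate at which the field changes along the scheme, the
  second is the defect of one step against explicit Euler.\<close>

definition curvature :: real where
  "curvature = \<Lambda> * (slope * (1 + T)) + slope"

lemma curvature_nonneg: "0 \<le> curvature"
  using lip_nonneg slope_nonneg T_pos by (simp add: curvature_def)

text \<open>A discrete Taylor formula: each step adds its own defect and \<open>h\<close> times the
  drift of the field since step \<open>i\<close>. The summand \<open>real n * h * h\<close> is of
  the order of the mesh at fixed elapsed time and disappears in the limit.\<close>

lemma euler_taylor:
  assumes h: "0 \<le> h" "h * K 0 \<le> 1 / 2" and k: "real (i + n) * h \<le> T" and z: "z \<in> label_box r"
  shows "norm (euler h (i + n) z - euler h i z - (real n * h) *\<^sub>R field (euler h i) (euler h i z))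
    \<le> curvature * ((real n * h)\<^sup>2 + real n * h * h)"
  using k
proof (induction n)
  case (Suc n)
  have le: "real (i + n) * h \<le> T" using Suc.prems h by (simp add: algebra_simps)
  then have le': "real i * h \<le> T" using h by (simp add: algebra_simps) (smt (verit) mult_nonneg_nonneg of_nat_0_le_iff)
  let ?E = "\<lambda>j. euler h j z" and ?F = "\<lambda>j. field (euler h j) (euler h j z)"
  have F: "norm (?F (i + n) - ?F i) \<le> \<Lambda> * (real n * h * (slope * (1 + T)))"
    using T_pos le le' h
    by (intro field_lipD[of T _ T] euler_admissible euler_increment z) auto
  have split: "?E (i + Suc n) - ?E i - (real (Suc n) * h) *\<^sub>R ?F i =
      (?E (Suc (i + n)) - ?E (i + n) - h *\<^sub>R ?F (i + n)) + h *\<^sub>R (?F (i + n) - ?F i)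
        + (?E (i + n) - ?E i - (real n * h) *\<^sub>R ?F i)"
    by (simp add: algebra_simps)
  have "norm (?E (i + Suc n) - ?E i - (real (Suc n) * h) *\<^sub>R ?F i)
      \<le> h\<^sup>2 * slope + h * (\<Lambda> * (real n * h * (slope * (1 + T))))
      + curvature * ((real n * h)\<^sup>2 + real n * h * h)"
    unfolding split
  proof (intro norm_triangle_mono)
    show "norm (h *\<^sub>R (?F (i + n) - ?F i)) \<le> h * (\<Lambda> * (real n * h * (slope * (1 + T))))"
      using F h by (simp add: mult_left_mono)
    show "norm (?E (Suc (i + n)) - ?E (i + n) - h *\<^sub>R ?F (i + n)) \<le> h\<^sup>2 * slope"
      using Suc.prems by (intro euler_step(1)[OF h _ z]) simp
    show "norm (?E (i + n) - ?E i - (real n * h) *\<^sub>R ?F i) \<le> curvature * ((real n * h)\<^sup>2 + real n * h * h)"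
      by (rule Suc.IH[OF le])
  qed
  \<comment> \<open>Passing from \<open>n\<close> to \<open>Suc n\<close> increases the bracket by
    \<open>(2 * n + 2) * h\<^sup>2\<close>, which dominates the new error.\<close>
  also have "\<dots> \<le> curvature * ((real (Suc n) * h)\<^sup>2 + real (Suc n) * h * h)"
  proof -
    define A where "A = \<Lambda> * (slope * (1 + T))"
    have A: "0 \<le> A" using lip_nonneg slope_nonneg T_pos by (simp add: A_def)
    have "h\<^sup>2 * slope + h * (\<Lambda> * (real n * h * (slope * (1 + T)))) = h\<^sup>2 * (slope + A * real n)"
      by (simp add: A_def power2_eq_square algebra_simps)
    also have "\<dots> \<le> h\<^sup>2 * ((A + slope) * (2 * real n + 2))"
      using A slope_nonneg by (intro mult_left_mono) (auto simp: algebra_simps)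
    finally show ?thesis
      unfolding curvature_def A_def[symmetric] by (simp add: power2_eq_square algebra_simps)
  qed
  finally show ?case .
qed simp

text \<open>Discrete Gronwall. One coarse step errs by \<open>h\<^sup>2 * curvature\<close>, two
  half steps by at most \<open>2 * h\<^sup>2 * curvature\<close>, hence the 3. The induction
  hypothesis must hold for all labels of the box, since the two fields are compared through the
  distance over the whole box.\<close>

lemma euler_refine:
  assumes h: "0 \<le> h" "h * K 0 \<le> 1 / 2" and k: "real k * h \<le> T" and z: "z \<in> label_box r"
  shows "norm (euler h k z - euler (h / 2) (2 * k) z) \<le> 3 * curvature * h * (real k * h) * exp (\<Lambda> * (real k * h))"
  using k z
proof (induction k arbitrary: z)
  case (Suc k)
  have h2: "0 \<le> h / 2" "h / 2 * K 0 \<le> 1 / 2" using h by auto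
  have le: "real k * h \<le> T" using Suc.prems h by (simp add: algebra_simps)
  let ?D = "3 * curvature * h * (real k * h) * exp (\<Lambda> * (real k * h))"
  let ?\<Phi> = "euler h k" and ?\<Psi> = "euler (h / 2) (2 * k)"
  let ?F = "field ?\<Phi> (?\<Phi> z)" and ?G = "field ?\<Psi> (?\<Psi> z)"
  have FG: "norm (?F - ?G) \<le> \<Lambda> * ?D"
    using T_pos le
    by (intro field_lipD[of T _ T] euler_admissible h h2 Suc) auto
  have 1: "norm (euler h (Suc k) z - ?\<Phi> z - h *\<^sub>R ?F) \<le> h\<^sup>2 * curvature"
  proof -
    have "slope \<le> curvature" unfolding curvature_def using lip_nonneg slope_nonneg T_pos by simp
    then show ?thesis
      using euler_step(1)[OF h Suc.prems(1,2)] by (meson mult_left_mono order.trans zero_le_power2)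
  qed
  have "norm (euler (h / 2) (2 * k + 2) z - ?\<Psi> z - (real 2 * (h / 2)) *\<^sub>R ?G)
      \<le> curvature * ((real 2 * (h / 2))\<^sup>2 + real 2 * (h / 2) * (h / 2))"
    using Suc.prems by (intro euler_taylor h2) (auto simp: algebra_simps)
  also have "\<dots> \<le> 2 * h\<^sup>2 * curvature"
    using curvature_nonneg h by (simp add: power2_eq_square algebra_simps)
  finally have 2: "norm (euler (h / 2) (2 * k + 2) z - ?\<Psi> z - h *\<^sub>R ?G) \<le> 2 * h\<^sup>2 * curvature" by simp
  have split: "euler h (Suc k) z - euler (h / 2) (2 * Suc k) z =
      (euler h (Suc k) z - ?\<Phi> z - h *\<^sub>R ?F) - (euler (h / 2) (2 * k + 2) z - ?\<Psi> z - h *\<^sub>R ?G)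
        + (?\<Phi> z - ?\<Psi> z) + h *\<^sub>R (?F - ?G)"
    by (simp add: scaleR_diff_right del: euler.simps)
  have "norm (euler h (Suc k) z - euler (h / 2) (2 * Suc k) z)
      \<le> (h\<^sup>2 * curvature + 2 * h\<^sup>2 * curvature) + ?D + h * (\<Lambda> * ?D)"
    unfolding split
  proof (intro norm_triangle_mono)
    show "norm ((euler h (Suc k) z - ?\<Phi> z - h *\<^sub>R ?F) - (euler (h / 2) (2 * k + 2) z - ?\<Psi> z - h *\<^sub>R ?G))
        \<le> h\<^sup>2 * curvature + 2 * h\<^sup>2 * curvature"
      using 1 2 by (rule order.trans[OF norm_triangle_ineq4 add_mono])
    show "norm (?\<Phi> z - ?\<Psi> z) \<le> ?D" using Suc.IH[OF le Suc.prems(2)] .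
    show "norm (h *\<^sub>R (?F - ?G)) \<le> h * (\<Lambda> * ?D)" using FG h by (simp add: mult_left_mono)
  qed
  also have "\<dots> = 3 * curvature * h * h + (1 + \<Lambda> * h) * ?D"
    by (simp add: power2_eq_square algebra_simps)
  also have "\<dots> \<le> 3 * curvature * h * h * exp (\<Lambda> * (real (Suc k) * h)) + exp (\<Lambda> * h) * ?D"
  proof (intro add_mono mult_right_mono)
    have "1 \<le> exp (\<Lambda> * (real (Suc k) * h))" using lip_nonneg h by simp
    then show "3 * curvature * h * h \<le> 3 * curvature * h * h * exp (\<Lambda> * (real (Suc k) * h))"
      using mult_left_mono[of 1 "exp (\<Lambda> * (real (Suc k) * h))" "3 * curvature * h * h"] curvature_nonneg h by simp
    show "1 + \<Lambda> * h \<le> exp (\<Lambda> * h)" by (rule exp_ge_add_one_self)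
    show "0 \<le> ?D" using curvature_nonneg h by simp
  qed
  also have "\<dots> = 3 * curvature * h * (real (Suc k) * h) * exp (\<Lambda> * (real (Suc k) * h))"
    by (simp add: algebra_simps exp_add)
  finally show ?case .
qed simp

end

subsection \<open>The limit flow\<close>

context alignment_box
begin

text \<open>The first summand comes from \<open>euler_refine\<close>, the second from the possible
  extra fine step of \<open>steps_Suc\<close>; \<open>mesh 0\<close> is the factor left over when
  \<open>mesh n\<close> is written as \<open>mesh 0 / 2 ^ n\<close>.\<close>

definition rate :: real where
  "rate = mesh 0 * (3 * curvature * T * exp (\<Lambda> * T) + slope * (1 + T))"

lemma rate_nonneg: "0 \<le> rate"
  using mesh_nonneg curvature_nonneg slope_nonneg T_pos by (simp add: rate_def)

lemma approx_refine:
  assumes t: "t \<in> {0..T}" and z: "z \<in> label_box r"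
  shows "dist (approx n t z) (approx (Suc n) t z) \<le> rate / 2 ^ n"
proof -
  define h k where "h = mesh n" and "k = steps n t"
  have h: "0 \<le> h" "h * K 0 \<le> 1 / 2" and h2: "0 \<le> h / 2" "h / 2 * K 0 \<le> 1 / 2"
    using mesh_nonneg[of n] mesh_K[of n] by (auto simp: h_def)
  have kh: "0 \<le> real k * h" "real k * h \<le> T"
    using steps_bounds(1)[of t n] t h(1) by (auto simp: h_def k_def)
  have "norm (euler h k z - euler (h / 2) (2 * k) z) \<le> 3 * curvature * h * (real k * h) * exp (\<Lambda> * (real k * h))"
    by (rule euler_refine[OF h kh(2) z])
  also have "\<dots> \<le> 3 * curvature * h * T * exp (\<Lambda> * T)"
    using kh h(1) curvature_nonneg lip_nonneg T_pos by (intro mult_mono) (auto intro: mult_left_mono)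
  finally have 1: "norm (euler h k z - euler (h / 2) (2 * k) z) \<le> 3 * curvature * h * T * exp (\<Lambda> * T)" .
  have 2: "norm (euler (h / 2) (2 * k) z - euler (h / 2) (steps (Suc n) t) z) \<le> h * (slope * (1 + T))"
  proof -
    consider "steps (Suc n) t = 2 * k" | "steps (Suc n) t = Suc (2 * k)"
      using steps_Suc[of t n] t by (auto simp: k_def)
    then show ?thesis
    proof cases
      case 1
      then show ?thesis using h slope_nonneg T_pos by simp
    next
      case 2
      have "real (Suc (2 * k)) * (h / 2) \<le> T"
        using steps_bounds(1)[of t "Suc n"] t 2 by (auto simp: mesh_Suc h_def)
      from euler_step(2)[OF h2 this z]
      have "norm (euler (h / 2) (2 * k) z - euler (h / 2) (steps (Suc n) t) z) \<le> h / 2 * (slope * (1 + T))"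
        unfolding 2 by (simp add: norm_minus_commute)
      also have "\<dots> \<le> h * (slope * (1 + T))"
        using h slope_nonneg T_pos by (intro mult_right_mono) auto
      finally show ?thesis .
    qed
  qed
  have "dist (approx n t z) (approx (Suc n) t z)
      \<le> norm (euler h k z - euler (h / 2) (2 * k) z) + norm (euler (h / 2) (2 * k) z - euler (h / 2) (steps (Suc n) t) z)"
    unfolding dist_norm[symmetric] approx_def mesh_Suc h_def k_def by (rule dist_triangle)
  also have "\<dots> \<le> 3 * curvature * h * T * exp (\<Lambda> * T) + h * (slope * (1 + T))"
    using 1 2 by (rule add_mono)
  also have "\<dots> = rate / 2 ^ n"
    unfolding rate_def h_def mesh_eq[of n] by (simp add: field_simps)
  finally show ?thesis .
qed

lemma approx_tendsto_flow:
  assumes "t \<in> {0..T}" "z \<in> label_box r"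
  shows "(\<lambda>n. approx n t z) \<longlonglongrightarrow> flow t z"
  unfolding flow_def
  by (rule geometric_cauchy_limit(1)[OF approx_refine[OF assms] rate_nonneg])

lemma approx_flow_rate:
  assumes "t \<in> {0..T}" "z \<in> label_box r"
  shows "norm (approx n t z - flow t z) \<le> 2 * rate / 2 ^ n"
  unfolding flow_def dist_norm[symmetric]
  by (rule geometric_cauchy_limit(2)[OF approx_refine[OF assms] rate_nonneg])

end

context alignment_data
begin

text \<open>\<open>approx\<close> and \<open>flow\<close> do not mention \<open>r\<close> or
  \<open>\<Lambda>\<close>, so estimates made in any box around a label give statements about that
  label; this glues the boxes.\<close>

lemma alignment_box_exists:
  obtains r \<Lambda> where "alignment_box M K L C\<^sub>0 R\<^sub>x R\<^sub>v T r \<Lambda>" "z \<in> label_box r"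
proof -
  define r where "r = Max {R\<^sub>x, R\<^sub>v, norm (fst z), norm (snd z)}"
  have r: "R\<^sub>x \<le> r" "R\<^sub>v \<le> r" "z \<in> label_box r"
    by (auto simp: r_def label_box_def)
  obtain \<Lambda> where "field_lip r \<Lambda>" using field_lip_exists[OF r(1,2)] by blast
  then have "alignment_box M K L C\<^sub>0 R\<^sub>x R\<^sub>v T r \<Lambda>"
    using r by unfold_locales
  then show thesis using r(3) by (rule that)
qed

lemma approx_tendsto: 
  assumes t: "t \<in> {0..T}"
  shows "(\<lambda>n. approx n t z) \<longlonglongrightarrow> flow t z"
proof -
  obtain r \<Lambda> where "alignment_box M K L C\<^sub>0 R\<^sub>x R\<^sub>v T r \<Lambda>" and z: "z \<in> label_box r"
    by (rule alignment_box_exists)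
  then interpret alignment_box M K L C\<^sub>0 R\<^sub>x R\<^sub>v T r \<Lambda> by simp
  show ?thesis by (rule approx_tendsto_flow[OF t z])
qed

lemma flow_admissible:
  assumes t: "t \<in> {0..T}"
  shows "admissible t (flow t)"
  unfolding admissible_def phase_bound_def
proof (intro conjI ballI allI impI)
  have m: "approx n t \<in> borel_measurable M" for n
    by (rule admissible_measurable[OF approx_admissible[OF t]])
  have flow_M: "flow t \<in> borel_measurable M"
    by (rule borel_measurable_LIMSEQ_metric[OF m approx_tendsto[OF t]])
  then show "flow t \<in> borel_measurable borel" by (simp add: measurable_M_iff)
  fix B :: "('a \<times> 'a) set" assume B: "B \<in> sets borel"
  have "emeasure M {z \<in> space M. flow t z \<in> B} \<le> ennreal phase_const * emeasure lborel B"
  proof (rule emeasure_distr_limit_le[where \<Phi>="\<lambda>n. approx n t"])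
    show "emeasure M {z \<in> space M. approx n t z \<in> B} \<le> ennreal phase_const * emeasure lborel B"
      if "B \<in> sets borel" for n B
      using approx_admissible[OF t, of n] that by (simp add: admissible_def phase_bound_def space_M)
  qed (rule m flow_M approx_tendsto[OF t] phase_const_nonneg B)+
  then show "emeasure M {z. flow t z \<in> B} \<le> ennreal phase_const * emeasure lborel B"
    by (simp add: space_M)
next
  fix p q :: real and z :: "'a \<times> 'a"
  assume q: "R\<^sub>v \<le> q" and z: "norm (fst z) \<le> p" "norm (snd z) \<le> q"
  have "(\<lambda>n. norm (fst (approx n t z))) \<longlonglongrightarrow> norm (fst (flow t z))"
    by (intro tendsto_intros approx_tendsto t)
  then show "norm (fst (flow t z)) \<le> p + t * q"
    by (rule LIMSEQ_le_const2) (intro exI allI impI admissible_box(1)[OF approx_admissible[OF t] q z])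
  have "(\<lambda>n. norm (snd (approx n t z))) \<longlonglongrightarrow> norm (snd (flow t z))"
    by (intro tendsto_intros approx_tendsto t)
  then show "norm (snd (flow t z)) \<le> q"
    by (rule LIMSEQ_le_const2) (intro exI allI impI admissible_box(2)[OF approx_admissible[OF t] q z])
qed

lemma flow_0: "flow 0 z = z"
  unfolding flow_def approx_def steps_def by simp

end

context alignment_box
begin

text \<open>The field is nonlocal in the labels; the uniform convergence over the box that
  \<open>field_lipD\<close> asks for is \<open>approx_flow_rate\<close>.\<close>

lemma field_approx_tendsto:
  assumes t: "t \<in> {0..T}" and z: "z \<in> label_box r"
  shows "(\<lambda>n. field (approx n t) (approx n t z)) \<longlonglongrightarrow> field (flow t) (flow t z)"
proof -
  have bd: "norm (field (approx n t) (approx n t z) - field (flow t) (flow t z)) \<le> \<Lambda> * (2 * rate / 2 ^ n)" for n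
    by (rule field_lipD[OF approx_admissible[OF t] flow_admissible[OF t] t t approx_flow_rate[OF t] z])
  have "(\<lambda>n. \<Lambda> * (2 * rate) * (1 / 2) ^ n) \<longlonglongrightarrow> \<Lambda> * (2 * rate) * 0"
    by (intro tendsto_mult tendsto_const LIMSEQ_power_zero) simp
  then have "(\<lambda>n. \<Lambda> * (2 * rate / 2 ^ n)) \<longlonglongrightarrow> 0"
    by (simp add: power_divide)
  then have "(\<lambda>n. field (approx n t) (approx n t z) - field (flow t) (flow t z)) \<longlonglongrightarrow> 0"
    by (rule Lim_null_comparison[OF always_eventually[OF allI[OF bd]]])
  then show ?thesis by (simp add: LIM_zero_iff)
qed

lemma approx_shift:
  assumes st: "s \<in> {0..T}" "t \<in> {0..T}" "s \<le> t" and z: "z \<in> label_box r"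
  defines "\<tau> \<equiv> \<lambda>n. real (steps n t - steps n s) * mesh n"
  shows "norm (approx n t z - approx n s z) \<le> \<tau> n * (slope * (1 + T))"
    and "norm (approx n t z - approx n s z - \<tau> n *\<^sub>R field (approx n s) (approx n s z))
      \<le> curvature * ((\<tau> n)\<^sup>2 + \<tau> n * mesh n)"
    and "\<tau> \<longlonglongrightarrow> t - s"
proof -
  have le: "steps n s \<le> steps n t" for n using st by (intro steps_mono)
  then have eq: "steps n t = steps n s + (steps n t - steps n s)" for n by simp
  have T: "real (steps n s + (steps n t - steps n s)) * mesh n \<le> T"
    using steps_bounds(1)[of t n] st eq[of n] by auto
  show "norm (approx n t z - approx n s z) \<le> \<tau> n * (slope * (1 + T))"
    using euler_increment[OF mesh_nonneg mesh_K T z] eq[of n] by (simp add: approx_def \<tau>_def)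
  show "norm (approx n t z - approx n s z - \<tau> n *\<^sub>R field (approx n s) (approx n s z))
      \<le> curvature * ((\<tau> n)\<^sup>2 + \<tau> n * mesh n)"
    using euler_taylor[OF mesh_nonneg mesh_K T z] eq[of n] by (simp add: approx_def \<tau>_def)
  have "\<tau> = (\<lambda>n. real (steps n t) * mesh n - real (steps n s) * mesh n)"
    using le by (auto simp: \<tau>_def of_nat_diff algebra_simps)
  moreover have "(\<lambda>n. real (steps n t) * mesh n - real (steps n s) * mesh n) \<longlonglongrightarrow> t - s"
    using st by (intro tendsto_diff steps_mesh_tendsto) auto
  ultimately show "\<tau> \<longlonglongrightarrow> t - s" by simp
qed

lemma flow_lipschitz:
  assumes st: "s \<in> {0..T}" "t \<in> {0..T}" and z: "z \<in> label_box r"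
  shows "norm (flow t z - flow s z) \<le> \<bar>t - s\<bar> * (slope * (1 + T))"
proof -
  have *: "norm (flow t z - flow s z) \<le> (t - s) * (slope * (1 + T))"
    if st: "s \<in> {0..T}" "t \<in> {0..T}" "s \<le> t" for s t
  proof (rule LIMSEQ_le)
    show "(\<lambda>n. norm (approx n t z - approx n s z)) \<longlonglongrightarrow> norm (flow t z - flow s z)"
      using st z by (intro tendsto_intros approx_tendsto_flow)
    show "(\<lambda>n. real (steps n t - steps n s) * mesh n * (slope * (1 + T))) \<longlonglongrightarrow> (t - s) * (slope * (1 + T))"
      by (intro tendsto_mult tendsto_const approx_shift(3)[OF st z])
  qed (intro exI allI impI approx_shift(1)[OF st z])
  show ?thesis
    using *[of s t] *[of t s] st by (cases "s \<le> t") (auto simp: norm_minus_commute)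
qed

lemma flow_taylor_forward:
  assumes st: "s \<in> {0..T}" "t \<in> {0..T}" "s \<le> t" and z: "z \<in> label_box r"
  shows "norm (flow t z - flow s z - (t - s) *\<^sub>R field (flow s) (flow s z)) \<le> curvature * (t - s)\<^sup>2"
proof (rule LIMSEQ_le)
  let ?\<tau> = "\<lambda>n. real (steps n t - steps n s) * mesh n"
  show "(\<lambda>n. norm (approx n t z - approx n s z - ?\<tau> n *\<^sub>R field (approx n s) (approx n s z)))
      \<longlonglongrightarrow> norm (flow t z - flow s z - (t - s) *\<^sub>R field (flow s) (flow s z))"
    using st z by (intro tendsto_intros approx_tendsto_flow field_approx_tendsto approx_shift(3))
  have "(\<lambda>n. curvature * ((?\<tau> n)\<^sup>2 + ?\<tau> n * mesh n)) \<longlonglongrightarrow> curvature * ((t - s)\<^sup>2 + (t - s) * 0)"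
    by (intro tendsto_intros mesh_tendsto_0 approx_shift(3)[OF st z])
  then show "(\<lambda>n. curvature * ((?\<tau> n)\<^sup>2 + ?\<tau> n * mesh n)) \<longlonglongrightarrow> curvature * (t - s)\<^sup>2"
    by simp
qed (intro exI allI impI approx_shift(2)[OF st z])

text \<open>The derivative within \<open>{0..T}\<close> also needs times \<open>s < t\<close>. There
  the forward expansion is made at \<open>s\<close>, and the field at \<open>s\<close> is replaced
  by that at \<open>t\<close> at a cost that is again quadratic in \<open>s - t\<close>.\<close>

lemma flow_taylor:
  assumes st: "s \<in> {0..T}" "t \<in> {0..T}" and z: "z \<in> label_box r"
  shows "norm (flow s z - flow t z - (s - t) *\<^sub>R field (flow t) (flow t z))
    \<le> (curvature + \<Lambda> * (slope * (1 + T))) * (s - t)\<^sup>2"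
proof (cases "t \<le> s")
  case True
  have "0 \<le> \<Lambda> * (slope * (1 + T)) * (s - t)\<^sup>2"
    using lip_nonneg slope_nonneg T_pos by simp
  with flow_taylor_forward[OF st(2,1) True z] show ?thesis
    by (simp add: distrib_right)
next
  case False
  let ?F = "\<lambda>t. field (flow t) (flow t z)"
  have "norm (?F s - ?F t) \<le> \<Lambda> * (\<bar>s - t\<bar> * (slope * (1 + T)))"
    by (rule field_lipD[OF flow_admissible flow_admissible]) (use st z flow_lipschitz in auto)
  then have "norm ((t - s) *\<^sub>R (?F s - ?F t)) \<le> (t - s) * (\<Lambda> * ((t - s) * (slope * (1 + T))))"
    using False by (simp add: mult_left_mono)
  moreover have "flow s z - flow t z - (s - t) *\<^sub>R ?F t
      = - ((flow t z - flow s z - (t - s) *\<^sub>R ?F s) + (t - s) *\<^sub>R (?F s - ?F t))"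
    by (simp add: algebra_simps)
  ultimately have "norm (flow s z - flow t z - (s - t) *\<^sub>R ?F t)
      \<le> curvature * (t - s)\<^sup>2 + (t - s) * (\<Lambda> * ((t - s) * (slope * (1 + T))))"
    using flow_taylor_forward[OF st _ z] False
    by (simp only: norm_minus_cancel) (intro norm_triangle_mono, auto)
  then show ?thesis
    by (simp add: power2_eq_square algebra_simps)
qed

end

context alignment_data
begin

lemma flow_has_vector_derivative:
  assumes t: "t \<in> {0..T}"
  shows "((\<lambda>s. flow s z) has_vector_derivative field (flow t) (flow t z)) (at t within {0..T})"
proof -
  obtain r \<Lambda> where "alignment_box M K L C\<^sub>0 R\<^sub>x R\<^sub>v T r \<Lambda>" and z: "z \<in> label_box r"
    by (rule alignment_box_exists)
  then interpret alignment_box M K L C\<^sub>0 R\<^sub>x R\<^sub>v T r \<Lambda> by simp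
  show ?thesis
    by (rule has_vector_derivative_quadraticI[OF flow_taylor[OF _ t z]])
qed

end

subsection \<open>Boundedness of the velocity moment\<close>

lemma norm_diff_le_of_vector_derivative:
  fixes f :: "real \<Rightarrow> 'b::real_normed_vector"
  assumes I: "convex I" and B: "\<And>t. t \<in> I \<Longrightarrow> \<exists>D. (f has_vector_derivative D) (at t within I) \<and> norm D \<le> B"
    and "\<sigma> \<in> I" "\<tau> \<in> I"
  shows "norm (f \<tau> - f \<sigma>) \<le> B * \<bar>\<tau> - \<sigma>\<bar>"
proof -
  obtain D where D: "\<And>t. t \<in> I \<Longrightarrow> (f has_vector_derivative D t) (at t within I)" "\<And>t. t \<in> I \<Longrightarrow> norm (D t) \<le> B"
    using B by metis
  have "norm (f \<tau> - f \<sigma>) \<le> B * norm (\<tau> - \<sigma>)"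
  proof (rule differentiable_bound[OF I, where f'="\<lambda>t x. x *\<^sub>R D t"])
    show "(f has_derivative (\<lambda>x. x *\<^sub>R D t)) (at t within I)" if "t \<in> I" for t
      using D(1)[OF that] by (simp add: has_vector_derivative_def)
    show "onorm (\<lambda>x. x *\<^sub>R D t) \<le> B" if "t \<in> I" for t
    proof (rule onorm_bound)
      show "0 \<le> B" using norm_ge_zero D(2)[OF that] by (rule order.trans)
      show "norm (x *\<^sub>R D t) \<le> B * norm x" for x
        using mult_left_mono[OF D(2)[OF that], of "\<bar>x\<bar>"] by (simp add: mult.commute)
    qed
  qed fact+
  then show ?thesis by simp
qed

lemma continuous_on_of_vector_derivative:
  assumes "\<And>t. t \<in> S \<Longrightarrow> \<exists>D. (f has_vector_derivative D) (at t within S) \<and> P t D"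
  shows "continuous_on S f"
  unfolding continuous_on_eq_continuous_within
proof
  fix t assume "t \<in> S"
  then obtain D where "(f has_vector_derivative D) (at t within S)"
    using assms by auto
  then show "continuous (at t within S) f" by (rule has_vector_derivative_continuous)
qed

lemma locally_bounded_imp_bounded:
  fixes m :: "real \<Rightarrow> real"
  assumes "compact C" and "\<And>t. t \<in> C \<Longrightarrow> \<exists>e>0. \<exists>S. \<forall>s\<in>C. \<bar>s - t\<bar> < e \<longrightarrow> m s \<le> S"
  shows "\<exists>S. \<forall>s\<in>C. m s \<le> S"
proof -
  obtain e S where e: "\<And>t. t \<in> C \<Longrightarrow> 0 < e t" and S: "\<And>t s. t \<in> C \<Longrightarrow> s \<in> C \<Longrightarrow> \<bar>s - t\<bar> < e t \<Longrightarrow> m s \<le> S t"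
    using assms(2) by metis
  have cover: "C \<subseteq> (\<Union>t\<in>C. ball t (e t))"
    using e by force
  obtain D where D: "D \<subseteq> C" "finite D" "C \<subseteq> (\<Union>t\<in>D. ball t (e t))"
    by (rule compactE_image[OF assms(1) open_ball cover])
  have "m s \<le> Max (S ` D)" if s: "s \<in> C" for s
  proof -
    obtain t where t: "t \<in> D" "s \<in> ball t (e t)" using D(3) s by blast
    then have "m s \<le> S t" using D(1) s by (intro S) (auto simp: dist_real_def abs_minus_commute)
    also have "\<dots> \<le> Max (S ` D)" using D(2) t by simp
    finally show ?thesis .
  qed
  then show ?thesis by blast
qed

text \<open>If no \<open>F n\<close> contained a relatively open piece of \<open>E\<close>, every
  \<open>E - F n\<close> would be relatively open and dense in \<open>E\<close>, and so would have a
  dense intersection, which however is empty.\<close>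

lemma Baire_closed_cover:
  fixes E :: "'b::{real_normed_vector,heine_borel} set"
  assumes E: "closed E" "E \<noteq> {}" and F: "\<And>n::nat. closed (F n)" "E \<subseteq> (\<Union>n. F n)"
  obtains p n e where "p \<in> E" "0 < e" "ball p e \<inter> E \<subseteq> F n"
proof -
  have "\<exists>n. \<not> E \<subseteq> closure (E - F n)"
  proof (rule ccontr)
    assume dense: "\<nexists>n. \<not> E \<subseteq> closure (E - F n)"
    have "E \<subseteq> closure (\<Inter>(range (\<lambda>n. E - F n)))"
    proof (rule Baire[OF E(1)])
      fix S assume "S \<in> range (\<lambda>n. E - F n)"
      then obtain n where S: "S = E - F n" by blast
      have "openin (top_of_set E) (E \<inter> - F n)"
        using F(1)[of n] by (intro openin_open_Int) auto
      then show "openin (top_of_set E) S \<and> E \<subseteq> closure S"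
        using dense unfolding S by (auto simp: Diff_eq)
    qed simp
    moreover have "\<Inter>(range (\<lambda>n. E - F n)) = {}" using F(2) by blast
    ultimately show False using E(2) by (metis closure_empty subset_empty)
  qed
  then obtain n p where p: "p \<in> E" "p \<notin> closure (E - F n)" by blast
  then obtain e where "0 < e" "ball p e \<subseteq> - closure (E - F n)"
    using open_contains_ball[of "- closure (E - F n)"] by auto
  moreover from this have "ball p e \<inter> E \<subseteq> F n"
    using closure_subset[of "E - F n"] by blast
  ultimately show thesis using that p(1) by blast
qed

context prob_space
begin

context
  fixes V :: "real \<Rightarrow> 'a \<Rightarrow> 'b::euclidean_space" and G :: "'a set" and c T :: real and m :: "real \<Rightarrow> real"
  assumes G: "AE z in M. z \<in> G" and c: "0 \<le> c"
    and int: "\<And>t. t \<in> {0..T} \<Longrightarrow> integrable M (V t)"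
  defines "m \<equiv> \<lambda>t. \<integral>z. norm (V t z) \<partial>M"
  assumes deriv: "\<And>z t. z \<in> G \<Longrightarrow> t \<in> {0..T} \<Longrightarrow>
      \<exists>D. ((\<lambda>s. V s z) has_vector_derivative D) (at t within {0..T}) \<and> norm D \<le> c * (m t + norm (V t z))"
begin

lemma moment_nonneg: "0 \<le> m t"
  by (simp add: m_def)

text \<open>Let \<open>S\<close> be the supremum of \<open>m\<close> on \<open>I\<close> and
  \<open>N\<close> the largest speed of one label there. As \<open>c\<close> times the length is at
  most 1/4, \<open>N\<close> is at most its speed at \<open>\<sigma>\<close> plus
  \<open>(S + N) / 4\<close>. Solving for \<open>N\<close>, integrating over labels and taking the
  supremum gives \<open>S \<le> 4 / 3 * m \<sigma> + S / 3\<close>. The a priori bound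
  \<open>S\<^sub>0\<close> makes \<open>S\<close> finite, so that it can be absorbed. The order of
  \<open>\<sigma>\<close> and \<open>\<tau>\<close> is free.\<close>

lemma moment_short_interval:
  assumes I: "I \<subseteq> {0..T}" "convex I" "compact I" and short: "\<And>\<sigma> \<tau>. \<sigma> \<in> I \<Longrightarrow> \<tau> \<in> I \<Longrightarrow> c * \<bar>\<tau> - \<sigma>\<bar> \<le> 1 / 4"
    and bdd: "\<And>\<tau>. \<tau> \<in> I \<Longrightarrow> m \<tau> \<le> S\<^sub>0" and \<tau>\<sigma>: "\<sigma> \<in> I" "\<tau> \<in> I"
  shows "m \<tau> \<le> 2 * m \<sigma>"
proof -
  define S where "S = (SUP \<tau>\<in>I. m \<tau>)"
  have bdd': "bdd_above (m ` I)" using bdd by (auto intro!: bdd_aboveI)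
  have mS: "m \<rho> \<le> S" if "\<rho> \<in> I" for \<rho>
    unfolding S_def using bdd' that by (rule cSUP_upper2) simp
  have path: "norm (V \<rho> z) \<le> 4 / 3 * norm (V \<sigma> z) + S / 3" if z: "z \<in> G" and \<rho>: "\<rho> \<in> I" for z \<rho>
  proof -
    have dI: "\<exists>D. ((\<lambda>s. V s z) has_vector_derivative D) (at t within I) \<and> norm D \<le> c * (m t + norm (V t z))"
      if "t \<in> I" for t
      using deriv[OF z, of t] that I(1) by (meson has_vector_derivative_within_subset subsetD)
    then have "continuous_on I (\<lambda>s. V s z)"
      by (rule continuous_on_of_vector_derivative)
    then have "continuous_on I (\<lambda>s. norm (V s z))" by (intro continuous_intros)
    then obtain \<rho>' where \<rho>': "\<rho>' \<in> I" "\<And>t. t \<in> I \<Longrightarrow> norm (V t z) \<le> norm (V \<rho>' z)"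
      using continuous_attains_sup[OF I(3)] \<tau>\<sigma> by (metis empty_iff)
    define N where "N = norm (V \<rho>' z)"
    have "S \<ge> 0" using moment_nonneg mS[OF \<tau>\<sigma>(1)] by (rule order.trans)
    then have SN: "0 \<le> S + N" by (simp add: N_def)
    have "norm (V \<rho>' z - V \<sigma> z) \<le> c * (S + N) * \<bar>\<rho>' - \<sigma>\<bar>"
    proof (rule norm_diff_le_of_vector_derivative[OF I(2) _ \<tau>\<sigma>(1) \<rho>'(1)])
      fix t assume t: "t \<in> I"
      have "c * (m t + norm (V t z)) \<le> c * (S + N)"
        unfolding N_def using c mS[OF t] \<rho>'(2)[OF t] by (intro mult_left_mono add_mono)
      then show "\<exists>D. ((\<lambda>s. V s z) has_vector_derivative D) (at t within I) \<and> norm D \<le> c * (S + N)"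
        using dI[OF t] by (meson order.trans)
    qed
    also have "\<dots> = (c * \<bar>\<rho>' - \<sigma>\<bar>) * (S + N)" by simp
    also have "\<dots> \<le> 1 / 4 * (S + N)"
      using short[OF \<tau>\<sigma>(1) \<rho>'(1)] SN by (rule mult_right_mono)
    finally have "N \<le> norm (V \<sigma> z) + 1 / 4 * (S + N)"
      using norm_triangle_ineq2[of "V \<rho>' z" "V \<sigma> z"] unfolding N_def by linarith
    then have "N \<le> 4 / 3 * norm (V \<sigma> z) + S / 3" by (simp add: field_simps)
    with \<rho>'(2)[OF \<rho>] show ?thesis by (simp add: N_def)
  qed
  have step: "m \<rho> \<le> 4 / 3 * m \<sigma> + S / 3" if \<rho>: "\<rho> \<in> I" for \<rho>
  proof -
    have i: "integrable M (V \<rho>)" "integrable M (V \<sigma>)" using \<rho> \<tau>\<sigma> I(1) by (auto intro: int)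
    have "m \<rho> \<le> (\<integral>z. 4 / 3 * norm (V \<sigma> z) + S / 3 \<partial>M)"
      unfolding m_def
    proof (rule integral_mono_AE)
      show "AE z in M. norm (V \<rho> z) \<le> 4 / 3 * norm (V \<sigma> z) + S / 3"
        using G by eventually_elim (rule path[OF _ \<rho>])
    qed (use i in auto)
    also have "\<dots> = 4 / 3 * m \<sigma> + S / 3"
      unfolding m_def using i by (simp add: prob_space)
    finally show ?thesis .
  qed
  have "S \<le> 4 / 3 * m \<sigma> + S / 3"
    unfolding S_def[symmetric] by (subst S_def, rule cSUP_least) (use \<tau>\<sigma> step in auto)
  with mS[OF \<tau>\<sigma>(2)] show ?thesis by simp
qed

text \<open>Paths are continuous in time, so Fatou's lemma makes \<open>m\<close> lower
  semicontinuous. No domination is at hand that would give continuity, but closed sublevel sets are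
  all that Baire's theorem needs.\<close>

lemma moment_sublevel_closed: "closed {t \<in> {0..T}. m t \<le> a}"
  unfolding closed_sequential_limits
proof (intro allI impI)
  fix x l assume "(\<forall>n. x n \<in> {t \<in> {0..T}. m t \<le> a}) \<and> x \<longlonglongrightarrow> l"
  then have x: "\<And>n. x n \<in> {0..T}" "\<And>n. m (x n) \<le> a" and lim: "x \<longlonglongrightarrow> l" by auto
  have l: "l \<in> {0..T}"
    using lim x(1) closed_atLeastAtMost closed_sequentially by blast
  have nn: "(\<integral>\<^sup>+z. ennreal (norm (V t z)) \<partial>M) = ennreal (m t)" if "t \<in> {0..T}" for t
    unfolding m_def using int[OF that] by (intro nn_integral_eq_integral) auto
  have [measurable]: "V (x n) \<in> borel_measurable M" for n
    using int[OF x(1)] by auto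
  have a: "0 \<le> a" using moment_nonneg x(2)[of 0] by (rule order.trans)
  have "ennreal (m l) \<le> (\<integral>\<^sup>+z. liminf (\<lambda>n. ennreal (norm (V (x n) z))) \<partial>M)"
    unfolding nn[OF l, symmetric]
  proof (rule nn_integral_mono_AE)
    show "AE z in M. ennreal (norm (V l z)) \<le> liminf (\<lambda>n. ennreal (norm (V (x n) z)))"
      using G
    proof eventually_elim
      case (elim z)
      have "continuous_on {0..T} (\<lambda>s. V s z)"
        using deriv[OF elim] by (rule continuous_on_of_vector_derivative)
      then have "(\<lambda>n. V (x n) z) \<longlonglongrightarrow> V l z"
        using continuous_on_tendsto_compose[OF _ lim l] x(1) by simp
      then have "(\<lambda>n. ennreal (norm (V (x n) z))) \<longlonglongrightarrow> ennreal (norm (V l z))"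
        by (intro tendsto_ennrealI tendsto_norm)
      then have "liminf (\<lambda>n. ennreal (norm (V (x n) z))) = ennreal (norm (V l z))"
        by (rule lim_imp_Liminf[OF trivial_limit_sequentially])
      then show ?case by simp
    qed
  qed
  also have "\<dots> \<le> liminf (\<lambda>n. \<integral>\<^sup>+z. ennreal (norm (V (x n) z)) \<partial>M)"
    by (intro nn_integral_liminf) measurable
  also have "\<dots> = liminf (\<lambda>n. ennreal (m (x n)))"
    using nn[OF x(1)] by simp
  also have "\<dots> \<le> ennreal a"
    by (intro Liminf_le always_eventually allI ennreal_leI x(2) trivial_limit_sequentially)
  finally show "l \<in> {t \<in> {0..T}. m t \<le> a}"
    using l a by simp
qed

text \<open>Finiteness of the first moment at each time gives, by Baire's theorem on the closed set where
  it fails to be locally bounded, a relatively open piece of that set with a uniform bound; the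
  two-sided growth estimate then propagates this bound into the gaps.\<close>

lemma moment_bounded: "\<exists>B. \<forall>t\<in>{0..T}. m t \<le> B"
proof -
  define loc where "loc t \<longleftrightarrow> (\<exists>e>0. \<exists>S. \<forall>s\<in>{0..T}. \<bar>s - t\<bar> < e \<longrightarrow> m s \<le> S)" for t
  define E where "E = {t \<in> {0..T}. \<not> loc t}"
  have "open {t. loc t}"
    unfolding open_dist
  proof
    fix t assume "t \<in> {t. loc t}"
    then obtain e S where e: "e > 0" "\<forall>s\<in>{0..T}. \<bar>s - t\<bar> < e \<longrightarrow> m s \<le> S"
      unfolding loc_def by blast
    have "loc t'" if "dist t' t < e / 2" for t'
    proof -
      have "\<forall>s\<in>{0..T}. \<bar>s - t'\<bar> < e / 2 \<longrightarrow> m s \<le> S"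
      proof (intro ballI impI)
        fix s assume s: "s \<in> {0..T}" "\<bar>s - t'\<bar> < e / 2"
        have "\<bar>s - t\<bar> < e" using s(2) that unfolding dist_real_def by linarith
        with e(2) s(1) show "m s \<le> S" by blast
      qed
      then show ?thesis unfolding loc_def using half_gt_zero[OF e(1)] by blast
    qed
    then show "\<exists>e>0. \<forall>y. dist y t < e \<longrightarrow> y \<in> {t. loc t}"
      using e(1) by (intro exI[of _ "e / 2"]) auto
  qed
  moreover have "E = {0..T} - {t. loc t}" by (auto simp: E_def)
  ultimately have E: "closed E" by (simp add: closed_Diff)
  have bounded_off_E: "\<exists>S. \<forall>s\<in>C. m s \<le> S" if "compact C" "C \<subseteq> {0..T} - E" for C
  proof (rule locally_bounded_imp_bounded[OF that(1)])
    fix t assume "t \<in> C"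
    then have "loc t" using that(2) by (auto simp: E_def)
    then show "\<exists>e>0. \<exists>S. \<forall>s\<in>C. \<bar>s - t\<bar> < e \<longrightarrow> m s \<le> S"
      unfolding loc_def using that(2) by blast
  qed
  have "E = {}"
  proof (rule ccontr)
    assume ne: "E \<noteq> {}"
    have cover: "E \<subseteq> (\<Union>n. {t \<in> {0..T}. m t \<le> real n})"
      using real_arch_simple by (auto simp: E_def)
    obtain p n e where p: "p \<in> E" "0 < e" "ball p e \<inter> E \<subseteq> {t \<in> {0..T}. m t \<le> real n}"
      by (rule Baire_closed_cover[OF E ne moment_sublevel_closed cover])
    \<comment> \<open>Two times within \<open>d\<close> of \<open>p\<close> are at most
      \<open>2 * d\<close> apart, as \<open>moment_short_interval\<close> requires;
      \<open>c + 1\<close> covers \<open>c = 0\<close>.\<close>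
    define d where "d = min e (1 / (8 * (c + 1)))"
    have d: "0 < d" "d \<le> e" "c * (2 * d) \<le> 1 / 4"
    proof -
      show "0 < d" "d \<le> e" using p(2) c by (auto simp: d_def)
      have "c * (2 * d) \<le> c * (2 * (1 / (8 * (c + 1))))"
        using c by (intro mult_left_mono) (auto simp: d_def)
      also have "\<dots> \<le> 1 / 4" using c by (simp add: field_simps)
      finally show "c * (2 * d) \<le> 1 / 4" .
    qed
    have pT: "p \<in> {0..T}" using p(1) by (simp add: E_def)
    have "m s \<le> 2 * real n" if s: "s \<in> {0..T}" "\<bar>s - p\<bar> < d" for s
    proof -
      have seg: "closed_segment p s \<subseteq> {0..T}"
        using pT s(1) by (intro closed_segment_subset) auto
      have near: "\<bar>t - p\<bar> \<le> \<bar>s - p\<bar>" if "t \<in> closed_segment p s" for t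
        using that segment_bound(1)[of t p s] by (simp add: norm_minus_commute)
      \<comment> \<open>On the way from \<open>p\<close> to \<open>s\<close>, \<open>a\<close> is
        the point of \<open>E\<close> nearest to \<open>s\<close>: beyond it the segment avoids
        \<open>E\<close>, and at \<open>a\<close> itself the bound from Baire's theorem is
        available.\<close>
      have "closed (E \<inter> closed_segment p s)" "E \<inter> closed_segment p s \<noteq> {}"
        using E p(1) by auto
      then obtain a where a: "a \<in> E" "a \<in> closed_segment p s"
        and amin: "\<And>t. t \<in> E \<Longrightarrow> t \<in> closed_segment p s \<Longrightarrow> dist s a \<le> dist s t"
        by (metis distance_attains_inf[of "E \<inter> closed_segment p s" s] IntE IntI)
      have sub: "closed_segment t s \<subseteq> closed_segment p s" if "t \<in> closed_segment p s" for t
        using that by (simp add: subset_closed_segment)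
      have off: "t \<notin> E" if t: "t \<in> closed_segment a s" "t \<noteq> a" for t
      proof
        assume "t \<in> E"
        moreover have "t \<in> closed_segment p s" using t sub[OF a(2)] by blast
        ultimately have "\<bar>s - a\<bar> \<le> \<bar>s - t\<bar>" using amin by (simp add: dist_real_def)
        then show False using t by (auto simp: closed_segment_eq_real_ivl split: if_splits)
      qed
      have short: "c * \<bar>\<tau> - \<sigma>\<bar> \<le> 1 / 4" if "\<sigma> \<in> closed_segment p s" "\<tau> \<in> closed_segment p s" for \<sigma> \<tau>
      proof -
        have "\<bar>\<tau> - \<sigma>\<bar> \<le> 2 * d" using near[OF that(1)] near[OF that(2)] s(2) by linarith
        then have "c * \<bar>\<tau> - \<sigma>\<bar> \<le> c * (2 * d)" using c by (rule mult_left_mono)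
        with d(3) show ?thesis by simp
      qed
      \<comment> \<open>The moment might a priori blow up on approaching \<open>a\<close>. On each
        segment from \<open>t \<noteq> a\<close> to \<open>s\<close> it is bounded, so the growth
        estimate started at \<open>s\<close> gives \<open>2 * m s\<close>, a bound independent of
        \<open>t\<close>. This is the finiteness that permits the estimate started at
        \<open>a\<close>.\<close>
      have "m t \<le> max (2 * m s) (m a)" if t: "t \<in> closed_segment a s" for t
      proof (cases "t = a")
        case False
        have ts: "closed_segment t s \<subseteq> closed_segment p s"
          using sub sub[OF a(2)] t by blast
        have notin: "a \<notin> closed_segment t s"
          using t False by (auto simp: closed_segment_eq_real_ivl split: if_splits)
        have "\<rho> \<notin> E" if "\<rho> \<in> closed_segment t s" for \<rho>
        proof (rule off)
          show "\<rho> \<in> closed_segment a s"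
            using that t subset_closed_segment[of t s a s] by auto
          show "\<rho> \<noteq> a" using that notin by auto
        qed
        then have "closed_segment t s \<subseteq> {0..T} - E"
          using ts seg by blast
        from bounded_off_E[OF compact_segment this]
        obtain S where S: "\<forall>\<rho>\<in>closed_segment t s. m \<rho> \<le> S" ..
        have "m t \<le> 2 * m s"
        proof (rule moment_short_interval)
          show "closed_segment t s \<subseteq> {0..T}" using ts seg by blast
          show "c * \<bar>\<tau> - \<sigma>\<bar> \<le> 1 / 4" if "\<sigma> \<in> closed_segment t s" "\<tau> \<in> closed_segment t s" for \<sigma> \<tau>
            using that ts by (intro short) auto
          show "m \<rho> \<le> S" if "\<rho> \<in> closed_segment t s" for \<rho>
            using S that by blast
        qed auto
        then show ?thesis by simp
      qed simp
      note bdd = this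
      have "m s \<le> 2 * m a"
      proof (rule moment_short_interval)
        show "closed_segment a s \<subseteq> {0..T}" using sub[OF a(2)] seg by blast
        show "c * \<bar>\<tau> - \<sigma>\<bar> \<le> 1 / 4" if "\<sigma> \<in> closed_segment a s" "\<tau> \<in> closed_segment a s" for \<sigma> \<tau>
          using that sub[OF a(2)] by (intro short) auto
        show "m \<rho> \<le> max (2 * m s) (m a)" if "\<rho> \<in> closed_segment a s" for \<rho>
          using that by (rule bdd)
      qed auto
      moreover have "dist p a < e"
        using near[OF a(2)] s(2) d(2) by (simp add: dist_real_def abs_minus_commute)
      then have "m a \<le> real n"
        using p(3) a(1) by auto
      ultimately show ?thesis by simp
    qed
    then have "loc p" unfolding loc_def using d(1) by blast
    then show False using p(1) by (simp add: E_def)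
  qed
  then show ?thesis using bounded_off_E[of "{0..T}"] by simp
qed

end

end

text \<open>The squared norm is differentiable also where \<open>u\<close> vanishes. From
  \<open>n * (b + n) \<le> 2 * (n\<^sup>2 + b\<^sup>2)\<close> with \<open>n = norm (u s)\<close>,
  the derivative of \<open>u s \<bullet> u s\<close> is at most
  \<open>4 * c * (n\<^sup>2 + b\<^sup>2)\<close>, so \<open>w\<close> decreases.\<close>

lemma vector_gronwall:
  fixes u :: "real \<Rightarrow> 'b::real_inner"
  assumes c: "0 \<le> c" and t: "t \<in> {0..T}"
    and deriv: "\<And>t. t \<in> {0..T} \<Longrightarrow> \<exists>D. (u has_vector_derivative D) (at t within {0..T}) \<and> norm D \<le> c * (b + norm (u t))"
  shows "(norm (u t))\<^sup>2 \<le> ((norm (u 0))\<^sup>2 + b\<^sup>2) * exp (4 * c * T)"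
proof -
  define w where "w s = (u s \<bullet> u s + b\<^sup>2) * exp (- 4 * c * s)" for s
  have cont: "continuous_on {0..T} u"
    using deriv by (rule continuous_on_of_vector_derivative)
  have "w t \<le> w 0"
  proof (cases "t = 0")
    case False
    have "0 \<le> t" using t by simp
    then show ?thesis
    proof (rule DERIV_nonpos_imp_decreasing_open)
      have "continuous_on {0..t} u" using cont t by (auto intro: continuous_on_subset)
      then show "continuous_on {0..t} w" unfolding w_def by (intro continuous_intros)
      fix s assume s: "0 < s" "s < t"
      then have sT: "s \<in> {0..T}" "s \<in> interior {0..T}" using t by auto
      obtain D where D: "(u has_vector_derivative D) (at s within {0..T})" "norm D \<le> c * (b + norm (u s))"
        using deriv[OF sT(1)] by auto
      have "(u has_vector_derivative D) (at s)"
        using D(1) by (simp only: at_within_interior[OF sT(2)])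
      then have du: "(u has_derivative (\<lambda>x. x *\<^sub>R D)) (at s)"
        by (simp add: has_vector_derivative_def)
      have "((\<lambda>s. u s \<bullet> u s) has_derivative (\<lambda>h. u s \<bullet> (h *\<^sub>R D) + (h *\<^sub>R D) \<bullet> u s)) (at s)"
        by (rule has_derivative_inner[OF du du])
      then have "((\<lambda>s. u s \<bullet> u s) has_real_derivative 2 * (u s \<bullet> D)) (at s)"
        unfolding has_field_derivative_def
        by (rule has_derivative_eq_rhs) (auto simp: inner_commute algebra_simps)
      note inner_deriv = this
      have "(w has_real_derivative
          2 * (u s \<bullet> D) * exp (- 4 * c * s) + (u s \<bullet> u s + b\<^sup>2) * (exp (- 4 * c * s) * (- 4 * c))) (at s)"
        unfolding w_def by (rule derivative_eq_intros inner_deriv refl | simp)+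
      moreover have "2 * (u s \<bullet> D) * exp (- 4 * c * s) + (u s \<bullet> u s + b\<^sup>2) * (exp (- 4 * c * s) * (- 4 * c)) \<le> 0"
      proof -
        let ?n = "norm (u s)"
        have "u s \<bullet> D \<le> ?n * norm D" by (rule norm_cauchy_schwarz)
        also have "\<dots> \<le> ?n * (c * (b + ?n))" using D(2) by (intro mult_left_mono) auto
        also have "\<dots> \<le> c * (2 * (?n\<^sup>2 + b\<^sup>2))"
        proof -
          have "?n * (b + ?n) \<le> 2 * (?n\<^sup>2 + b\<^sup>2)"
          proof -
            have "2 * (?n * b) \<le> ?n * ?n + b * b"
              using zero_le_power2[of "?n - b"] by (simp add: power2_eq_square algebra_simps)
            moreover have "0 \<le> ?n * ?n" "0 \<le> b * b" by simp_all
            ultimately show ?thesis unfolding power2_eq_square distrib_left by linarith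
          qed
          then show ?thesis using c mult_left_mono[of "?n * (b + ?n)" "2 * (?n\<^sup>2 + b\<^sup>2)" c] by (simp add: mult_ac)
        qed
        finally have "2 * (u s \<bullet> D) - 4 * c * (u s \<bullet> u s + b\<^sup>2) \<le> 0"
          by (simp add: dot_square_norm algebra_simps)
        then have "(2 * (u s \<bullet> D) - 4 * c * (u s \<bullet> u s + b\<^sup>2)) * exp (- 4 * c * s) \<le> 0"
          by (rule mult_nonpos_nonneg) simp
        then show ?thesis by (simp add: algebra_simps)
      qed
      ultimately show "\<exists>y. (w has_real_derivative y) (at s) \<and> y \<le> 0" by blast
    qed
  qed simp
  then have "u t \<bullet> u t + b\<^sup>2 \<le> (u 0 \<bullet> u 0 + b\<^sup>2) * exp (4 * c * t)"
    by (simp add: w_def exp_minus field_simps)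
  also have "\<dots> \<le> (u 0 \<bullet> u 0 + b\<^sup>2) * exp (4 * c * T)"
    using c t by (intro mult_left_mono) (auto intro: mult_left_mono)
  finally show ?thesis
    using zero_le_power2[of b] unfolding dot_square_norm by linarith
qed

subsection \<open>Uniqueness\<close>

lemma expectation_push:
  fixes f :: "'b::euclidean_space \<Rightarrow> real"
  assumes f: "bounded_prob_density f" and [measurable]: "\<Phi> \<in> borel_measurable M"
    and push: "density lborel (\<lambda>z. ennreal (f z)) = distr M borel \<Phi>" and \<alpha>: "bounded_continuous \<alpha>"
  shows "(\<integral>z. \<alpha> z * f z \<partial>lborel) = (\<integral>z. \<alpha> (\<Phi> z) \<partial>M)"
proof -
  note [measurable] = f[THEN bounded_prob_density_measurable] \<alpha>[THEN bounded_continuous_measurable]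
  have "(\<integral>z. \<alpha> z * f z \<partial>lborel) = integral\<^sup>L (density lborel (\<lambda>z. ennreal (f z))) \<alpha>"
    using f by (subst integral_density) (auto simp: bounded_prob_density_def mult.commute)
  also have "\<dots> = (\<integral>z. \<alpha> (\<Phi> z) \<partial>M)"
    unfolding push by (subst integral_distr) auto
  finally show ?thesis .
qed

text \<open>The map \<open>\<Psi>\<close> is not assumed measurable. If some \<open>\<alpha> \<circ> \<Psi>\<close> were not integrable against
  \<open>f\<^sub>0\<close>, then neither would be \<open>\<alpha> \<circ> \<Psi> + 1\<close>, and both Bochner integrals would be \<open>0\<close>, although
  they must differ by \<open>1\<close>.\<close>

lemma weak_push_forward:
  fixes f\<^sub>0 g :: "'b::euclidean_space \<Rightarrow> real"
  assumes f0: "bounded_prob_density f\<^sub>0" and g: "bounded_prob_density g"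
    and G[measurable]: "G \<in> sets borel" and AE_G: "AE z in density lborel (\<lambda>z. ennreal (f\<^sub>0 z)). z \<in> G"
    and pos: "\<And>z. z \<in> G \<Longrightarrow> 0 < f\<^sub>0 z"
    and eq: "\<And>\<alpha>. bounded_continuous \<alpha> \<Longrightarrow> (\<integral>z. \<alpha> z * g z \<partial>lborel) = (\<integral>z. \<alpha> (\<Psi> z) * f\<^sub>0 z \<partial>lborel)"
  shows "(\<lambda>z. indicator G z *\<^sub>R \<Psi> z) \<in> borel_measurable borel"
    and "density lborel (\<lambda>z. ennreal (g z))
      = distr (density lborel (\<lambda>z. ennreal (f\<^sub>0 z))) borel (\<lambda>z. indicator G z *\<^sub>R \<Psi> z)"
proof -
  let ?M = "density lborel (\<lambda>z. ennreal (f\<^sub>0 z))" and ?\<Psi> = "\<lambda>z. indicator G z *\<^sub>R \<Psi> z"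
  note [measurable] = f0[THEN bounded_prob_density_measurable] g[THEN bounded_prob_density_measurable]
  have int: "integrable lborel f\<^sub>0" "integrable lborel g" "integral\<^sup>L lborel g = 1"
    and nn: "AE z in lborel. 0 \<le> f\<^sub>0 z" "AE z in lborel. 0 \<le> g z"
    using f0 g by (auto simp: bounded_prob_density_def has_bochner_integral_iff)
  have integrable_g: "integrable lborel (\<lambda>z. \<alpha> z * g z)" if \<alpha>: "bounded_continuous \<alpha>" for \<alpha>
  proof -
    note [measurable] = \<alpha>[THEN bounded_continuous_measurable]
    obtain B where B: "0 \<le> B" "\<And>z. \<bar>\<alpha> z\<bar> \<le> B" using bounded_continuous_bound[OF \<alpha>] by blast
    have "integrable lborel (\<lambda>z. B * g z)" using int(2) by simp
    then show ?thesis
      by (rule Bochner_Integration.integrable_bound) (auto simp: abs_mult B intro!: AE_I2 mult_right_mono)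
  qed
  have integrable: "integrable lborel (\<lambda>z. \<alpha> (\<Psi> z) * f\<^sub>0 z)" if \<alpha>: "bounded_continuous \<alpha>" for \<alpha>
  proof (rule ccontr)
    assume not: "\<not> integrable lborel (\<lambda>z. \<alpha> (\<Psi> z) * f\<^sub>0 z)"
    have \<alpha>1: "bounded_continuous (\<lambda>z. \<alpha> z + 1)"
    proof -
      obtain B where B: "\<And>z. \<bar>\<alpha> z\<bar> \<le> B" using bounded_continuous_bound[OF \<alpha>] by blast
      have "\<bar>\<alpha> z + 1\<bar> \<le> B + 1" for z
        using B[of z] abs_triangle_ineq[of "\<alpha> z" 1] by simp
      then show ?thesis
        using \<alpha> unfolding bounded_continuous_def bounded_iff by (auto intro!: continuous_intros)
    qed
    have not1: "\<not> integrable lborel (\<lambda>z. (\<alpha> (\<Psi> z) + 1) * f\<^sub>0 z)"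
    proof
      assume "integrable lborel (\<lambda>z. (\<alpha> (\<Psi> z) + 1) * f\<^sub>0 z)"
      then have "integrable lborel (\<lambda>z. (\<alpha> (\<Psi> z) + 1) * f\<^sub>0 z - f\<^sub>0 z)"
        using int(1) by (rule Bochner_Integration.integrable_diff)
      with not show False by (simp add: distrib_right)
    qed
    have "(\<integral>z. \<alpha> z * g z \<partial>lborel) = 0"
      unfolding eq[OF \<alpha>] using not by (rule not_integrable_integral_eq)
    moreover have "(\<integral>z. (\<alpha> z + 1) * g z \<partial>lborel) = 0"
      unfolding eq[OF \<alpha>1] using not1 by (rule not_integrable_integral_eq)
    ultimately show False
      using integrable_g[OF \<alpha>] int(2,3) by (simp add: distrib_right)
  qed
  show m[measurable]: "?\<Psi> \<in> borel_measurable borel"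
  proof (subst borel_measurable_euclidean_space, intro ballI)
    fix b :: 'b assume b: "b \<in> Basis"
    \<comment> \<open>The map \<open>s / (1 + \<bar>s\<bar>)\<close> squeezes a coordinate into the
      open unit interval around 0 and is inverted by \<open>q / (1 - \<bar>q\<bar>)\<close>, so a
      bounded test function recovers the unbounded coordinate.\<close>
    define \<alpha> where "\<alpha> y = (y \<bullet> b) / (1 + \<bar>y \<bullet> b\<bar>)" for y
    have "bounded_continuous \<alpha>"
    proof -
      have "\<bar>\<alpha> y\<bar> \<le> 1" for y by (simp add: \<alpha>_def abs_divide)
      moreover have "continuous_on UNIV \<alpha>"
        unfolding \<alpha>_def by (intro continuous_intros) (auto simp: add_nonneg_eq_0_iff)
      ultimately show ?thesis unfolding bounded_continuous_def bounded_iff by auto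
    qed
    then have [measurable]: "(\<lambda>z. \<alpha> (\<Psi> z) * f\<^sub>0 z) \<in> borel_measurable borel"
      using integrable borel_measurable_integrable by fastforce
    \<comment> \<open>Only the product with \<open>f\<^sub>0\<close> is known to be measurable; on
      \<open>G\<close> it can be divided by \<open>f\<^sub>0 > 0\<close>.\<close>
    define q where "q z = indicator G z * ((\<alpha> (\<Psi> z) * f\<^sub>0 z) / f\<^sub>0 z)" for z
    have [measurable]: "q \<in> borel_measurable borel" unfolding q_def[abs_def] by measurable
    have "?\<Psi> z \<bullet> b = q z / (1 - \<bar>q z\<bar>)" for z
    proof (cases "z \<in> G")
      case True
      then have q: "q z = (\<Psi> z \<bullet> b) / (1 + \<bar>\<Psi> z \<bullet> b\<bar>)"
        using pos[OF True] by (simp add: q_def \<alpha>_def)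
      have p: "0 < 1 + \<bar>\<Psi> z \<bullet> b\<bar>" by simp
      then have "1 - \<bar>q z\<bar> = 1 / (1 + \<bar>\<Psi> z \<bullet> b\<bar>)"
        unfolding q by (simp add: abs_divide field_simps)
      with q p True show ?thesis by simp
    next
      case False
      then show ?thesis by (simp add: q_def)
    qed
    then show "(\<lambda>z. ?\<Psi> z \<bullet> b) \<in> borel_measurable borel" by simp
  qed
  have mM: "?\<Psi> \<in> borel_measurable ?M" by measurable
  show "density lborel (\<lambda>z. ennreal (g z)) = distr ?M borel ?\<Psi>"
  proof (rule measure_eqI_bounded_continuous)
    show "finite_measure (density lborel (\<lambda>z. ennreal (g z)))"
      using prob_space_bounded_prob_density[OF g] by (rule prob_space.finite_measure)
    show "finite_measure (distr ?M borel ?\<Psi>)"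
      using prob_space_bounded_prob_density[OF f0] mM
      by (intro prob_space.finite_measure prob_space.prob_space_distr)
    fix \<alpha> :: "'b \<Rightarrow> real" assume \<alpha>: "bounded_continuous \<alpha>"
    note [measurable] = \<alpha>[THEN bounded_continuous_measurable]
    have "integral\<^sup>L (density lborel (\<lambda>z. ennreal (g z))) \<alpha> = (\<integral>z. \<alpha> z * g z \<partial>lborel)"
      using nn by (subst integral_density) (auto simp: mult.commute)
    also have "\<dots> = (\<integral>z. \<alpha> (\<Psi> z) * f\<^sub>0 z \<partial>lborel)" by (rule eq[OF \<alpha>])
    also have "\<dots> = (\<integral>z. \<alpha> (?\<Psi> z) * f\<^sub>0 z \<partial>lborel)"
    proof (rule integral_cong_AE)
      show "(\<lambda>z. \<alpha> (\<Psi> z) * f\<^sub>0 z) \<in> borel_measurable lborel" using integrable[OF \<alpha>] by auto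
      show "(\<lambda>z. \<alpha> (?\<Psi> z) * f\<^sub>0 z) \<in> borel_measurable lborel" by measurable
      have "AE z in lborel. 0 < ennreal (f\<^sub>0 z) \<longrightarrow> z \<in> G"
        using AE_G by (subst (asm) AE_density) auto
      with nn(1) show "AE z in lborel. \<alpha> (\<Psi> z) * f\<^sub>0 z = \<alpha> (?\<Psi> z) * f\<^sub>0 z"
        by eventually_elim (auto simp: indicator_def)
    qed
    also have "\<dots> = (\<integral>z. \<alpha> (?\<Psi> z) \<partial>?M)"
      using nn by (subst integral_density) (auto simp: mult.commute)
    also have "\<dots> = integral\<^sup>L (distr ?M borel ?\<Psi>) \<alpha>"
      using mM by (subst integral_distr) auto
    finally show "integral\<^sup>L (density lborel (\<lambda>z. ennreal (g z))) \<alpha> = integral\<^sup>L (distr ?M borel ?\<Psi>) \<alpha>" .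
  qed auto
qed

text \<open>A Gronwall argument without integrals: one integration in time turns the bound
  \<open>b * exp (2 * c * t)\<close> for the whole family into half of it.\<close>

lemma family_gronwall:
  fixes u :: "'l \<Rightarrow> real \<Rightarrow> 'b::real_normed_vector"
  assumes c: "0 < c" and bdd: "\<And>z t. z \<in> G \<Longrightarrow> t \<in> {0..T} \<Longrightarrow> norm (u z t) \<le> b"
    and zero: "\<And>z. z \<in> G \<Longrightarrow> u z 0 = 0"
    and deriv: "\<And>z t. z \<in> G \<Longrightarrow> t \<in> {0..T} \<Longrightarrow> (u z has_vector_derivative u' z t) (at t within {0..T})"
    and lip: "\<And>t D z. t \<in> {0..T} \<Longrightarrow> (\<And>\<zeta>. \<zeta> \<in> G \<Longrightarrow> norm (u \<zeta> t) \<le> D) \<Longrightarrow> z \<in> G \<Longrightarrow> norm (u' z t) \<le> c * D"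
    and z: "z \<in> G" and t: "t \<in> {0..T}"
  shows "u z t = 0"
proof -
  have b0: "0 \<le> b" using norm_ge_zero bdd[OF z t] by (rule order.trans)
  have decay: "norm (u z t) \<le> b / 2 ^ k * exp (2 * c * t)" if "z \<in> G" "t \<in> {0..T}" for z t k
    using that
  proof (induction k arbitrary: z t)
    case 0
    have "b * 1 \<le> b * exp (2 * c * t)"
      using b0 c 0 by (intro mult_left_mono) auto
    with bdd[OF 0] show ?case by simp
  next
    case (Suc k)
    show ?case
    proof (cases "t = 0")
      case True
      then show ?thesis using zero[OF Suc.prems(1)] b0 by simp
    next
      case False
      then have t0: "0 < t" using Suc.prems by simp
      let ?\<phi> = "\<lambda>s. b / 2 ^ Suc k * exp (2 * c * s)" and ?\<phi>' = "\<lambda>s. c * (b / 2 ^ k * exp (2 * c * s))"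
      have cont: "continuous_on {0..T} (u z)"
        using deriv[OF Suc.prems(1)] by (intro continuous_on_of_vector_derivative[where P="\<lambda>_ _. True"]) blast
      have "norm (u z t - u z 0) \<le> ?\<phi> t - ?\<phi> 0"
      proof (rule differentiable_bound_general[OF t0, where f'="u' z" and \<phi>'="?\<phi>'"])
        show "continuous_on {0..t} (u z)" using cont Suc.prems(2) by (auto intro: continuous_on_subset)
        show "continuous_on {0..t} ?\<phi>" by (intro continuous_intros)
        fix s assume s: "0 < s" "s < t"
        then have sT: "s \<in> {0..T}" "s \<in> interior {0..T}" using Suc.prems by auto
        show "(u z has_vector_derivative u' z s) (at s)"
          using deriv[OF Suc.prems(1) sT(1)] by (simp only: at_within_interior[OF sT(2)])
        have "(?\<phi> has_real_derivative ?\<phi>' s) (at s)"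
          by (rule derivative_eq_intros refl | simp)+
        then show "(?\<phi> has_vector_derivative ?\<phi>' s) (at s)"
          by (rule has_real_derivative_iff_has_vector_derivative[THEN iffD1])
        show "norm (u' z s) \<le> ?\<phi>' s"
          using Suc.IH[OF _ sT(1)] by (intro lip[OF sT(1) _ Suc.prems(1)])
      qed
      moreover have "0 \<le> ?\<phi> 0" using b0 by simp
      ultimately show ?thesis using zero[OF Suc.prems(1)] by simp
    qed
  qed
  have "norm (u z t) \<le> 0"
  proof (rule LIMSEQ_le_const)
    have "(\<lambda>k. b * exp (2 * c * t) * (1 / 2) ^ k) \<longlonglongrightarrow> b * exp (2 * c * t) * 0"
      by (intro tendsto_mult tendsto_const LIMSEQ_power_zero) simp
    then show "(\<lambda>k. b / 2 ^ k * exp (2 * c * t)) \<longlonglongrightarrow> 0"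
      by (simp add: power_divide mult.commute)
    show "\<exists>N. \<forall>k\<ge>N. norm (u z t) \<le> b / 2 ^ k * exp (2 * c * t)"
      using decay[OF z t] by blast
  qed
  then show ?thesis by simp
qed

section \<open>Comparison of a competitor with the limit flow\<close>

context alignment_data
begin

text \<open>The bounds come in a forced order: the moment is bounded in time by
  \<open>moment_bounded\<close>, then each velocity by \<open>vector_gronwall\<close>, then the
  positions. Only now is the distance to \<open>flow\<close> known to be finite, as
  \<open>family_gronwall\<close> demands.\<close>

lemma flow_unique:
  assumes G: "AE z in M. z \<in> G" "\<And>z. z \<in> G \<Longrightarrow> norm (fst z) \<le> R\<^sub>x \<and> norm (snd z) \<le> R\<^sub>v"
    and meas: "\<And>t. t \<in> {0..T} \<Longrightarrow> \<Psi> t \<in> borel_measurable M"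
    and int: "\<And>t. t \<in> {0..T} \<Longrightarrow> integrable M (\<lambda>z. snd (\<Psi> t z))"
    and init: "\<And>z. z \<in> G \<Longrightarrow> \<Psi> 0 z = z"
    and ode: "\<And>z t. z \<in> G \<Longrightarrow> t \<in> {0..T} \<Longrightarrow>
      ((\<lambda>s. \<Psi> s z) has_vector_derivative field (\<Psi> t) (\<Psi> t z)) (at t within {0..T})"
    and z: "z \<in> G" and t: "t \<in> {0..T}"
  shows "\<Psi> t z = flow t z"
proof -
  define m where "m t = (\<integral>z. norm (snd (\<Psi> t z)) \<partial>M)" for t
  have snd_ode: "((\<lambda>s. snd (\<Psi> s z)) has_vector_derivative force (\<Psi> t) (fst (\<Psi> t z)) (snd (\<Psi> t z))) (at t within {0..T})"
    and fst_ode: "((\<lambda>s. fst (\<Psi> s z)) has_vector_derivative snd (\<Psi> t z)) (at t within {0..T})"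
    if "z \<in> G" "t \<in> {0..T}" for z t
    using bounded_linear.has_vector_derivative[OF bounded_linear_snd ode[OF that]]
      bounded_linear.has_vector_derivative[OF bounded_linear_fst ode[OF that]]
    by (simp_all add: field_def)
  have force_le: "norm (force (\<Psi> t) x v) \<le> K 0 * (m t + norm v)" if "t \<in> {0..T}" for t x v
    unfolding m_def by (rule norm_force_le_moment[OF meas[OF that] int[OF that]])
  have "\<exists>B. \<forall>t\<in>{0..T}. m t \<le> B"
    unfolding m_def
  proof (rule moment_bounded[OF G(1), where c="K 0"])
    fix z t assume "z \<in> G" "t \<in> {0..T}"
    then show "\<exists>D. ((\<lambda>s. snd (\<Psi> s z)) has_vector_derivative D) (at t within {0..T}) \<and>
        norm D \<le> K 0 * ((\<integral>z. norm (snd (\<Psi> t z)) \<partial>M) + norm (snd (\<Psi> t z)))"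
      using snd_ode force_le unfolding m_def by blast
  qed (use K_0_pos int in auto)
  then obtain B where B: "\<And>t. t \<in> {0..T} \<Longrightarrow> m t \<le> B" by blast
  \<comment> \<open>The conclusion of \<open>vector_gronwall\<close> with \<open>b = B\<close> and
    initial speed at most \<open>R\<^sub>v\<close>.\<close>
  define R where "R = sqrt ((R\<^sub>v\<^sup>2 + B\<^sup>2) * exp (4 * K 0 * T))"
  have R0: "0 \<le> R" by (simp add: R_def)
  have V: "norm (snd (\<Psi> t z)) \<le> R" if z: "z \<in> G" and t: "t \<in> {0..T}" for z t
  proof -
    have "(norm (snd (\<Psi> t z)))\<^sup>2 \<le> ((norm (snd (\<Psi> 0 z)))\<^sup>2 + B\<^sup>2) * exp (4 * K 0 * T)"
    proof (rule vector_gronwall[OF _ t])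
      fix s assume s: "s \<in> {0..T}"
      have "K 0 * (m s + norm (snd (\<Psi> s z))) \<le> K 0 * (B + norm (snd (\<Psi> s z)))"
        using B[OF s] K_0_pos by (intro mult_left_mono) auto
      then show "\<exists>D. ((\<lambda>t. snd (\<Psi> t z)) has_vector_derivative D) (at s within {0..T}) \<and>
          norm D \<le> K 0 * (B + norm (snd (\<Psi> s z)))"
        using snd_ode[OF z s] order.trans[OF force_le[OF s]] by blast
    qed (use K_0_pos in simp)
    also have "\<dots> \<le> (R\<^sub>v\<^sup>2 + B\<^sup>2) * exp (4 * K 0 * T)"
      using G(2)[OF z] init[OF z] by (intro mult_right_mono add_right_mono power_mono) auto
    finally show ?thesis unfolding R_def by (rule real_le_rsqrt)
  qed
  define S where "S = R\<^sub>x + T * R\<^sub>v + R\<^sub>v + R"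
  have S: "0 \<le> S" "R\<^sub>x + T * R\<^sub>v \<le> S" "R\<^sub>v \<le> S" "R \<le> S"
    using R0 R_pos T_pos by (auto simp: S_def)
  have box: "norm (fst (flow t z)) \<le> S" "norm (snd (flow t z)) \<le> S" if z: "z \<in> G" and t: "t \<in> {0..T}" for z t
  proof -
    have "norm (fst (flow t z)) \<le> R\<^sub>x + t * R\<^sub>v" "norm (snd (flow t z)) \<le> R\<^sub>v"
      using G(2)[OF z] by (auto intro: admissible_box[OF flow_admissible[OF t] order.refl])
    moreover have "t * R\<^sub>v \<le> T * R\<^sub>v" using t R_pos by (intro mult_right_mono) auto
    ultimately show "norm (fst (flow t z)) \<le> S" "norm (snd (flow t z)) \<le> S" using S by auto
  qed
  obtain \<Lambda> where \<Lambda>0: "0 \<le> \<Lambda>" and \<Lambda>: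
    "\<And>(\<Phi> :: 'a \<times> 'a \<Rightarrow> 'a \<times> 'a) \<Psi> p q D.
      spatial_bound space_const \<Phi> \<Longrightarrow> \<Psi> \<in> borel_measurable M \<Longrightarrow>
      AE \<eta> in M. norm (fst (\<Phi> \<eta>)) \<le> S \<Longrightarrow> AE \<eta> in M. norm (snd (\<Phi> \<eta>)) \<le> S \<Longrightarrow>
      AE \<eta> in M. norm (snd (\<Psi> \<eta>)) \<le> S \<Longrightarrow> AE \<eta> in M. norm (\<Phi> \<eta> - \<Psi> \<eta>) \<le> D \<Longrightarrow>
      norm (fst p) \<le> S \<Longrightarrow> norm (snd p) \<le> S \<Longrightarrow> norm (p - q) \<le> D \<Longrightarrow>
      norm (field \<Phi> p - field \<Psi> q) \<le> \<Lambda> * D"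
    by (rule field_lipschitz[OF space_const_nonneg S(1)]) (rule that)
  have AE_G: "AE \<eta> in M. P \<eta>" if "\<And>\<eta>. \<eta> \<in> G \<Longrightarrow> P \<eta>" for P
    using G(1) by eventually_elim (rule that)
  have "flow t z - \<Psi> t z = 0"
  \<comment> \<open>\<open>\<Lambda> + 1\<close> is strictly positive even if
    \<open>\<Lambda>\<close> is 0. The bound adds \<open>2 * S\<close> for \<open>flow\<close> to
    \<open>R\<^sub>x + R * T + R\<close> for \<open>\<Psi>\<close>, the position and velocity bounds
    of the competitor.\<close>
  proof (rule family_gronwall[where G=G and T=T and c="\<Lambda> + 1" and b="2 * S + (R\<^sub>x + R * T + R)"
        and u="\<lambda>z t. flow t z - \<Psi> t z" and u'="\<lambda>z t. field (flow t) (flow t z) - field (\<Psi> t) (\<Psi> t z)"])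
    fix z t assume z: "z \<in> G" and t: "t \<in> {0..T}"
    show "((\<lambda>t. flow t z - \<Psi> t z) has_vector_derivative
        field (flow t) (flow t z) - field (\<Psi> t) (\<Psi> t z)) (at t within {0..T})"
      by (intro has_vector_derivative_diff flow_has_vector_derivative ode z t)
    have "norm (fst (\<Psi> t z) - fst (\<Psi> 0 z)) \<le> R * \<bar>t - 0\<bar>"
      using fst_ode[OF z] V[OF z] t
      by (intro norm_diff_le_of_vector_derivative[where f="\<lambda>s. fst (\<Psi> s z)" and I="{0..T}"]) auto
    also have "\<dots> \<le> R * T" using t R0 by (intro mult_left_mono) auto
    finally have "norm (fst (\<Psi> t z)) \<le> R\<^sub>x + R * T"
      using init[OF z] G(2)[OF z] norm_triangle_sub[of "fst (\<Psi> t z)" "fst z"] by simp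
    then have "norm (\<Psi> t z) \<le> R\<^sub>x + R * T + R"
      using norm_Pair_le[of "fst (\<Psi> t z)" "snd (\<Psi> t z)"] V[OF z t] by simp
    moreover have "norm (flow t z) \<le> 2 * S"
      using norm_Pair_le[of "fst (flow t z)" "snd (flow t z)"] box[OF z t] by simp
    ultimately show "norm (flow t z - \<Psi> t z) \<le> 2 * S + (R\<^sub>x + R * T + R)"
      using norm_triangle_ineq4[of "flow t z" "\<Psi> t z"] by linarith
  next
    fix z t D assume t: "t \<in> {0..T}" and D: "\<And>\<zeta>. \<zeta> \<in> G \<Longrightarrow> norm (flow t \<zeta> - \<Psi> t \<zeta>) \<le> D" and z: "z \<in> G"
    have "norm (field (flow t) (flow t z) - field (\<Psi> t) (\<Psi> t z)) \<le> \<Lambda> * D"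
      by (intro \<Lambda> AE_G box D z t meas admissible_spatial_bound[OF flow_admissible[OF t]] order.trans[OF V S(4)])
    also have "\<dots> \<le> (\<Lambda> + 1) * D"
      using order.trans[OF norm_ge_zero D[OF z]] by (intro mult_right_mono) auto
    finally show "norm (field (flow t) (flow t z) - field (\<Psi> t) (\<Psi> t z)) \<le> (\<Lambda> + 1) * D" .
  qed (use \<Lambda>0 z t flow_0 init in auto)
  then show ?thesis by simp
qed

end

section \<open>Time continuity and densities of the limit flow\<close>

context alignment_data
begin

lemma flow_time_continuous:
  assumes \<alpha>: "bounded_continuous \<alpha>"
  shows "continuous_on {0..T} (\<lambda>t. \<integral>z. \<alpha> (flow t z) \<partial>M)"
  unfolding continuous_on_sequentially
proof (intro allI ballI impI)
  fix x :: "nat \<Rightarrow> real" and t assume t: "t \<in> {0..T}" and "(\<forall>n. x n \<in> {0..T}) \<and> x \<longlonglongrightarrow> t"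
  then have x: "\<And>n. x n \<in> {0..T}" "x \<longlonglongrightarrow> t" by auto
  note [measurable] = \<alpha>[THEN bounded_continuous_measurable]
  have [measurable]: "flow s \<in> borel_measurable M" if "s \<in> {0..T}" for s
    by (rule admissible_measurable[OF flow_admissible[OF that]])
  obtain B where B: "\<And>z. \<bar>\<alpha> z\<bar> \<le> B" using bounded_continuous_bound[OF \<alpha>] by blast
  have "(\<lambda>n. \<integral>z. \<alpha> (flow (x n) z) \<partial>M) \<longlonglongrightarrow> (\<integral>z. \<alpha> (flow t z) \<partial>M)"
  proof (rule integral_dominated_convergence[where w="\<lambda>_. B"])
    show "AE z in M. (\<lambda>n. \<alpha> (flow (x n) z)) \<longlonglongrightarrow> \<alpha> (flow t z)"
    proof (rule AE_I2)
      fix z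
      have "continuous_on {0..T} (\<lambda>s. flow s z)"
        by (rule continuous_on_of_vector_derivative[where P="\<lambda>_ _. True"])
           (use flow_has_vector_derivative in blast)
      from continuous_on_tendsto_compose[OF this x(2) t]
      have "(\<lambda>n. flow (x n) z) \<longlonglongrightarrow> flow t z" using x(1) by simp
      moreover have "isCont \<alpha> (flow t z)"
        using \<alpha> by (simp add: bounded_continuous_def continuous_on_eq_continuous_at del: split_paired_All)
      ultimately show "(\<lambda>n. \<alpha> (flow (x n) z)) \<longlonglongrightarrow> \<alpha> (flow t z)"
        by (rule isCont_tendsto_compose[rotated])
    qed
  qed (use B x t in auto)
  then show "((\<lambda>t. \<integral>z. \<alpha> (flow t z) \<partial>M) \<circ> x) \<longlonglongrightarrow> (\<integral>z. \<alpha> (flow t z) \<partial>M)"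
    by (simp add: comp_def)
qed

lemma flow_density_exists:
  obtains f where "\<And>t. t \<in> {0..T} \<Longrightarrow> bounded_prob_density (f t)"
    "\<And>t. t \<in> {0..T} \<Longrightarrow> density lborel (\<lambda>z. ennreal (f t z)) = distr M borel (flow t)"
proof -
  have "\<exists>f. bounded_prob_density f \<and> density lborel (\<lambda>z. ennreal (f z)) = distr M borel (flow t)"
    if t: "t \<in> {0..T}" for t
  proof (rule bounded_prob_density_exists[OF _ _ phase_const_nonneg])
    have m: "flow t \<in> borel_measurable M" by (rule admissible_measurable[OF flow_admissible[OF t]])
    then show "prob_space (distr M borel (flow t))" by (rule prob_space_distr)
    show "emeasure (distr M borel (flow t)) B \<le> ennreal phase_const * emeasure lborel B"
      if "B \<in> sets borel" for B
      using flow_admissible[OF t] m that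
      by (simp add: emeasure_distr admissible_def phase_bound_def space_M vimage_def)
  qed simp
  then show thesis using that by metis
qed

end

theorem theorem4p1:
  fixes K :: "real \<Rightarrow> real" and \<gamma> T R\<^sub>x R\<^sub>v :: real
    and f\<^sub>0 :: "(real ^ 'd) \<times> (real ^ 'd) \<Rightarrow> real"
  assumes K_pos: "\<And>z. z \<in> {0..1} \<Longrightarrow> 0 < K z"
    and K_decreasing: "antimono_on {0..1} K"
    and K_Lipschitz: "\<exists>L. L-lipschitz_on {0..1} K"
    and K_integral: "(K has_integral \<gamma>) {0..1}"
    and f0_density: "bounded_prob_density f\<^sub>0"
    and R_pos: "0 < R\<^sub>x" "0 < R\<^sub>v"
    and f0_supp: "ess_supp f\<^sub>0 \<subseteq> cball 0 R\<^sub>x \<times> cball 0 R\<^sub>v"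
    and T_pos: "0 < T"
  shows "\<exists>f. f \<in> Cw_Linf T \<and> weak_solution K T f\<^sub>0 f \<and>
    (\<forall>g. g \<in> Cw_Linf T \<and> weak_solution K T f\<^sub>0 g \<longrightarrow>
      (\<forall>t\<in>{0..T}. AE z in lborel. g t z = f t z)) \<and>
    (\<forall>t\<in>{0..T}. ess_supp (f t) \<subseteq> cball 0 (R\<^sub>x + t * R\<^sub>v) \<times> cball 0 R\<^sub>v)"
proof -
  let ?M = "density lborel (\<lambda>z. ennreal (f\<^sub>0 z))" and ?box = "cball (0::real^'d) R\<^sub>x \<times> cball (0::real^'d) R\<^sub>v"
  obtain L where L: "L-lipschitz_on {0..1} K" using K_Lipschitz by blast
  obtain C\<^sub>0 where C0: "0 \<le> C\<^sub>0" "\<And>B. B \<in> sets borel \<Longrightarrow> emeasure ?M B \<le> ennreal C\<^sub>0 * emeasure lborel B"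
    using emeasure_density_bound[OF f0_density] by blast
  note f0_meas[measurable] = f0_density[THEN bounded_prob_density_measurable]
  have f0_nn: "AE z in lborel. 0 \<le> f\<^sub>0 z" using f0_density by (auto simp: bounded_prob_density_def)
  have "AE z in lborel. 0 < ennreal (f\<^sub>0 z) \<longrightarrow> z \<in> ?box"
    using AE_eq_0_outside_ess_supp[of f\<^sub>0] by eventually_elim (use f0_supp in auto)
  then have supp: "AE z in ?M. z \<in> ?box"
    by (subst AE_density) auto
  interpret M: prob_space ?M by (rule prob_space_bounded_prob_density[OF f0_density])
  interpret alignment_data ?M K L C\<^sub>0 R\<^sub>x R\<^sub>v T
  proof unfold_locales
    show "AE z in ?M. norm (fst z) \<le> R\<^sub>x \<and> norm (snd z) \<le> R\<^sub>v"
      using supp by eventually_elim (auto simp: mem_Times_iff)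
  qed (use K_pos K_decreasing L C0 R_pos T_pos in auto)
  have flow_meas: "flow t \<in> borel_measurable ?M" if "t \<in> {0..T}" for t
    by (rule admissible_measurable[OF flow_admissible[OF that]])
  obtain f where f: "\<And>t. t \<in> {0..T} \<Longrightarrow> bounded_prob_density (f t)"
    and push: "\<And>t. t \<in> {0..T} \<Longrightarrow> density lborel (\<lambda>z. ennreal (f t z)) = distr ?M borel (flow t)"
    by (rule flow_density_exists) (rule that)
  have push_integral: "(\<integral>z. \<alpha> z * f t z \<partial>lborel) = (\<integral>z. \<alpha> (flow t z) \<partial>?M)"
    if "t \<in> {0..T}" "bounded_continuous \<alpha>" for t \<alpha>
    using that by (intro expectation_push f push flow_meas)
  have "f \<in> Cw_Linf T"
  proof -
    have "continuous_on {0..T} (\<lambda>t. \<integral>z. \<alpha> z * f t z \<partial>lborel)" if \<alpha>: "bounded_continuous \<alpha>" for \<alpha>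
      by (rule continuous_on_cong[THEN iffD2, OF refl push_integral[OF _ \<alpha>] flow_time_continuous[OF \<alpha>]])
    then show ?thesis unfolding Cw_Linf_def using f by blast
  qed
  moreover have "weak_solution K T f\<^sub>0 f"
    unfolding weak_solution_def
  proof (intro exI conjI ballI allI impI)
    let ?X = "\<lambda>t x v. fst (flow t (x, v))" and ?V = "\<lambda>t x v. snd (flow t (x, v))"
    show "generated_flow K T f ?X ?V"
      unfolding generated_flow_def
    proof (intro allI conjI ballI)
      fix x v :: "real^'d" and t assume t: "t \<in> {0..T}"
      have "integrable ?M (pull (flow t) (?X t x v) (?V t x v))"
        by (rule pull_integrable[OF flow_meas[OF t] admissible_AE(2)[OF flow_admissible[OF t]]])
      then show "integrable lborel (W_integrand K (marginal (f t)) (f t) (?X t x v) (?V t x v))"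
        using W_integrand_integrable_iff[OF flow_meas[OF t] f[OF t] push[OF t]] by blast
      note ode = flow_has_vector_derivative[OF t, of "(x, v)"]
      show "((\<lambda>s. ?X s x v) has_vector_derivative ?V t x v) (at t within {0..T})"
        using bounded_linear.has_vector_derivative[OF bounded_linear_fst ode] by (simp add: field_def)
      show "((\<lambda>s. ?V s x v) has_vector_derivative W_field K (marginal (f t)) (f t) (?X t x v) (?V t x v)) (at t within {0..T})"
        unfolding W_field_eq_force[OF flow_meas[OF t] f[OF t] push[OF t]]
        using bounded_linear.has_vector_derivative[OF bounded_linear_snd ode] by (simp add: field_def)
    qed (simp_all add: flow_0)
    fix t and \<alpha> :: "(real^'d) \<times> (real^'d) \<Rightarrow> real"
    assume t: "t \<in> {0..T}" and \<alpha>: "bounded_continuous \<alpha>"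
    note [measurable] = \<alpha>[THEN bounded_continuous_measurable] flow_meas[OF t]
    have "(\<lambda>z. \<alpha> (flow t z)) \<in> borel_measurable ?M" by measurable
    then have "(\<lambda>z. \<alpha> (flow t z)) \<in> borel_measurable lborel" by simp
    then have "(\<integral>z. \<alpha> (flow t z) \<partial>?M) = (\<integral>z. f\<^sub>0 z *\<^sub>R \<alpha> (flow t z) \<partial>lborel)"
      using f0_nn by (intro integral_density) auto
    then show "(\<integral>z. \<alpha> z * f t z \<partial>lborel) = (\<integral>(x, v). \<alpha> (?X t x v, ?V t x v) * f\<^sub>0 (x, v) \<partial>lborel)"
      unfolding push_integral[OF t \<alpha>] by (simp add: case_prod_unfold mult.commute)
  qed
  moreover have "AE z in lborel. g t z = f t z"
    if g_Cw: "g \<in> Cw_Linf T" and g_weak: "weak_solution K T f\<^sub>0 g" and t: "t \<in> {0..T}" for g t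
  proof -
    obtain X V where flow_g: "generated_flow K T g X V"
      and weak_g: "\<And>t \<alpha>. t \<in> {0..T} \<Longrightarrow> bounded_continuous \<alpha> \<Longrightarrow>
        (\<integral>z. \<alpha> z * g t z \<partial>lborel) = (\<integral>(x, v). \<alpha> (X t x v, V t x v) * f\<^sub>0 (x, v) \<partial>lborel)"
      using g_weak unfolding weak_solution_def by blast
    have g: "bounded_prob_density (g t)" if "t \<in> {0..T}" for t
      using g_Cw that by (auto simp: Cw_Linf_def)
    \<comment> \<open>Positivity of \<open>f\<^sub>0\<close> is what
      \<open>weak_push_forward\<close> needs in order to recover measurability; the box bounds the
      initial data in \<open>flow_unique\<close>.\<close>
    define G where "G = {z. 0 < f\<^sub>0 z} \<inter> ?box"
    have box: "?box \<in> sets borel" by (intro borel_closed closed_Times) auto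
    have pos: "{z. 0 < f\<^sub>0 z} \<in> sets borel" by measurable
    have G_borel: "G \<in> sets borel"
      unfolding G_def using pos box by (rule sets.Int)
    have "AE z in ?M. 0 < f\<^sub>0 z" by (subst AE_density) auto
    then have G_AE: "AE z in ?M. z \<in> G"
      using supp by eventually_elim (simp add: G_def)
    \<comment> \<open>\<open>X\<close> and \<open>V\<close> are not assumed measurable in the label.
      The map is set to 0 off \<open>G\<close>, an \<open>M\<close>-null change that leaves the
      push-forward untouched.\<close>
    define \<Psi> where "\<Psi> t z = indicator G z *\<^sub>R (X t (fst z) (snd z), V t (fst z) (snd z))" for t z
    have weak_g': "(\<integral>z. \<alpha> z * g t z \<partial>lborel) = (\<integral>z. \<alpha> (X t (fst z) (snd z), V t (fst z) (snd z)) * f\<^sub>0 z \<partial>lborel)"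
      if "t \<in> {0..T}" "bounded_continuous \<alpha>" for t \<alpha>
      using weak_g[OF that] by (simp add: case_prod_unfold)
    have \<Psi>_meas: "\<Psi> t \<in> borel_measurable ?M"
      and \<Psi>_push: "density lborel (\<lambda>z. ennreal (g t z)) = distr ?M borel (\<Psi> t)" if t: "t \<in> {0..T}" for t
    proof -
      have "0 < f\<^sub>0 z" if "z \<in> G" for z using that by (simp add: G_def)
      note push = weak_push_forward[OF f0_density g[OF t] G_borel G_AE this weak_g'[OF t]]
      show "\<Psi> t \<in> borel_measurable ?M"
        using push(1) by (simp add: \<Psi>_def[abs_def])
      show "density lborel (\<lambda>z. ennreal (g t z)) = distr ?M borel (\<Psi> t)"
        using push(2) by (simp add: \<Psi>_def[abs_def])
    qed
    note W_force = W_field_eq_force[OF \<Psi>_meas g \<Psi>_push] and W_int = W_integrand_integrable_iff[OF \<Psi>_meas g \<Psi>_push]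
    have \<Psi>_eq: "\<Psi> t z = flow t z" if z: "z \<in> G" and t: "t \<in> {0..T}" for z t
    proof (rule flow_unique[OF G_AE _ \<Psi>_meas _ _ _ z t])
      show "norm (fst z) \<le> R\<^sub>x \<and> norm (snd z) \<le> R\<^sub>v" if "z \<in> G" for z
        using that by (auto simp: G_def mem_Times_iff)
      show "\<Psi> 0 z = z" if "z \<in> G" for z
        using that flow_g by (simp add: \<Psi>_def generated_flow_def)
    next
      fix t assume t: "t \<in> {0..T}"
      \<comment> \<open>Any one trajectory will do: convergence of \<open>W\<close> at a single
        point yields the velocity moment by \<open>moment_integrable_of_pull\<close>.\<close>
      have "integrable lborel (W_integrand K (marginal (g t)) (g t) (X t 0 0) (V t 0 0))"
        using flow_g t unfolding generated_flow_def by blast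
      then have "integrable ?M (pull (\<Psi> t) (X t 0 0) (V t 0 0))"
        using W_int[OF t t t] by blast
      then show "integrable ?M (\<lambda>z. snd (\<Psi> t z))"
        by (rule moment_integrable_of_pull[OF \<Psi>_meas[OF t]])
    next
      fix z t assume z: "z \<in> G" and t: "t \<in> {0..T}"
      let ?x = "fst z" and ?v = "snd z"
      have "((\<lambda>s. X s ?x ?v) has_vector_derivative V t ?x ?v) (at t within {0..T})"
        "((\<lambda>s. V s ?x ?v) has_vector_derivative W_field K (marginal (g t)) (g t) (X t ?x ?v) (V t ?x ?v)) (at t within {0..T})"
        using flow_g t unfolding generated_flow_def by blast+
      then have "((\<lambda>s. (X s ?x ?v, V s ?x ?v)) has_vector_derivative
          (V t ?x ?v, force (\<Psi> t) (X t ?x ?v) (V t ?x ?v))) (at t within {0..T})"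
        unfolding W_force[OF t t t] by (rule has_vector_derivative_Pair)
      then show "((\<lambda>s. \<Psi> s z) has_vector_derivative field (\<Psi> t) (\<Psi> t z)) (at t within {0..T})"
        using z by (simp add: \<Psi>_def field_def)
    qed
    \<comment> \<open>The maps agree only on \<open>G\<close>, but \<open>G\<close> has full
      \<open>M\<close>-measure, so the push-forwards coincide and their densities agree almost
      everywhere.\<close>
    have "distr ?M borel (\<Psi> t) = distr ?M borel (flow t)"
      using \<Psi>_meas[OF t] flow_meas[OF t] G_AE \<Psi>_eq[OF _ t]
      by (intro distr_cong_AE) (auto elim: eventually_mono)
    then show ?thesis
      using f[OF t] g[OF t] \<Psi>_push[OF t] push[OF t] by (intro AE_eq_of_density_eq) auto
  qed
  moreover have "ess_supp (f t) \<subseteq> cball 0 (R\<^sub>x + t * R\<^sub>v) \<times> cball 0 R\<^sub>v" if t: "t \<in> {0..T}" for t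
  proof (rule ess_supp_subset_closed[OF f[OF t]])
    let ?S = "cball (0::real^'d) (R\<^sub>x + t * R\<^sub>v) \<times> cball (0::real^'d) R\<^sub>v"
    show "closed ?S" by (intro closed_Times) auto
    then have S: "?S \<in> sets borel" by simp
    have "AE z in ?M. flow t z \<in> ?S"
      using admissible_AE[OF flow_admissible[OF t]] by eventually_elim (simp add: mem_Times_iff)
    then show "AE z in density lborel (\<lambda>z. ennreal (f t z)). z \<in> ?S"
      unfolding push[OF t] using flow_meas[OF t] S by (subst AE_distr_iff) auto
  qed
  ultimately show ?thesis by blast
qed

end
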